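(* Let $\Omega\subseteq\mathbb{R}^N$ satisfy the standing assumptions below and let $\ell\ge2$ be an integer with $\lambda_\ell(\Omega)<\mathcal{E}(\Omega)$. Then for every $j=1,\dots,\ell$: (1) $\lambda_j(\Omega)$ is an eigenvalue of the Dirichlet Laplacian on $\Omega$, i.e. there is $u_j\in\mathcal{S}_2(\Omega)$ with $\int_\Omega\langle\nabla u_j,\nabla\varphi\rangle dx=\lambda_j(\Omega)\int_\Omega u_j\varphi\,dx$ for all $\varphi\in W^{1,2}_0(\Omega)$; the functions $u_1,\dots,u_j$ can be chosen orthonormal in $L^2(\Omega)$, and \[ \lambda_j(\Omega)=\min\Big\{\int_\Omega|\nabla u|^2dx:\ u\in\mathcal{S}_2(\Omega),\ \int_\Omega u\,u_m\,dx=0\ \text{for }m=1,\dots,j-1\Big\}, \] the minimum being attained by $u_j$; (2) with $\Omega_n$ ($n\ge r_0$) the truncated sets defined below, for every $n$ there are eigenfunctions $u^n_1,\dots,u^n_j\in\mathcal{S}_2(\Omega_n)$ of the Dirichlet Laplacian on $\Omega_n$, associated with $\lambda_1(\Omega_n),\dots,\lambda_j(\Omega_n)$, forming an orthonormal set in $L^2(\Omega_n)$, such that (extending them by zero and up to a subsequence) $\lim_{n\to\infty}\|u^n_m-u_m\|_{L^2(\Omega)}=0$ for $m=1,\dots,j$.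
   Context: Standing assumptions: $N\ge2$ and $\Omega=\Omega_0\cup\bigcup_{i=1}^k\mathcal{C}_i$ with $k\ge1$, where (A1) $\Omega_0\subseteq\mathbb{R}^N$ is a bounded open set (possibly empty); (A2) for each $i$, $\mathcal{C}_i=\mathbf{R}_i(E_i\times(0,+\infty))+\mathbf{t}_i$, where $E_i\subseteq\mathbb{R}^{N-1}$ is open, bounded and connected, $\mathbf{R}_i$ is an $N\times N$ orthogonal matrix and $\mathbf{t}_i\in\mathbb{R}^N$; (A3) there is $\varrho_0>0$ with $(\mathcal{C}_i\cap\mathcal{C}_j)\setminus B_{\varrho_0}(0)=\emptyset$ for $i\neq j$. For $r>0$ set $Q^i_r=\mathbf{R}_i((-r,r)^N)+\mathbf{t}_i$, $\Omega^i_r=\Omega_0\cup(Q^i_r\cap\mathcal{C}_i)$, $\Omega_r=\bigcup_{i=1}^k\Omega^i_r$; $r_0>0$ is fixed so large that for every $r\ge r_0$, $\Omega\setminus\Omega_r=\bigcup_{i=1}^k(\mathcal{C}_i\setminus Q^i_r)$ is a disjoint union. For an open set $A$, $W^{1,2}_0(A)$ is the closure of $C^\infty_0(A)$ in $W^{1,2}(A)$, $\mathcal{S}_2(A)=\{\varphi\in W^{1,2}_0(A):\|\varphi\|_{L^2(A)}=1\}$ and \[ \lambda_j(A)=\inf\Big\{\max_{\varphi\in F\cap\mathcal{S}_2(A)}\int_A|\nabla\varphi|^2dx:\ F\subseteq W^{1,2}_0(A)\text{ subspace},\ \dim F=j\Big\}. \] $\lambda_1(E_i)$ is the first Dirichlet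 eigenvalue of $E_i\subseteq\mathbb{R}^{N-1}$ and $\mathcal{E}(\Omega)=\min\{\lambda_1(E_1),\dots,\lambda_1(E_k)\}$. *)

theory Defs
  imports "HOL-Analysis.Analysis"
begin

definition cgrad :: "(real^'n \<Rightarrow> real) \<Rightarrow> real^'n \<Rightarrow> real^'n" where
  "cgrad f x = (\<chi> i. frechet_derivative f (at x) (axis i 1))"

coinductive smoothC :: "(real^'n \<Rightarrow> real) \<Rightarrow> bool" where
  "continuous_on UNIV f \<Longrightarrow> f differentiable_on UNIV \<Longrightarrow>
   (\<forall>i. smoothC (\<lambda>x. frechet_derivative f (at x) (axis i 1))) \<Longrightarrow> smoothC f"

definition Cc_inf :: "(real^'n) set \<Rightarrow> (real^'n \<Rightarrow> real) set" where
  "Cc_inf A = {f. smoothC f \<and> compact (closure {x. f x \<noteq> 0}) \<and> closure {x. f x \<noteq> 0} \<subseteq> A}"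

text \<open>(u,g) lies in the closure of C_c^infinity(A) in W^{1,2}: u is in L^2, g is
  in L^2 (vector valued) and there are test functions converging to u in L^2
  whose gradients converge to g in L^2. Functions are defined on all of R^N
  (extension by zero, up to a null set).\<close>
definition W0pair :: "(real^'n) set \<Rightarrow> (real^'n \<Rightarrow> real) \<Rightarrow> (real^'n \<Rightarrow> real^'n) \<Rightarrow> bool" where
  "W0pair A u g \<longleftrightarrow>
     u \<in> borel_measurable lebesgue \<and> g \<in> borel_measurable lebesgue \<and>
     integrable lebesgue (\<lambda>x. (u x)\<^sup>2) \<and> integrable lebesgue (\<lambda>x. (norm (g x))\<^sup>2) \<and>
     (\<exists>\<phi>. (\<forall>k. \<phi> k \<in> Cc_inf A) \<and>
        (\<lambda>k. LINT x|lebesgue. (\<phi> k x - u x)\<^sup>2) \<longlonglongrightarrow> 0 \<and>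
        (\<lambda>k. LINT x|lebesgue. (norm (cgrad (\<phi> k) x - g x))\<^sup>2) \<longlonglongrightarrow> 0)"

definition W0 :: "(real^'n) set \<Rightarrow> (real^'n \<Rightarrow> real) set" where
  "W0 A = {u. \<exists>g. W0pair A u g}"

definition wgrad :: "(real^'n) set \<Rightarrow> (real^'n \<Rightarrow> real) \<Rightarrow> real^'n \<Rightarrow> real^'n" where
  "wgrad A u = (SOME g. W0pair A u g)"

definition L2sq :: "(real^'n) set \<Rightarrow> (real^'n \<Rightarrow> real) \<Rightarrow> real" where
  "L2sq A u = (LINT x:A|lebesgue. (u x)\<^sup>2)"

definition L2norm :: "(real^'n) set \<Rightarrow> (real^'n \<Rightarrow> real) \<Rightarrow> real" where
  "L2norm A u = sqrt (L2sq A u)"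

definition L2inner :: "(real^'n) set \<Rightarrow> (real^'n \<Rightarrow> real) \<Rightarrow> (real^'n \<Rightarrow> real) \<Rightarrow> real" where
  "L2inner A u v = (LINT x:A|lebesgue. u x * v x)"

definition Dirichlet :: "(real^'n) set \<Rightarrow> (real^'n \<Rightarrow> real) \<Rightarrow> real" where
  "Dirichlet A u = (LINT x:A|lebesgue. (norm (wgrad A u x))\<^sup>2)"

definition S2 :: "(real^'n) set \<Rightarrow> (real^'n \<Rightarrow> real) set" where
  "S2 A = {u \<in> W0 A. L2norm A u = 1}"

text \<open>j-th min-max level: infimum over j-dimensional subspaces F of W^{1,2}_0(A)
  (elements up to a.e. equality), each given by a basis phi_0..phi_{j-1}, of the
  maximum of the Dirichlet energy on F \<inter> S_2(A).\<close>
definition lam :: "nat \<Rightarrow> (real^'n) set \<Rightarrow> real" where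
  "lam j A = Inf { Sup { Dirichlet A (\<lambda>x. \<Sum>i<j. c i * \<phi> i x) | c.
                          (\<lambda>x. \<Sum>i<j. c i * \<phi> i x) \<in> S2 A }
                 | \<phi>. (\<forall>i<j. \<phi> i \<in> W0 A) \<and>
                      (\<forall>c. (AE x in lebesgue. (\<Sum>i<j. c i * \<phi> i x) = 0) \<longrightarrow> (\<forall>i<j. c i = 0)) }"

definition eigenfun :: "(real^'n) set \<Rightarrow> real \<Rightarrow> (real^'n \<Rightarrow> real) \<Rightarrow> bool" where
  "eigenfun A mu u \<longleftrightarrow> u \<in> S2 A \<and>
     (\<forall>\<phi>\<in>W0 A. (LINT x:A|lebesgue. wgrad A u x \<bullet> wgrad A \<phi> x) = mu * L2inner A u \<phi>)"

text \<open>Embedding R^{N-1} x R into R^N = real^('m option); None is the axis coordinate.\<close>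
definition emb :: "real^('m::finite) \<Rightarrow> real \<Rightarrow> real^('m option)" where
  "emb y s = (\<chi> a. case a of None \<Rightarrow> s | Some b \<Rightarrow> y $ b)"

definition cyl :: "(real^('m::finite)) set \<Rightarrow> real^('m option)^('m option) \<Rightarrow> real^('m option) \<Rightarrow> (real^('m option)) set" where
  "cyl E R t = (\<lambda>x. R *v x + t) ` {emb y s | y s. y \<in> E \<and> s > 0}"

definition cube :: "real \<Rightarrow> real^('m::finite option)^('m option) \<Rightarrow> real^('m option) \<Rightarrow> (real^('m option)) set" where
  "cube r R t = (\<lambda>x. R *v x + t) ` {x. \<forall>a. \<bar>x $ a\<bar> < r}"

end

theory Submission
  imports Defs
begin

text \<open>
  No weak convergence is used. Write \<open>ip\<close> for the \<open>L\<^sup>2\<close> product and \<open>en\<close> for the Dirichlet form. If a space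
  satisfies \<open>\<mu> * ip u u \<le> en u u + C * (\<Sum>i<M. (f i u)\<^sup>2)\<close> with finitely many bounded functionals \<open>f i\<close>, then a
  sequence whose differences satisfy \<open>en w \<le> \<nu> * ip w w + o(1)\<close> with \<open>\<nu> < \<mu>\<close> has a Cauchy subsequence: pass to a
  subsequence along which the finitely many numbers \<open>f i (u n)\<close> converge. By the parallelogram law this applies to
  minimising sequences at each level below \<open>\<mu>\<close>; testing the eigenvalue equation on \<open>\<Omega>\<^sub>m\<close> with an eigenfunction of
  the smaller set \<open>\<Omega>\<^sub>n\<close>, it also applies to the eigenfunctions of the truncated sets.

  For \<open>\<Omega>\<close> the estimate holds for every \<open>\<mu>\<close> below the smallest first eigenvalue of the cross sections: on the ends
  it is the Rayleigh quotient of the slices, and on the remaining bounded part it is Poincare's inequality on a fine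
  grid of cubes, the functionals being the integrals over the cubes.
\<close>

section \<open>Bilinear forms and min-max levels\<close>

text \<open>The embedding of \<open>W0 \<Omega>\<close> into L2 is not compact, since mass can
  escape along the cylinders. Escaping mass costs at least the smallest first cross-sectional
  eigenvalue per unit of mass, so compactness survives for levels strictly below that threshold.
  Eigenvalues may coincide, so eigenfunctions of the truncated sets need not approach a basis fixed
  beforehand. The system on \<Omega> in both claims is therefore defined as the limit of the
  truncated ones; its minimality is recovered afterwards, because every orthonormal system of
  eigenvectors for the successive levels has it. A separately constructed system serves to show that
  the levels converge. A slice of a test function must vanish near the boundary of the cross section
  before the Rayleigh quotient applies. Other pieces of \<Omega> could cross the lateral boundary of
  a cylinder; the disjointness beyond \<open>r0\<close> excludes this on the ends. Functions are not
  identified up to null sets, so the abstract part works with semidefinite forms; real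
  \<open>Sup\<close> and \<open>Inf\<close> require every set to be shown bounded and
  nonempty.\<close>

lemma homogeneous_system_nontrivial:
  fixes a :: "nat \<Rightarrow> nat \<Rightarrow> real"
  assumes "m < n"
  shows "\<exists>c. (\<exists>i<n. c i \<noteq> 0) \<and> (\<forall>k<m. (\<Sum>i<n. c i * a k i) = 0)"
  using assms
proof (induction m arbitrary: n a)
  case 0
  then show ?case by (intro exI[of _ "\<lambda>_. 1"]) auto
next
  case (Suc m)
  then obtain n' where n: "n = Suc n'" "m < n'" by (cases n) auto
  show ?case
  proof (cases "\<forall>i<n. a m i = 0")
    case True
    from Suc.IH[of n a] Suc.prems obtain c where "\<exists>i<n. c i \<noteq> 0"
      "\<forall>k<m. (\<Sum>i<n. c i * a k i) = 0" by auto
    then show ?thesis using True by (intro exI[of _ c]) (auto simp: less_Suc_eq)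
  next
    case False
    then obtain p where p: "p < n" "a m p \<noteq> 0" by auto
    \<comment> \<open>Swaps the pivot column \<open>p\<close> with the last column
      \<open>n'\<close>, so that the pivot of row \<open>m\<close> stands last and the induction
      hypothesis can be used on the first \<open>n'\<close> columns.\<close>
    define s where "s i = (if i = p then n' else if i = n' then p else i)" for i
    define a' where "a' k i = a k (s i)" for k i
    have bij: "bij_betw s {..<n} {..<n}"
      using p n by (intro bij_betw_byWitness[where f' = s]) (auto simp: s_def)
    have pv: "a' m n' \<noteq> 0" using p by (auto simp: a'_def s_def)
    \<comment> \<open>Gaussian elimination: row \<open>m\<close> clears the last column of the other
      rows, which leaves \<open>m\<close> equations in \<open>n' > m\<close> unknowns.\<close>
    from Suc.IH[OF n(2), of "\<lambda>k i. a' k i - a' k n' * a' m i / a' m n'"] obtain c where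
      c: "\<exists>i<n'. c i \<noteq> 0" "\<forall>k<m. (\<Sum>i<n'. c i * (a' k i - a' k n' * a' m i / a' m n')) = 0"
      by auto
    \<comment> \<open>The last unknown is recovered from row \<open>m\<close>; the elimination makes
      the remaining equations hold as well.\<close>
    define d where "d i = (if i = n' then - (\<Sum>i<n'. c i * a' m i) / a' m n' else c i)" for i
    have sd: "(\<Sum>i<n. d i * a' k i) = (\<Sum>i<n'. c i * a' k i) - (\<Sum>i<n'. c i * a' m i) / a' m n' * a' k n'" for k
      by (simp add: n d_def)
    have "(\<Sum>i<n. d i * a' k i) = 0" if "k < Suc m" for k
    proof (cases "k = m")
      case True
      then show ?thesis using pv by (simp add: sd)
    next
      case False
      then have "k < m" using that by simp
      then have "(\<Sum>i<n'. c i * (a' k i - a' k n' * a' m i / a' m n')) = 0" using c by blast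
      moreover have "(\<Sum>i<n'. c i * (a' k i - a' k n' * a' m i / a' m n'))
        = (\<Sum>i<n'. c i * a' k i) - (\<Sum>i<n'. c i * a' m i) / a' m n' * a' k n'"
        by (simp add: right_diff_distrib sum_subtractf sum_distrib_right sum_divide_distrib mult_ac times_divide_eq_right)
          (simp add: sum_distrib_left mult_ac)
      ultimately show ?thesis by (simp add: sd)
    qed
    moreover have "(\<Sum>i<n. d (s i) * a k i) = (\<Sum>i<n. d i * a' k i)" for k
    proof -
      have "(\<Sum>i<n. d (s i) * a k i) = (\<Sum>i<n. d (s (s i)) * a k (s i))"
        using sum.reindex_bij_betw[OF bij, of "\<lambda>i. d (s i) * a k i"] by simp
      also have "\<dots> = (\<Sum>i<n. d i * a' k i)" by (intro sum.cong) (auto simp: a'_def s_def)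
      finally show ?thesis .
    qed
    moreover obtain i where "i < n'" "c i \<noteq> 0" using c by auto
    then have "s i < n" "d (s (s i)) \<noteq> 0" using n p by (auto simp: s_def d_def)
    ultimately show ?thesis by (intro exI[of _ "\<lambda>i. d (s i)"]) auto
  qed
qed

text \<open>The subsequence is refined once per index; since the family is finite, this ends without
  a diagonal sequence.\<close>

lemma bounded_finite_family_convergent_subseq:
  fixes a :: "nat \<Rightarrow> nat \<Rightarrow> real"
  assumes "\<And>i n. i < M \<Longrightarrow> \<bar>a i n\<bar> \<le> K"
  shows "\<exists>r. strict_mono (r :: nat \<Rightarrow> nat) \<and> (\<forall>i<M. convergent (\<lambda>n. a i (r n)))"
  using assms
proof (induction M)
  case 0
  then show ?case by (intro exI[of _ id]) (auto simp: strict_mono_def)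
next
  case (Suc M)
  then obtain r where r: "strict_mono r" "\<forall>i<M. convergent (\<lambda>n. a i (r n))" by auto
  have "bounded (range (\<lambda>n. a M (r n)))"
    using Suc.prems[of M] by (intro boundedI[of _ K]) auto
  then obtain l s where s: "strict_mono s" "((\<lambda>n. a M (r n)) \<circ> s) \<longlonglongrightarrow> l"
    using bounded_imp_convergent_subsequence by blast
  have "convergent (\<lambda>n. a i ((r \<circ> s) n))" if "i < Suc M" for i
  proof (cases "i = M")
    case True
    then show ?thesis using s by (auto simp: convergent_def o_def)
  next
    case False
    then have "convergent (\<lambda>n. a i (r n))" using r that by auto
    then show ?thesis using convergent_subseq_convergent[OF _ s(1)] by (force simp: o_def)
  qed
  then show ?case using r s by (intro exI[of _ "r \<circ> s"]) (auto simp: strict_mono_def)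
qed

text \<open>A nonnegative quadratic polynomial has nonpositive discriminant;
  \<open>c \<ge> 0\<close> is itself a consequence. It yields Cauchy-Schwarz for the abstract forms
  and for square integrable functions and, with \<open>a = 0\<close>, the Euler-Lagrange equation of
  a minimiser.\<close>

lemma psd_2x2_det:
  fixes a b c :: real
  assumes "\<And>t. a + 2 * t * b + t\<^sup>2 * c \<ge> 0"
  shows "b\<^sup>2 \<le> a * c"
proof (cases "c = 0")
  case True
  have "b = 0"
  proof (rule ccontr)
    assume "b \<noteq> 0"
    then have "a + 2 * (- (a + 1) / (2 * b)) * b = -1" by (simp add: field_simps)
    then show False using assms[of "- (a + 1) / (2 * b)"] True by simp
  qed
  then show ?thesis using True by simp
next
  case False
  have "c > 0"
  proof (rule ccontr)
    assume "\<not> c > 0"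
    then have c: "c < 0" using False by simp
    \<comment> \<open>Large enough that \<open>t * c\<close> outweighs
      \<open>\<bar>a\<bar> + 2 * \<bar>b\<bar>\<close>; the summand 1 gives
      \<open>t \<ge> 1\<close>, hence \<open>\<bar>a\<bar> \<le> t * \<bar>a\<bar>\<close>.\<close>
    define t where "t = (\<bar>a\<bar> + 2 * \<bar>b\<bar> + 1) / (-c) + 1"
    have t1: "t \<ge> 1" using c divide_nonneg_neg[of "\<bar>a\<bar> + 2 * \<bar>b\<bar> + 1" c] by (simp add: t_def)
    have tc: "t * c = - (\<bar>a\<bar> + 2 * \<bar>b\<bar> + 1) + c" using c by (simp add: t_def field_simps)
    have "a + 2 * t * b + t\<^sup>2 * c \<le> t * \<bar>a\<bar> + 2 * t * \<bar>b\<bar> + t * (t * c)"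
      using t1 mult_right_mono[of 1 t "\<bar>a\<bar>"] by (auto simp: power2_eq_square intro!: add_mono mult_left_mono)
    also have "\<dots> = t * (\<bar>a\<bar> + 2 * \<bar>b\<bar> + t * c)" by (simp add: algebra_simps)
    also have "\<dots> = t * (c - 1)" by (simp add: tc)
    also have "\<dots> < 0" using t1 c by (simp add: mult_pos_neg)
    finally show False using assms[of t] by simp
  qed
  have "a + 2 * (-b/c) * b + (-b/c)\<^sup>2 * c = a - b\<^sup>2 / c"
    using False by (simp add: field_simps power2_eq_square)
  then have "a - b\<^sup>2 / c \<ge> 0" using assms[of "-b/c"] by simp
  then show ?thesis using \<open>c > 0\<close> by (simp add: field_simps)
qed

lemma square_diff_le_twice: "(a - b)\<^sup>2 \<le> 2 * a\<^sup>2 + 2 * b\<^sup>2" for a b :: real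
  using zero_le_power2[of "a + b"] by (simp add: power2_sum power2_diff)

section \<open>Positive semidefinite forms on a space of functions\<close>

abbreviation lincomb :: "nat \<Rightarrow> (nat \<Rightarrow> real) \<Rightarrow> (nat \<Rightarrow> 'x \<Rightarrow> real) \<Rightarrow> 'x \<Rightarrow> real" where
  "lincomb n c \<phi> \<equiv> (\<lambda>x. \<Sum>i<n. c i * \<phi> i x)"

abbreviation sqdist :: "(('x \<Rightarrow> real) \<Rightarrow> ('x \<Rightarrow> real) \<Rightarrow> real) \<Rightarrow> ('x \<Rightarrow> real) \<Rightarrow> ('x \<Rightarrow> real) \<Rightarrow> real" where
  "sqdist b u v \<equiv> b (\<lambda>x. u x - v x) (\<lambda>x. u x - v x)"

text \<open>Semidefinite because the elements are functions and not classes modulo null sets: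
  \<open>b u u = 0\<close> does not make \<open>u\<close> zero. Vectors are kept as functions so
  that the sums in the definition of \<open>lam\<close> are themselves elements of
  \<open>H\<close>.\<close>

locale psd =
  fixes H :: "('x \<Rightarrow> real) set" and b :: "('x \<Rightarrow> real) \<Rightarrow> ('x \<Rightarrow> real) \<Rightarrow> real"
  assumes H_zero [simp, intro]: "(\<lambda>x. 0) \<in> H"
    and H_lin: "\<And>u v \<alpha> \<beta>. u \<in> H \<Longrightarrow> v \<in> H \<Longrightarrow> (\<lambda>x. \<alpha> * u x + \<beta> * v x) \<in> H"
    and lin: "\<And>u v w \<alpha> \<beta>. u \<in> H \<Longrightarrow> v \<in> H \<Longrightarrow> w \<in> H \<Longrightarrow>
          b (\<lambda>x. \<alpha> * u x + \<beta> * v x) w = \<alpha> * b u w + \<beta> * b v w"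
    and sym: "\<And>u v. u \<in> H \<Longrightarrow> v \<in> H \<Longrightarrow> b u v = b v u"
    and nonneg: "\<And>u. u \<in> H \<Longrightarrow> b u u \<ge> 0"
begin

lemma H_scale [simp, intro]: "u \<in> H \<Longrightarrow> (\<lambda>x. \<alpha> * u x) \<in> H"
  using H_lin[of u u \<alpha> 0] by simp
lemma H_add [simp, intro]: "u \<in> H \<Longrightarrow> v \<in> H \<Longrightarrow> (\<lambda>x. u x + v x) \<in> H"
  using H_lin[of u v 1 1] by simp
lemma H_diff [simp, intro]: "u \<in> H \<Longrightarrow> v \<in> H \<Longrightarrow> (\<lambda>x. u x - v x) \<in> H"
  using H_lin[of u v 1 "-1"] by simp
lemma H_sum [simp, intro]:
  "(\<And>i. i < (n::nat) \<Longrightarrow> \<phi> i \<in> H) \<Longrightarrow> (lincomb n c \<phi>) \<in> H"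
  by (induction n) auto

lemma scale_left: "u \<in> H \<Longrightarrow> w \<in> H \<Longrightarrow> b (\<lambda>x. \<alpha> * u x) w = \<alpha> * b u w"
  using lin[of u u w \<alpha> 0] by simp
lemma scale_right: "u \<in> H \<Longrightarrow> w \<in> H \<Longrightarrow> b w (\<lambda>x. \<alpha> * u x) = \<alpha> * b w u"
  using scale_left[of u w \<alpha>] by (simp add: sym[of w])
lemma add_left: "u \<in> H \<Longrightarrow> v \<in> H \<Longrightarrow> w \<in> H \<Longrightarrow> b (\<lambda>x. u x + v x) w = b u w + b v w"
  using lin[of u v w 1 1] by simp
lemma add_right: "u \<in> H \<Longrightarrow> v \<in> H \<Longrightarrow> w \<in> H \<Longrightarrow> b w (\<lambda>x. u x + v x) = b w u + b w v"
  using add_left[of u v w] by (simp add: sym[of w])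
lemma diff_left: "u \<in> H \<Longrightarrow> v \<in> H \<Longrightarrow> w \<in> H \<Longrightarrow> b (\<lambda>x. u x - v x) w = b u w - b v w"
  using lin[of u v w 1 "-1"] by simp
lemma diff_right: "u \<in> H \<Longrightarrow> v \<in> H \<Longrightarrow> w \<in> H \<Longrightarrow> b w (\<lambda>x. u x - v x) = b w u - b w v"
  using diff_left[of u v w] by (simp add: sym[of w])
lemma zero_left: "w \<in> H \<Longrightarrow> b (\<lambda>x. 0) w = 0"
  using lin[of w w w 0 0] by simp
lemma zero_right: "w \<in> H \<Longrightarrow> b w (\<lambda>x. 0) = 0"
  using zero_left[of w] by (simp add: sym[of w])
lemma sum_left:
  "(\<And>i. i < (n::nat) \<Longrightarrow> \<phi> i \<in> H) \<Longrightarrow> w \<in> H \<Longrightarrow> b (lincomb n c \<phi>) w = (\<Sum>i<n. c i * b (\<phi> i) w)"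
  by (induction n) (auto simp: zero_left add_left scale_left)
lemma sum_right:
  assumes "\<And>i. i < (n::nat) \<Longrightarrow> \<phi> i \<in> H" "w \<in> H"
  shows "b w (lincomb n c \<phi>) = (\<Sum>i<n. c i * b w (\<phi> i))"
proof -
  have "(lincomb n c \<phi>) \<in> H" using assms by auto
  then have "b w (lincomb n c \<phi>) = b (lincomb n c \<phi>) w"
    using assms by (simp add: sym)
  also have "\<dots> = (\<Sum>i<n. c i * b w (\<phi> i))"
    using assms by (subst sum_left) (auto intro!: sum.cong simp: sym)
  finally show ?thesis .
qed

lemmas expand = add_left add_right diff_left diff_right scale_left scale_right zero_left zero_right

lemma square_scale: "u \<in> H \<Longrightarrow> b (\<lambda>x. \<alpha> * u x) (\<lambda>x. \<alpha> * u x) = \<alpha>\<^sup>2 * b u u"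
  by (simp add: expand power2_eq_square)
lemma square_add: "u \<in> H \<Longrightarrow> v \<in> H \<Longrightarrow> b (\<lambda>x. u x + v x) (\<lambda>x. u x + v x) = b u u + 2 * b u v + b v v"
  by (simp add: expand sym[of v u])
lemma square_diff: "u \<in> H \<Longrightarrow> v \<in> H \<Longrightarrow> sqdist b u v = b u u - 2 * b u v + b v v"
  by (simp add: expand sym[of v u])
lemma square_diff_commute: "u \<in> H \<Longrightarrow> v \<in> H \<Longrightarrow>
    sqdist b u v = sqdist b v u"
  by (simp add: square_diff sym[of u v])
lemma square_add_scale: "u \<in> H \<Longrightarrow> v \<in> H \<Longrightarrow>
   b (\<lambda>x. u x + \<alpha> * v x) (\<lambda>x. u x + \<alpha> * v x) = b u u + 2 * \<alpha> * b u v + \<alpha>\<^sup>2 * b v v"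
  by (simp add: square_add square_scale scale_right)

lemma cauchy_schwarz: assumes "u \<in> H" "v \<in> H" shows "(b u v)\<^sup>2 \<le> b u u * b v v"
proof (rule psd_2x2_det)
  fix t
  show "b u u + 2 * t * b u v + t\<^sup>2 * b v v \<ge> 0"
    using nonneg[of "\<lambda>x. u x + t * v x"] assms by (simp add: square_add_scale)
qed

lemma cauchy_schwarz_abs: assumes "u \<in> H" "v \<in> H" shows "\<bar>b u v\<bar> \<le> sqrt (b u u) * sqrt (b v v)"
  using real_sqrt_le_mono[OF cauchy_schwarz[OF assms]] by (simp add: real_sqrt_mult)

lemma square_diff_le: assumes "u \<in> H" "v \<in> H"
  shows "sqdist b u v \<le> 2 * b u u + 2 * b v v"
  using nonneg[of "\<lambda>x. u x + v x"] assms by (simp add: square_add square_diff)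

lemma sqrt_triangle: assumes "u \<in> H" "v \<in> H"
  shows "\<bar>sqrt (b u u) - sqrt (b v v)\<bar> \<le> sqrt (sqdist b u v)"
proof (rule real_le_rsqrt)
  have "b u v \<le> sqrt (b u u) * sqrt (b v v)" using cauchy_schwarz_abs[OF assms] by simp
  then show "\<bar>sqrt (b u u) - sqrt (b v v)\<bar>\<^sup>2 \<le> sqdist b u v"
    using assms nonneg by (simp add: square_diff power2_diff)
qed

definition conv :: "(nat \<Rightarrow> 'x \<Rightarrow> real) \<Rightarrow> ('x \<Rightarrow> real) \<Rightarrow> bool" where
  "conv u v \<longleftrightarrow> (\<lambda>n. sqdist b (u n) v) \<longlonglongrightarrow> 0"

lemma conv_square: assumes "\<And>n. u n \<in> H" "v \<in> H" "conv u v"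
  shows "(\<lambda>n. b (u n) (u n)) \<longlonglongrightarrow> b v v"
proof -
  have "(\<lambda>n. sqrt (sqdist b (u n) v)) \<longlonglongrightarrow> 0"
    using tendsto_real_sqrt[OF assms(3)[unfolded conv_def]] by simp
  then have "(\<lambda>n. sqrt (b (u n) (u n)) - sqrt (b v v)) \<longlonglongrightarrow> 0"
    by (rule Lim_null_comparison[rotated]) (use sqrt_triangle assms in auto)
  then have "(\<lambda>n. sqrt (b (u n) (u n))) \<longlonglongrightarrow> sqrt (b v v)" by (simp add: LIM_zero_iff)
  then have "(\<lambda>n. (sqrt (b (u n) (u n)))\<^sup>2) \<longlonglongrightarrow> (sqrt (b v v))\<^sup>2" by (rule tendsto_power)
  then show ?thesis using assms nonneg by simp
qed

lemma conv_inner: assumes "\<And>n. u n \<in> H" "v \<in> H" "conv u v" "w \<in> H"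
  shows "(\<lambda>n. b (u n) w) \<longlonglongrightarrow> b v w"
proof -
  have "(\<lambda>n. sqrt (sqdist b (u n) v) * sqrt (b w w)) \<longlonglongrightarrow> 0"
    using tendsto_mult_left_zero[OF tendsto_real_sqrt[OF assms(3)[unfolded conv_def], simplified]] .
  then have "(\<lambda>n. b (u n) w - b v w) \<longlonglongrightarrow> 0"
  proof (rule Lim_null_comparison[rotated])
    have "\<bar>b (u n) w - b v w\<bar> \<le> sqrt (sqdist b (u n) v) * sqrt (b w w)" for n
      using cauchy_schwarz_abs[of "\<lambda>x. u n x - v x" w] assms by (simp add: diff_left H_diff)
    then show "\<forall>\<^sub>F n in sequentially. norm (b (u n) w - b v w)
        \<le> sqrt (sqdist b (u n) v) * sqrt (b w w)" by simp
  qed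
  then show ?thesis by (simp add: LIM_zero_iff)
qed

lemma conv_inner2: assumes "\<And>n. u n \<in> H" "v \<in> H" "conv u v" "\<And>n. u' n \<in> H" "v' \<in> H" "conv u' v'"
  shows "(\<lambda>n. b (u n) (u' n)) \<longlonglongrightarrow> b v v'"
proof -
  \<comment> \<open>The second argument is split into its limit and the error
    \<open>u' n - v'\<close>; the factor \<open>b (u n) (u n)\<close> in front of the error stays
    bounded because it converges.\<close>
  have "(\<lambda>n. b (u n) v') \<longlonglongrightarrow> b v v'" using conv_inner assms by auto
  moreover have "(\<lambda>n. b (u n) (\<lambda>x. u' n x - v' x)) \<longlonglongrightarrow> 0"
  proof (rule Lim_null_comparison)
    show "\<forall>\<^sub>F n in sequentially. norm (b (u n) (\<lambda>x. u' n x - v' x))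
        \<le> sqrt (b (u n) (u n)) * sqrt (sqdist b (u' n) v')"
      using cauchy_schwarz_abs assms by auto
    show "(\<lambda>n. sqrt (b (u n) (u n)) * sqrt (sqdist b (u' n) v')) \<longlonglongrightarrow> 0"
      using tendsto_mult[OF tendsto_real_sqrt[OF conv_square[OF assms(1-3)]]
          tendsto_real_sqrt[OF assms(6)[unfolded conv_def]]] by simp
  qed
  ultimately have "(\<lambda>n. b (u n) v' + b (u n) (\<lambda>x. u' n x - v' x)) \<longlonglongrightarrow> b v v' + 0"
    by (rule tendsto_add)
  then show ?thesis using assms by (simp add: diff_right)
qed

lemma conv_subseq: "conv u v \<Longrightarrow> strict_mono r \<Longrightarrow> conv (\<lambda>n. u (r n)) v"
  unfolding conv_def using LIMSEQ_subseq_LIMSEQ[of _ 0 r] by (force simp: o_def)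


lemma sqrt_add_le: assumes "u \<in> H" "v \<in> H"
  shows "sqrt (b (\<lambda>x. u x + v x) (\<lambda>x. u x + v x)) \<le> sqrt (b u u) + sqrt (b v v)"
proof (rule real_le_lsqrt)
  have "b u v \<le> sqrt (b u u) * sqrt (b v v)" using cauchy_schwarz_abs[OF assms] by simp
  then show "b (\<lambda>x. u x + v x) (\<lambda>x. u x + v x) \<le> (sqrt (b u u) + sqrt (b v v))\<^sup>2"
    using assms nonneg by (simp add: square_add power2_sum)
qed (use assms nonneg in auto)

lemma sqrt_sum_le: assumes "\<And>i. i < (n::nat) \<Longrightarrow> \<phi> i \<in> H"
  shows "sqrt (b (lincomb n c \<phi>) (lincomb n c \<phi>)) \<le> (\<Sum>i<n. \<bar>c i\<bar> * sqrt (b (\<phi> i) (\<phi> i)))"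
  using assms
proof (induction n)
  case 0
  then show ?case by (simp add: zero_left)
next
  case (Suc n)
  have "sqrt (b (\<lambda>x. c n * \<phi> n x) (\<lambda>x. c n * \<phi> n x)) = \<bar>c n\<bar> * sqrt (b (\<phi> n) (\<phi> n))"
    using Suc.prems by (simp add: square_scale real_sqrt_mult)
  then show ?case using Suc sqrt_add_le[of "\<lambda>x. \<Sum>i<n. c i * \<phi> i x" "\<lambda>x. c n * \<phi> n x"] by (simp add: H_sum)
qed

lemma square_sum: assumes "\<And>i. i < (n::nat) \<Longrightarrow> \<phi> i \<in> H"
  shows "b (lincomb n c \<phi>) (lincomb n c \<phi>) = (\<Sum>i<n. \<Sum>k<n. c i * c k * b (\<phi> i) (\<phi> k))"
  using assms by (simp add: sum_left sum_right H_sum sum_distrib_left mult_ac)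

end

section \<open>Two forms on one space: mass \<open>ip\<close> and energy \<open>en\<close>\<close>

locale hform = ip: psd H ip + en: psd H en
  for H :: "('x \<Rightarrow> real) set" and ip en :: "('x \<Rightarrow> real) \<Rightarrow> ('x \<Rightarrow> real) \<Rightarrow> real"
begin

definition subsp :: "('x \<Rightarrow> real) set \<Rightarrow> bool" where
  "subsp V \<longleftrightarrow> V \<subseteq> H \<and> (\<lambda>x. 0) \<in> V \<and> (\<forall>u\<in>V. \<forall>v\<in>V. \<forall>\<alpha> \<beta>. (\<lambda>x. \<alpha> * u x + \<beta> * v x) \<in> V)"

definition conv :: "(nat \<Rightarrow> 'x \<Rightarrow> real) \<Rightarrow> ('x \<Rightarrow> real) \<Rightarrow> bool" where
  "conv u v \<longleftrightarrow> ip.conv u v \<and> en.conv u v"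

definition Cauchy_seq :: "(nat \<Rightarrow> 'x \<Rightarrow> real) \<Rightarrow> bool" where
  "Cauchy_seq u \<longleftrightarrow> (\<forall>e>0. \<exists>N. \<forall>m\<ge>N. \<forall>n\<ge>N.
      sqdist ip (u m) (u n) < e \<and> sqdist en (u m) (u n) < e)"

text \<open>Completeness in the combined seminorm of \<open>ip\<close> and \<open>en\<close>: the
  limit has to exist in \<open>V\<close>, so completeness of \<open>H\<close> is not
  presupposed.\<close>

definition closed_subsp :: "('x \<Rightarrow> real) set \<Rightarrow> bool" where
  "closed_subsp V \<longleftrightarrow> subsp V \<and> (\<forall>u. (\<forall>n. u n \<in> V) \<longrightarrow> Cauchy_seq u \<longrightarrow> (\<exists>v\<in>V. conv u v))"

definition functional :: "(('x \<Rightarrow> real) \<Rightarrow> real) \<Rightarrow> bool" where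
  "functional f \<longleftrightarrow> (\<forall>u\<in>H. \<forall>v\<in>H. f (\<lambda>x. u x - v x) = f u - f v) \<and>
      (\<exists>K\<ge>0. \<forall>u\<in>H. \<bar>f u\<bar> \<le> K * sqrt (ip u u))"

text \<open>Up to finitely many directions the energy dominates \<open>\<mu>\<close> times the mass:
  the quadratic form version of the essential spectrum lying at or above \<open>\<mu>\<close>.
  Holding for every \<open>\<mu>\<close> amounts to compactness, the situation on bounded
  sets.\<close>

definition coercive :: "('x \<Rightarrow> real) set \<Rightarrow> real \<Rightarrow> bool" where
  "coercive V \<mu> \<longleftrightarrow> (\<exists>M f C. (\<forall>i<M. functional (f i)) \<and> C \<ge> 0 \<and>
      (\<forall>u\<in>V. \<mu> * ip u u \<le> en u u + C * (\<Sum>i<(M::nat). (f i u)\<^sup>2)))"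

text \<open>Independence modulo vectors of mass zero, which in the application are the functions
  vanishing almost everywhere.\<close>

definition indep :: "nat \<Rightarrow> (nat \<Rightarrow> 'x \<Rightarrow> real) \<Rightarrow> bool" where
  "indep j \<phi> \<longleftrightarrow> (\<forall>c. ip (lincomb j c \<phi>) (lincomb j c \<phi>) = 0 \<longrightarrow> (\<forall>i<j. c i = 0))"

definition levels :: "nat \<Rightarrow> (nat \<Rightarrow> 'x \<Rightarrow> real) \<Rightarrow> real set" where
  "levels j \<phi> = {en (lincomb j c \<phi>) (lincomb j c \<phi>) | c.
      ip (lincomb j c \<phi>) (lincomb j c \<phi>) = 1}"

definition minmax :: "nat \<Rightarrow> ('x \<Rightarrow> real) set \<Rightarrow> real" where
  "minmax j V = Inf {Sup (levels j \<phi>) | \<phi>. (\<forall>i<j. \<phi> i \<in> V) \<and> indep j \<phi>}"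

text \<open>Indices start at 0, so \<open>e i\<close> belongs to the level
  \<open>minmax (Suc i) V\<close>. The eigenvalues are not free parameters but the min-max levels in
  their order, with multiplicity.\<close>

definition eigsys :: "('x \<Rightarrow> real) set \<Rightarrow> nat \<Rightarrow> (nat \<Rightarrow> 'x \<Rightarrow> real) \<Rightarrow> bool" where
  "eigsys V j e \<longleftrightarrow> (\<forall>i<j. e i \<in> V) \<and> (\<forall>i<j. \<forall>k<j. ip (e i) (e k) = (if i = k then 1 else 0)) \<and>
      (\<forall>i<j. \<forall>\<phi>\<in>V. en (e i) \<phi> = minmax (Suc i) V * ip (e i) \<phi>)"

lemma subspD: assumes "subsp V"
  shows "V \<subseteq> H" "(\<lambda>x. 0) \<in> V" "u \<in> V \<Longrightarrow> (\<lambda>x. \<alpha> * u x) \<in> V"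
    "u \<in> V \<Longrightarrow> v \<in> V \<Longrightarrow> (\<lambda>x. u x + v x) \<in> V" "u \<in> V \<Longrightarrow> v \<in> V \<Longrightarrow> (\<lambda>x. u x - v x) \<in> V"
    "u \<in> V \<Longrightarrow> u \<in> H"
proof -
  have L: "(\<lambda>x. \<alpha> * u x + \<beta> * v x) \<in> V" if "u \<in> V" "v \<in> V" for u v \<alpha> \<beta>
    using assms that by (auto simp: subsp_def)
  show "V \<subseteq> H" "(\<lambda>x. 0) \<in> V" "u \<in> V \<Longrightarrow> u \<in> H" using assms by (auto simp: subsp_def)
  show "u \<in> V \<Longrightarrow> (\<lambda>x. \<alpha> * u x) \<in> V" using L[of u u \<alpha> 0] by simp
  show "u \<in> V \<Longrightarrow> v \<in> V \<Longrightarrow> (\<lambda>x. u x + v x) \<in> V" using L[of u v 1 1] by simp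
  show "u \<in> V \<Longrightarrow> v \<in> V \<Longrightarrow> (\<lambda>x. u x - v x) \<in> V" using L[of u v 1 "-1"] by simp
qed

lemma subsp_sum: assumes "subsp V" "\<And>i. i < (n::nat) \<Longrightarrow> \<phi> i \<in> V"
  shows "(lincomb n c \<phi>) \<in> V"
  using assms(2) by (induction n) (simp_all add: subspD(2-4)[OF assms(1)])

lemma closed_subspD: "closed_subsp V \<Longrightarrow> subsp V" by (simp add: closed_subsp_def)

lemma closed_subsp_limit:
  "closed_subsp V \<Longrightarrow> (\<And>n. u n \<in> V) \<Longrightarrow> Cauchy_seq u \<Longrightarrow> \<exists>v\<in>V. conv u v"
  unfolding closed_subsp_def by simp

lemma functional_diff: "functional f \<Longrightarrow> u \<in> H \<Longrightarrow> v \<in> H \<Longrightarrow> f (\<lambda>x. u x - v x) = f u - f v"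
  unfolding functional_def by blast

lemma conv_subseq: "conv u v \<Longrightarrow> strict_mono r \<Longrightarrow> conv (\<lambda>n. u (r n)) v"
  by (simp add: conv_def ip.conv_subseq en.conv_subseq)

text \<open>Compactness enters only here: below \<open>\<mu>\<close>, the finitely many functionals of a coercivity estimate
  control the \<open>ip\<close>-norm of the differences.\<close>
lemma coercive_Cauchy_subseq:
  assumes V: "subsp V" and co: "coercive V \<mu>" and "\<nu> < \<mu>" and uV: "\<And>n. u n \<in> V"
    and uB: "\<And>n. ip (u n) (u n) \<le> B" and d0: "\<delta> \<longlonglongrightarrow> 0"
    and le: "\<And>m n. sqdist en (u m) (u n)
       \<le> \<nu> * sqdist ip (u m) (u n) + \<delta> m + \<delta> n"
  shows "\<exists>r. strict_mono r \<and> Cauchy_seq (\<lambda>n. u (r n))"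
proof -
  obtain M f C where f: "\<And>i. i < M \<Longrightarrow> functional (f i)" and C: "C \<ge> 0"
    and coe: "\<And>u. u \<in> V \<Longrightarrow> \<mu> * ip u u \<le> en u u + C * (\<Sum>i<(M::nat). (f i u)\<^sup>2)"
    using co unfolding coercive_def by blast
  have uH: "u n \<in> H" for n using uV subspD(6)[OF V] by blast
  have "\<forall>i. \<exists>K\<ge>0. i < M \<longrightarrow> (\<forall>n. \<bar>f i (u n)\<bar> \<le> K)"
  proof
    fix i
    show "\<exists>K\<ge>0. i < M \<longrightarrow> (\<forall>n. \<bar>f i (u n)\<bar> \<le> K)"
    proof (cases "i < M")
      case True
      then obtain K where K: "K \<ge> 0" "\<And>u. u \<in> H \<Longrightarrow> \<bar>f i u\<bar> \<le> K * sqrt (ip u u)"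
        using f[OF True] unfolding functional_def by blast
      have "\<bar>f i (u n)\<bar> \<le> K * sqrt \<bar>B\<bar>" for n
      proof -
        have "ip (u n) (u n) \<le> \<bar>B\<bar>" using uB[of n] by simp
        then have "K * sqrt (ip (u n) (u n)) \<le> K * sqrt \<bar>B\<bar>" using K(1) by (simp add: mult_left_mono)
        then show ?thesis using K(2)[OF uH[of n]] by simp
      qed
      then show ?thesis using K by (intro exI[of _ "K * sqrt \<bar>B\<bar>"]) auto
    qed auto
  qed
  then obtain K where K: "\<And>i. K i \<ge> 0" "\<And>i n. i < M \<Longrightarrow> \<bar>f i (u n)\<bar> \<le> K i" by metis
  have "\<bar>f i (u n)\<bar> \<le> (\<Sum>i<M. K i)" if "i < M" for i n
    using K(2)[OF that, of n] member_le_sum[of i "{..<M}" K] K(1) that by force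
  then obtain r where r: "strict_mono r" "\<And>i. i < M \<Longrightarrow> convergent (\<lambda>n. f i (u (r n)))"
    using bounded_finite_family_convergent_subseq[of M "\<lambda>i n. f i (u n)"] by blast
  then obtain l where l: "\<And>i. i < M \<Longrightarrow> (\<lambda>n. f i (u (r n))) \<longlonglongrightarrow> l i"
    unfolding convergent_def by metis
  \<comment> \<open>The value of \<open>f i\<close> at a difference is the difference of
    \<open>f i (u (r m)) - l i\<close> and \<open>f i (u (r n)) - l i\<close>, so the finite-rank
    term splits into one null sequence in \<open>m\<close> and one in \<open>n\<close>.\<close>
  define h where "h n = C * (\<Sum>i<M. 2 * (f i (u (r n)) - l i)\<^sup>2) + \<delta> (r n)" for n
  have "h \<longlonglongrightarrow> C * (\<Sum>i<M. 2 * (l i - l i)\<^sup>2) + 0"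
    unfolding h_def using l d0 LIMSEQ_subseq_LIMSEQ[OF d0 r(1)] by (intro tendsto_intros) (auto simp: o_def)
  then have h0: "h \<longlonglongrightarrow> 0" by simp
  define w where "w m n = (\<lambda>x. u (r m) x - u (r n) x)" for m n
  have wV: "w m n \<in> V" for m n unfolding w_def by (rule subspD(5)[OF V uV uV])
  \<comment> \<open>The upper bound with \<open>\<nu>\<close> on the energy is set against the
    coercive lower bound with \<open>\<mu>\<close>; the gap \<open>\<mu> - \<nu>\<close> remains as
    a factor of the mass.\<close>
  have key: "(\<mu> - \<nu>) * ip (w m n) (w m n) \<le> h m + h n" for m n
  proof -
    have "(f i (w m n))\<^sup>2 \<le> 2 * (f i (u (r m)) - l i)\<^sup>2 + 2 * (f i (u (r n)) - l i)\<^sup>2" if "i < M" for i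
    proof -
      have "f i (w m n) = (f i (u (r m)) - l i) - (f i (u (r n)) - l i)"
        unfolding w_def by (subst functional_diff[OF f[OF that]]) (auto simp: uH)
      then show ?thesis
        using square_diff_le_twice[of "f i (u (r m)) - l i" "f i (u (r n)) - l i"] by simp
    qed
    then have "(\<Sum>i<M. (f i (w m n))\<^sup>2) \<le> (\<Sum>i<M. 2 * (f i (u (r m)) - l i)\<^sup>2 + 2 * (f i (u (r n)) - l i)\<^sup>2)"
      by (intro sum_mono) auto
    then have "C * (\<Sum>i<M. (f i (w m n))\<^sup>2) \<le> C * (\<Sum>i<M. 2 * (f i (u (r m)) - l i)\<^sup>2 + 2 * (f i (u (r n)) - l i)\<^sup>2)"
      using C by (rule mult_left_mono)
    also have "\<dots> = h m - \<delta> (r m) + (h n - \<delta> (r n))"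
      by (simp add: h_def sum.distrib distrib_left)
    finally have "C * (\<Sum>i<M. (f i (w m n))\<^sup>2) \<le> h m - \<delta> (r m) + (h n - \<delta> (r n))" .
    moreover have "\<mu> * ip (w m n) (w m n) \<le> en (w m n) (w m n) + C * (\<Sum>i<M. (f i (w m n))\<^sup>2)"
      using coe[OF wV] .
    moreover have "en (w m n) (w m n) \<le> \<nu> * ip (w m n) (w m n) + \<delta> (r m) + \<delta> (r n)"
      using le unfolding w_def by simp
    ultimately show ?thesis by (simp add: algebra_simps)
  qed
  have "Cauchy_seq (\<lambda>n. u (r n))"
    unfolding Cauchy_seq_def
  proof (intro allI impI)
    fix e :: real assume e: "e > 0"
    \<comment> \<open>With \<open>D\<close> for the bracket, \<open>\<eta> * D = e / 2\<close>. The
      term \<open>1 / (\<mu> - \<nu>)\<close> pays for the mass, and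
      \<open>1 + \<bar>\<nu>\<bar> / (\<mu> - \<nu>)\<close> for the energy, which is at most
      \<open>\<nu>\<close> times the mass plus \<open>\<eta>\<close>.\<close>
    define \<eta> where "\<eta> = e / (2 * (1 + 1 / (\<mu> - \<nu>) + \<bar>\<nu>\<bar> / (\<mu> - \<nu>)))"
    define D where "D = 1 + 1 / (\<mu> - \<nu>) + \<bar>\<nu>\<bar> / (\<mu> - \<nu>)"
    have ml: "\<mu> - \<nu> > 0" using assms by simp
    have D: "D \<ge> 1" "1 / (\<mu> - \<nu>) \<le> D" using ml by (auto simp: D_def)
    have \<eta>: "\<eta> > 0" "\<eta> * D = e / 2" using e D by (auto simp: \<eta>_def D_def[symmetric])
    obtain N where N: "\<And>n. n \<ge> N \<Longrightarrow> \<bar>h n\<bar> < \<eta> / 2" 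
      using LIMSEQ_D[OF h0, of "\<eta> / 2"] \<eta> by auto
    obtain N2 where N2: "\<And>n. n \<ge> N2 \<Longrightarrow> \<bar>\<delta> (r n)\<bar> < \<eta> / 2"
      using LIMSEQ_D[OF LIMSEQ_subseq_LIMSEQ[OF d0 r(1)], of "\<eta> / 2"] \<eta> by (auto simp: o_def)
    show "\<exists>N. \<forall>m\<ge>N. \<forall>n\<ge>N. sqdist ip (u (r m)) (u (r n)) < e \<and>
        sqdist en (u (r m)) (u (r n)) < e"
    proof (intro exI[of _ "max N N2"] allI impI)
      fix m n assume mn: "m \<ge> max N N2" "n \<ge> max N N2"
      let ?p = "ip (w m n) (w m n)"
      have p0: "?p \<ge> 0" using ip.nonneg wV subspD(6)[OF V] by blast
      have "(\<mu> - \<nu>) * ?p \<le> \<eta>" using key[of m n] N[of m] N[of n] mn by auto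
      then have p: "?p \<le> \<eta> / (\<mu> - \<nu>)" using ml by (simp add: field_simps)
      have "?p \<le> \<eta> * D" 
        using order_trans[OF p, of "\<eta> * D"] mult_left_mono[OF D(2), of \<eta>] \<eta>(1) by simp
      then have 1: "?p < e" using \<eta> e by simp
      have "\<bar>\<delta> (r m)\<bar> + \<bar>\<delta> (r n)\<bar> \<le> \<eta>" using N2[of m] N2[of n] mn by auto
      then have "en (w m n) (w m n) \<le> \<nu> * ?p + \<eta>"
        using le[of "r m" "r n"] unfolding w_def by simp
      also have "\<nu> * ?p \<le> \<bar>\<nu>\<bar> * (\<eta> / (\<mu> - \<nu>))"
        using mult_left_mono[OF p, of "\<bar>\<nu>\<bar>"] mult_right_mono[of \<nu> "\<bar>\<nu>\<bar>", OF abs_ge_self p0] by linarith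
      also have "\<bar>\<nu>\<bar> * (\<eta> / (\<mu> - \<nu>)) + \<eta> \<le> \<eta> * D"
        using divide_nonneg_pos[OF less_imp_le[OF \<eta>(1)] ml] by (simp add: D_def distrib_left mult.commute)
      finally have 2: "en (w m n) (w m n) < e" using \<eta> e by simp
      show "sqdist ip (u (r m)) (u (r n)) < e \<and>
        sqdist en (u (r m)) (u (r n)) < e"
        using 1 2 unfolding w_def by simp
    qed
  qed
  then show ?thesis using r by blast
qed

lemma minimizer_exists:
  assumes P: "closed_subsp P" and co: "coercive P \<mu>" and "\<nu> < \<mu>" and uP: "\<And>n. u n \<in> P"
    and u1: "\<And>n. ip (u n) (u n) = 1" and lim: "(\<lambda>n. en (u n) (u n)) \<longlonglongrightarrow> \<nu>"
    and low: "\<And>v. v \<in> P \<Longrightarrow> \<nu> * ip v v \<le> en v v"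
  shows "\<exists>e\<in>P. ip e e = 1 \<and> en e e = \<nu>"
proof -
  note S = closed_subspD[OF P]
  have uH: "u n \<in> H" for n using uP subspD(6)[OF S] by blast
  have "\<exists>r. strict_mono r \<and> Cauchy_seq (\<lambda>n. u (r n))"
  \<comment> \<open>The energy of a difference is
    \<open>2 * en (u m) (u m) + 2 * en (u n) (u n)\<close> minus the energy of the sum. By
    \<open>low\<close> and the parallelogram law for \<open>ip\<close>, the latter is at least
    \<open>\<nu>\<close> times 4 minus the mass of the difference. What is left over is twice the
    excess of each energy over \<open>\<nu>\<close>, which is \<open>\<delta>\<close>.\<close>
  proof (rule coercive_Cauchy_subseq[OF S co \<open>\<nu> < \<mu>\<close> uP, where B = 1 and \<delta> = "\<lambda>n. 2 * (en (u n) (u n) - \<nu>)"])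
    show "ip (u n) (u n) \<le> 1" for n using u1 by simp
    have "(\<lambda>n. 2 * (en (u n) (u n) - \<nu>)) \<longlonglongrightarrow> 2 * (\<nu> - \<nu>)" by (intro tendsto_intros lim)
    then show "(\<lambda>n. 2 * (en (u n) (u n) - \<nu>)) \<longlonglongrightarrow> 0" by simp
    fix m n
    have "\<nu> * ip (\<lambda>x. u m x + u n x) (\<lambda>x. u m x + u n x) \<le> en (\<lambda>x. u m x + u n x) (\<lambda>x. u m x + u n x)"
      using low[OF subspD(4)[OF S uP uP]] .
    then show "sqdist en (u m) (u n)
       \<le> \<nu> * sqdist ip (u m) (u n) + 2 * (en (u m) (u m) - \<nu>) + 2 * (en (u n) (u n) - \<nu>)"
      using uH u1 by (simp add: ip.square_add ip.square_diff en.square_add en.square_diff algebra_simps)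
  qed
  then obtain r where r: "strict_mono r" "Cauchy_seq (\<lambda>n. u (r n))" by blast
  then obtain e where e: "e \<in> P" "conv (\<lambda>n. u (r n)) e" using P uP unfolding closed_subsp_def by metis
  have eH: "e \<in> H" using e subspD(6)[OF S] by blast
  have "(\<lambda>n. ip (u (r n)) (u (r n))) \<longlonglongrightarrow> ip e e" "(\<lambda>n. en (u (r n)) (u (r n))) \<longlonglongrightarrow> en e e"
    using e uH eH by (auto intro!: ip.conv_square en.conv_square simp: conv_def)
  moreover have "(\<lambda>n. en (u (r n)) (u (r n))) \<longlonglongrightarrow> \<nu>"
    using LIMSEQ_subseq_LIMSEQ[OF lim r(1)] by (simp add: o_def)
  ultimately show ?thesis using u1 e LIMSEQ_unique by (intro bexI[of _ e]) (auto simp: LIMSEQ_const_iff)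
qed

lemma closed_subsp_orth:
  assumes V: "closed_subsp V" and e: "\<And>k. k < j \<Longrightarrow> e k \<in> H"
  shows "closed_subsp {u \<in> V. \<forall>k<j. ip u (e k) = 0}"
proof -
  note S = closed_subspD[OF V]
  have V': "u \<in> V \<Longrightarrow> u \<in> H" for u using subspD(6)[OF S] by blast
  have "subsp {u \<in> V. \<forall>k<j. ip u (e k) = 0}"
    using S e V' ip.lin unfolding subsp_def by (auto simp: ip.zero_left)
  moreover have "\<exists>v\<in>{u \<in> V. \<forall>k<j. ip u (e k) = 0}. conv u v"
    if u: "\<forall>n. u n \<in> {u \<in> V. \<forall>k<j. ip u (e k) = 0}" "Cauchy_seq u" for u
  proof -
    obtain v where v: "v \<in> V" "conv u v" using u V unfolding closed_subsp_def by blast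
    have "ip v (e k) = 0" if "k < j" for k
    proof -
      have "(\<lambda>n. ip (u n) (e k)) \<longlonglongrightarrow> ip v (e k)"
        using u v e[OF that] V' by (intro ip.conv_inner) (auto simp: conv_def)
      then show ?thesis using u that by (simp add: LIMSEQ_const_iff)
    qed
    then show ?thesis using v by blast
  qed
  ultimately show ?thesis unfolding closed_subsp_def by blast
qed

lemma coercive_mono: "coercive V \<mu> \<Longrightarrow> P \<subseteq> V \<Longrightarrow> coercive P \<mu>"
  unfolding coercive_def by (meson subsetD)

text \<open>The form \<open>en - \<nu> * ip\<close> is nonnegative on \<open>P\<close> and vanishes
  at \<open>e\<close>, so by Cauchy-Schwarz \<open>e\<close> lies in its kernel.\<close>

lemma minimizer_weak:
  assumes S: "subsp P" and e: "e \<in> P" "en e e = \<nu>" "ip e e = 1"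
    and low: "\<And>v. v \<in> P \<Longrightarrow> \<nu> * ip v v \<le> en v v" and \<phi>: "\<phi> \<in> P"
  shows "en e \<phi> = \<nu> * ip e \<phi>"
proof -
  have H: "e \<in> H" "\<phi> \<in> H" using e \<phi> subspD(6)[OF S] by blast+
  have "(en e \<phi> - \<nu> * ip e \<phi>)\<^sup>2 \<le> 0 * (en \<phi> \<phi> - \<nu> * ip \<phi> \<phi>)"
  proof (rule psd_2x2_det)
    fix t
    have "(\<lambda>x. e x + t * \<phi> x) \<in> P" by (rule subspD(4)[OF S e(1) subspD(3)[OF S \<phi>]])
    from low[OF this] show "0 + 2 * t * (en e \<phi> - \<nu> * ip e \<phi>) + t\<^sup>2 * (en \<phi> \<phi> - \<nu> * ip \<phi> \<phi>) \<ge> 0"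
      using H e by (simp add: ip.square_add_scale en.square_add_scale algebra_simps)
  qed
  then show ?thesis by simp
qed

section \<open>Independent families and bounds for min-max levels\<close>

lemma indep_coeff_bound:
  assumes H: "\<And>i. i < j \<Longrightarrow> \<phi> i \<in> H" and ind: "indep j \<phi>"
  shows "\<exists>K\<ge>0. \<forall>c. \<forall>i<j. (c i)\<^sup>2 \<le> K * ip (lincomb j c \<phi>) (lincomb j c \<phi>)"
\<comment> \<open>Equivalence of norms in finite dimension. If no constant worked, coefficient
  vectors of Euclidean length 1 would have Gram form tending to 0, and a limit vector would
  contradict independence. The bound is what makes the suprema of energies finite.\<close>
proof (rule ccontr)
  define q where "q c = ip (lincomb j c \<phi>) (lincomb j c \<phi>)" for c
  have q: "q c = (\<Sum>i<j. \<Sum>k<j. c i * c k * ip (\<phi> i) (\<phi> k))" for c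
    unfolding q_def using H by (rule ip.square_sum)
  have q0: "q c \<ge> 0" for c unfolding q_def using H by (intro ip.nonneg) auto
  assume "\<not> ?thesis"
  then have neg: "\<not> (\<forall>c. \<forall>i<j. (c i)\<^sup>2 \<le> real n * q c)" for n unfolding q_def by (meson of_nat_0_le_iff)
  have "\<exists>c. \<exists>i<j. (c i)\<^sup>2 > real n * q c" for n using neg[of n] by (auto simp: not_le)
  then obtain c where "\<And>n::nat. \<exists>i<j. (c n i)\<^sup>2 > real n * q (c n)" by metis
  then obtain i where c: "\<And>n. i n < j" "\<And>n::nat. (c n (i n))\<^sup>2 > real n * q (c n)" by metis
  define s where "s n = (\<Sum>i<j. (c n i)\<^sup>2)" for n
  have s: "s n > real n * q (c n)" for n
    using c(2)[of n] member_le_sum[of "i n" "{..<j}" "\<lambda>i. (c n i)\<^sup>2"] c(1)[of n] by (simp add: s_def)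
  have spos: "s n > 0" for n using s[of n] q0[of "c n"] by (smt (verit) mult_nonneg_nonneg of_nat_0_le_iff)
  define d where "d i n = c n i / sqrt (s n)" for i n
  have d1: "(\<Sum>i<j. (d i n)\<^sup>2) = 1" for n
    using spos[of n] by (simp add: d_def power_divide sum_divide_distrib[symmetric] s_def)
  have "\<bar>d i n\<bar> \<le> 1" if "i < j" for i n
  proof -
    have "(d i n)\<^sup>2 \<le> 1" using member_le_sum[of i "{..<j}" "\<lambda>i. (d i n)\<^sup>2"] d1[of n] that by simp
    then show ?thesis by (simp add: abs_square_le_1)
  qed
  then obtain r where r: "strict_mono r" "\<And>i. i < j \<Longrightarrow> convergent (\<lambda>n. d i (r n))"
    using bounded_finite_family_convergent_subseq[of j d] by blast
  then obtain l where l: "\<And>i. i < j \<Longrightarrow> (\<lambda>n. d i (r n)) \<longlonglongrightarrow> l i" unfolding convergent_def by metis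
  have "(\<lambda>n. \<Sum>i<j. (d i (r n))\<^sup>2) \<longlonglongrightarrow> (\<Sum>i<j. (l i)\<^sup>2)" using l by (intro tendsto_intros) auto
  then have l1: "(\<Sum>i<j. (l i)\<^sup>2) = 1" using d1 by (simp add: LIMSEQ_const_iff)
  have qlim: "(\<lambda>n. q (\<lambda>i. d i (r n))) \<longlonglongrightarrow> q l" unfolding q using l by (intro tendsto_intros) auto
  have qd: "q (\<lambda>i. d i n) = q (c n) / s n" for n
    using spos[of n] by (simp add: q d_def sum_divide_distrib real_sqrt_mult[symmetric] times_divide_times_eq)
  have qn: "real n * q (\<lambda>i. d i n) \<le> 1" for n
    using s[of n] spos[of n] by (simp add: qd field_simps)
  have "(\<lambda>n. 1 / real (Suc n)) \<longlonglongrightarrow> 0" using LIMSEQ_inverse_real_of_nat by (simp add: inverse_eq_divide)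
  moreover have "q (\<lambda>i. d i (r n)) \<le> 1 / real n" if "n > 0" for n
  proof -
    have "real n * q (\<lambda>i. d i (r n)) \<le> real (r n) * q (\<lambda>i. d i (r n))"
      using q0 strict_mono_imp_increasing[OF r(1), of n] by (intro mult_right_mono) auto
    then show ?thesis using qn[of "r n"] that by (simp add: field_simps)
  qed
  ultimately have "q l \<le> 0"
    using LIMSEQ_Suc[OF qlim] by (intro LIMSEQ_le[of "\<lambda>n. q (\<lambda>i. d i (r (Suc n)))" _ "\<lambda>n. 1 / real (Suc n)"]) (blast intro: zero_less_Suc)+
  then have "q l = 0" using q0[of l] by simp
  then have "\<forall>i<j. l i = 0" using ind unfolding indep_def q_def by blast
  then show False using l1 by simp
qed

lemma levels_bdd:
  assumes H: "\<And>i. i < j \<Longrightarrow> \<phi> i \<in> H" and ind: "indep j \<phi>"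
  shows "bdd_above (levels j \<phi>)"
proof -
  obtain K where K: "K \<ge> 0" "\<And>c i. i < j \<Longrightarrow> (c i)\<^sup>2 \<le> K * ip (lincomb j c \<phi>) (lincomb j c \<phi>)"
    using indep_coeff_bound[OF assms] by blast
  have "en (lincomb j c \<phi>) (lincomb j c \<phi>) \<le> (\<Sum>i<j. \<Sum>k<j. K * \<bar>en (\<phi> i) (\<phi> k)\<bar>)"
    if "ip (lincomb j c \<phi>) (lincomb j c \<phi>) = 1" for c
  proof -
    have c: "\<bar>c i\<bar> \<le> sqrt K" if "i < j" for i
      using K(2)[OF that, of c] \<open>ip _ _ = 1\<close> by (simp add: real_le_rsqrt)
    have "c i * c k * en (\<phi> i) (\<phi> k) \<le> K * \<bar>en (\<phi> i) (\<phi> k)\<bar>" if "i < j" "k < j" for i k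
    proof -
      have "\<bar>c i\<bar> * \<bar>c k\<bar> \<le> sqrt K * sqrt K" using c that K(1) by (intro mult_mono) auto
      then have "\<bar>c i * c k\<bar> \<le> K" using K by (simp add: abs_mult)
      then have "\<bar>c i * c k * en (\<phi> i) (\<phi> k)\<bar> \<le> K * \<bar>en (\<phi> i) (\<phi> k)\<bar>"
        by (simp add: abs_mult mult_right_mono)
      then show ?thesis by simp
    qed
    then show ?thesis using H by (subst en.square_sum) (auto intro!: sum_mono)
  qed
  then show ?thesis unfolding levels_def bdd_above_def by blast
qed

lemma indep_normalize:
  assumes H: "\<And>i. i < j \<Longrightarrow> \<phi> i \<in> H" and ind: "indep j \<phi>" and "\<exists>i<j. c i \<noteq> 0"
  shows "\<exists>\<alpha>. ip (\<lambda>x. \<Sum>i<j. (\<alpha> * c i) * \<phi> i x) (\<lambda>x. \<Sum>i<j. (\<alpha> * c i) * \<phi> i x) = 1"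
proof -
  let ?w = "\<lambda>x. \<Sum>i<j. c i * \<phi> i x"
  have w: "?w \<in> H" using H by auto
  have "ip ?w ?w \<noteq> 0" using ind assms(3) unfolding indep_def by blast
  then have "ip ?w ?w > 0" using ip.nonneg[OF w] by simp
  have eq: "ip (\<lambda>x. \<Sum>i<j. (\<alpha> * c i) * \<phi> i x) (\<lambda>x. \<Sum>i<j. (\<alpha> * c i) * \<phi> i x) = \<alpha>\<^sup>2 * ip ?w ?w" for \<alpha>
    using ip.square_scale[OF w, of \<alpha>] by (simp add: sum_distrib_left mult_ac)
  have "(1 / sqrt (ip ?w ?w))\<^sup>2 * ip ?w ?w = 1" using \<open>ip ?w ?w > 0\<close> by (simp add: power_divide)
  then show ?thesis by (intro exI[of _ "1 / sqrt (ip ?w ?w)"]) (rule trans[OF eq])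
qed

lemma levels_nonempty:
  assumes "\<And>i. i < j \<Longrightarrow> \<phi> i \<in> H" "indep j \<phi>" "j \<ge> 1"
  shows "levels j \<phi> \<noteq> {}"
proof -
  have "\<exists>i<j. (1::real) \<noteq> 0" using assms(3) by (intro exI[of _ 0]) auto
  from indep_normalize[OF assms(1,2) this] obtain \<alpha> where
    "ip (\<lambda>x. \<Sum>i<j. (\<alpha> * 1) * \<phi> i x) (\<lambda>x. \<Sum>i<j. (\<alpha> * 1) * \<phi> i x) = 1" by auto
  then have "en (\<lambda>x. \<Sum>i<j. (\<alpha> * 1) * \<phi> i x) (\<lambda>x. \<Sum>i<j. (\<alpha> * 1) * \<phi> i x) \<in> levels j \<phi>"
    unfolding levels_def by (intro CollectI exI[of _ "\<lambda>_. \<alpha> * 1"] conjI refl)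
  then show ?thesis by auto
qed

text \<open>Dimension count: \<open>m < j\<close> linear conditions on \<open>j\<close> coefficients
  leave a nonzero combination, and independence allows it to be normalised.\<close>

lemma indep_orth:
  assumes H: "\<And>i. i < j \<Longrightarrow> \<phi> i \<in> H" and ind: "indep j \<phi>" and "m < j" and e: "\<And>k. k < m \<Longrightarrow> e k \<in> H"
  shows "\<exists>c. ip (lincomb j c \<phi>) (lincomb j c \<phi>) = 1 \<and>
     (\<forall>k<m. ip (lincomb j c \<phi>) (e k) = 0)"
proof -
  obtain c where c: "\<exists>i<j. c i \<noteq> 0" "\<forall>k<m. (\<Sum>i<j. c i * ip (\<phi> i) (e k)) = 0"
    using homogeneous_system_nontrivial[OF \<open>m < j\<close>, of "\<lambda>k i. ip (\<phi> i) (e k)"] by blast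
  obtain \<alpha> where \<alpha>: "ip (\<lambda>x. \<Sum>i<j. (\<alpha> * c i) * \<phi> i x) (\<lambda>x. \<Sum>i<j. (\<alpha> * c i) * \<phi> i x) = 1"
    using indep_normalize[OF H ind c(1)] by blast
  have "ip (\<lambda>x. \<Sum>i<j. (\<alpha> * c i) * \<phi> i x) (e k) = 0" if "k < m" for k
  proof -
    have "ip (\<lambda>x. \<Sum>i<j. (\<alpha> * c i) * \<phi> i x) (e k) = \<alpha> * (\<Sum>i<j. c i * ip (\<phi> i) (e k))"
      using H e[OF that] by (subst ip.sum_left) (auto simp: sum_distrib_left mult_ac)
    then show ?thesis using c that by simp
  qed
  then show ?thesis using \<alpha> by (intro exI[of _ "\<lambda>i. \<alpha> * c i"]) auto
qed

text \<open>Every competing span contains a unit vector orthogonal to the \<open>m < j\<close> given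
  ones, so a lower bound on that complement is a lower bound on the level. The existence assumption
  keeps \<open>Inf\<close> from being taken over the empty set.\<close>

lemma minmax_ge:
  assumes S: "subsp V" and "\<exists>\<phi>. (\<forall>i<j. \<phi> i \<in> V) \<and> indep j \<phi>" and "m < j" and e: "\<And>k. k < m \<Longrightarrow> e k \<in> H"
    and low: "\<And>v. v \<in> V \<Longrightarrow> ip v v = 1 \<Longrightarrow> (\<forall>k<m. ip v (e k) = 0) \<Longrightarrow> L \<le> en v v"
  shows "L \<le> minmax j V"
  unfolding minmax_def
proof (rule cInf_greatest)
  show "{Sup (levels j \<phi>) |\<phi>. (\<forall>i<j. \<phi> i \<in> V) \<and> indep j \<phi>} \<noteq> {}" using assms(2) by blast
  fix x assume "x \<in> {Sup (levels j \<phi>) |\<phi>. (\<forall>i<j. \<phi> i \<in> V) \<and> indep j \<phi>}"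
  then obtain \<phi> where \<phi>: "\<And>i. i < j \<Longrightarrow> \<phi> i \<in> V" "indep j \<phi>" "x = Sup (levels j \<phi>)" by blast
  have H: "\<phi> i \<in> H" if "i < j" for i using \<phi>(1)[OF that] subspD(6)[OF S] by blast
  obtain c where c: "ip (lincomb j c \<phi>) (lincomb j c \<phi>) = 1"
     "\<forall>k<m. ip (lincomb j c \<phi>) (e k) = 0"
    using indep_orth[OF H \<phi>(2) \<open>m < j\<close>, of e] e by blast
  have "L \<le> en (lincomb j c \<phi>) (lincomb j c \<phi>)"
    using low[OF subsp_sum[of V j \<phi> c, OF S \<phi>(1)]] c by simp
  also have "\<dots> \<le> x" unfolding \<phi>(3) using c
    by (intro cSup_upper levels_bdd[OF H \<phi>(2)]) (auto simp: levels_def)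
  finally show "L \<le> x" .
qed

text \<open>Each \<open>Sup\<close> is at least the energy of one unit vector, which is nonnegative;
  for \<open>j = 0\<close> there would be no such vector.\<close>

lemma minmax_set_bdd_below:
  assumes "subsp V" "j \<ge> 1"
  shows "bdd_below {Sup (levels j \<phi>) |\<phi>. (\<forall>i<j. \<phi> i \<in> V) \<and> indep j \<phi>}"
proof (rule bdd_belowI[of _ 0])
  fix x assume "x \<in> {Sup (levels j \<phi>) |\<phi>. (\<forall>i<j. \<phi> i \<in> V) \<and> indep j \<phi>}"
  then obtain \<phi> where \<phi>: "\<And>i. i < j \<Longrightarrow> \<phi> i \<in> V" "indep j \<phi>" "x = Sup (levels j \<phi>)" by blast
  have H: "\<phi> i \<in> H" if "i < j" for i using \<phi>(1)[OF that] subspD(6)[OF assms(1)] by blast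
  obtain y where "y \<in> levels j \<phi>" using levels_nonempty[OF H \<phi>(2) assms(2)] by blast
  moreover then have "0 \<le> y" using H by (auto simp: levels_def intro!: en.nonneg)
  ultimately show "0 \<le> x" unfolding \<phi>(3) using levels_bdd[OF H \<phi>(2)] by (meson cSup_upper2)
qed

lemma minmax_le:
  assumes S: "subsp V" and "j \<ge> 1" and \<phi>: "\<And>i. i < j \<Longrightarrow> \<phi> i \<in> V" "indep j \<phi>"
    and up: "\<And>c. en (lincomb j c \<phi>) (lincomb j c \<phi>)
        \<le> L * ip (lincomb j c \<phi>) (lincomb j c \<phi>)"
  shows "minmax j V \<le> L"
proof -
  have H: "\<phi> i \<in> H" if "i < j" for i using \<phi>(1)[OF that] subspD(6)[OF S] by blast
  have "minmax j V \<le> Sup (levels j \<phi>)"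
    unfolding minmax_def using \<phi> by (intro cInf_lower minmax_set_bdd_below[OF S \<open>j \<ge> 1\<close>]) blast
  also have "\<dots> \<le> L"
  proof (rule cSup_least[OF levels_nonempty[OF H \<phi>(2) \<open>j \<ge> 1\<close>]])
    fix y assume "y \<in> levels j \<phi>"
    then obtain c where "y = en (lincomb j c \<phi>) (lincomb j c \<phi>)"
      "ip (lincomb j c \<phi>) (lincomb j c \<phi>) = 1" unfolding levels_def by blast
    then show "y \<le> L" using up[of c] by simp
  qed
  finally show ?thesis .
qed

text \<open>Domain monotonicity: a smaller subspace offers fewer competitors to the infimum.\<close>

lemma minmax_mono:
  assumes "subsp V" "W \<subseteq> V" "j \<ge> 1" "\<exists>\<phi>. (\<forall>i<j. \<phi> i \<in> W) \<and> indep j \<phi>"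
  shows "minmax j V \<le> minmax j W"
  unfolding minmax_def using assms by (intro cInf_superset_mono minmax_set_bdd_below) blast+

lemma orthonormal_comb:
  fixes j :: nat
  assumes "\<And>i. i < j \<Longrightarrow> e i \<in> H" "\<And>i k. i < j \<Longrightarrow> k < j \<Longrightarrow> ip (e i) (e k) = (if i = k then 1 else 0)"
  shows "ip (lincomb j c e) (lincomb j c e) = (\<Sum>i<j. (c i)\<^sup>2)"
proof -
  have "ip (lincomb j c e) (lincomb j c e) = (\<Sum>i<j. \<Sum>k<j. c i * c k * ip (e i) (e k))"
    by (rule ip.square_sum[of j e c, OF assms(1)])
  also have "\<dots> = (\<Sum>i<j. \<Sum>k<j. if i = k then (c i)\<^sup>2 else 0)"
    using assms by (intro sum.cong) (auto simp: power2_eq_square)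
  finally show ?thesis by simp
qed

lemma orthonormal_comb_en:
  fixes j :: nat
  assumes "\<And>i. i < j \<Longrightarrow> e i \<in> H"  "\<And>i k. i < j \<Longrightarrow> k < j \<Longrightarrow> en (e i) (e k) = (if i = k then l i else 0)"
  shows "en (lincomb j c e) (lincomb j c e) = (\<Sum>i<j. l i * (c i)\<^sup>2)"
proof -
  have "en (lincomb j c e) (lincomb j c e) = (\<Sum>i<j. \<Sum>k<j. c i * c k * en (e i) (e k))"
    by (rule en.square_sum[of j e c, OF assms(1)])
  also have "\<dots> = (\<Sum>i<j. \<Sum>k<j. if i = k then l i * (c i)\<^sup>2 else 0)"
    using assms by (intro sum.cong) (auto simp: power2_eq_square)
  finally show ?thesis by simp
qed

lemma orthonormal_indep:
  assumes "\<And>i. i < j \<Longrightarrow> e i \<in> H" "\<And>i k. i < j \<Longrightarrow> k < j \<Longrightarrow> ip (e i) (e k) = (if i = k then 1 else 0)"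
  shows "indep j e"
  unfolding indep_def using orthonormal_comb[OF assms] by (auto simp: sum_nonneg_eq_0_iff)

lemma minmax_le_orthonormal:
  assumes S: "subsp V" and "j \<ge> 1" and e: "\<And>i. i < j \<Longrightarrow> e i \<in> V"
    and on: "\<And>i k. i < j \<Longrightarrow> k < j \<Longrightarrow> ip (e i) (e k) = (if i = k then 1 else 0)"
    and oe: "\<And>i k. i < j \<Longrightarrow> k < j \<Longrightarrow> en (e i) (e k) = (if i = k then l i else 0)"
    and L: "\<And>i. i < j \<Longrightarrow> l i \<le> L"
  shows "minmax j V \<le> L"
proof (rule minmax_le[OF S \<open>j \<ge> 1\<close> e])
  have H: "e i \<in> H" if "i < j" for i using e[OF that] subspD(6)[OF S] by blast
  show "indep j e" using orthonormal_indep H on by blast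
  show "en (lincomb j c e) (lincomb j c e)
        \<le> L * ip (lincomb j c e) (lincomb j c e)" for c
    using L by (simp add: orthonormal_comb[OF H on] orthonormal_comb_en[OF H oe] sum_distrib_left)
     (intro sum_mono mult_right_mono, auto)
qed

lemma eigsysD: assumes "eigsys V j e"
  shows "i < j \<Longrightarrow> e i \<in> V" "i < j \<Longrightarrow> k < j \<Longrightarrow> ip (e i) (e k) = (if i = k then 1 else 0)"
    "i < j \<Longrightarrow> \<phi> \<in> V \<Longrightarrow> en (e i) \<phi> = minmax (Suc i) V * ip (e i) \<phi>"
  using assms unfolding eigsys_def by simp_all

text \<open>Any orthonormal system of eigenvectors for the min-max levels satisfies the recursive variational
  characterisation: replace in the span only those \<open>e k\<close> whose level lies strictly below the one in question,
  so that coinciding levels do no harm.\<close>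
lemma eigsys_argmin:
  assumes S: "subsp V" and E: "eigsys V j e" and "i < j" and v: "v \<in> V" "ip v v = 1" "\<And>k. k < i \<Longrightarrow> ip v (e k) = 0"
  shows "minmax (Suc i) V \<le> en v v"
proof (rule ccontr)
  define \<Lambda> where "\<Lambda> = minmax (Suc i) V"
  assume "\<not> minmax (Suc i) V \<le> en v v"
  then have less: "en v v < \<Lambda>" by (simp add: \<Lambda>_def)
  \<comment> \<open>The least index whose level reaches \<open>\<Lambda>\<close>. Earlier levels are
    strictly smaller by this choice, without appeal to monotonicity of the levels.\<close>
  define p where "p = (LEAST p. minmax (Suc p) V \<ge> \<Lambda>)"
  have p: "minmax (Suc p) V \<ge> \<Lambda>" unfolding p_def by (rule LeastI[of _ i]) (simp add: \<Lambda>_def)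
  have pi: "p \<le> i" unfolding p_def by (rule Least_le) (simp add: \<Lambda>_def)
  have plow: "minmax (Suc k) V < \<Lambda>" if "k < p" for k 
    using not_less_Least[of k "\<lambda>p. minmax (Suc p) V \<ge> \<Lambda>"] that unfolding p_def by simp
  define \<psi> where "\<psi> k = (if k < p then e k else v)" for k
  define l where "l k = (if k < p then minmax (Suc k) V else en v v)" for k
  have eV: "\<And>k. k < j \<Longrightarrow> e k \<in> V" and eo: "\<And>k k'. k < j \<Longrightarrow> k' < j \<Longrightarrow> ip (e k) (e k') = (if k = k' then 1 else 0)"
    and ee: "\<And>k \<phi>. k < j \<Longrightarrow> \<phi> \<in> V \<Longrightarrow> en (e k) \<phi> = minmax (Suc k) V * ip (e k) \<phi>"
    using eigsysD[OF E] by simp_all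
  have VH: "u \<in> V \<Longrightarrow> u \<in> H" for u by (rule subspD(6)[OF S])
  have ve: "ip (e k) v = 0" "en (e k) v = 0" "en v (e k) = 0" "ip v (e k) = 0" if "k < p" for k
    using that pi \<open>i < j\<close> v eV[of k] ee[of k v] ip.sym[of "e k" v] en.sym[of v "e k"] VH by auto
  \<comment> \<open>The vectors \<open>e k\<close> with \<open>k < p\<close> together with
    \<open>v\<close> are orthogonal for both forms and have energies below \<open>\<Lambda>\<close>;
    there are \<open>p + 1\<close> of them, which contradicts the choice of
    \<open>p\<close>.\<close>
  have "minmax (Suc p) V \<le> Max (l ` {..p})"
  proof (rule minmax_le_orthonormal[OF S, where e = \<psi> and l = l])
    show "\<psi> k \<in> V" if "k < Suc p" for k using that eV pi \<open>i < j\<close> v by (auto simp: \<psi>_def)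
    show "ip (\<psi> k) (\<psi> k') = (if k = k' then 1 else 0)" if "k < Suc p" "k' < Suc p" for k k'
      using that pi \<open>i < j\<close> v by (auto simp: \<psi>_def eo ve)
    show "en (\<psi> k) (\<psi> k') = (if k = k' then l k else 0)" if "k < Suc p" "k' < Suc p" for k k'
      using that pi \<open>i < j\<close> v by (auto simp: \<psi>_def l_def eo ve ee eV)
    show "l k \<le> Max (l ` {..p})" if "k < Suc p" for k using that by (intro Max_ge) auto
  qed simp
  also have "\<dots> < \<Lambda>" using plow less by (subst Max_less_iff) (auto simp: l_def)
  finally show False using p by simp
qed

section \<open>Existence of eigenvectors below the coercivity threshold\<close>

lemma en_eigsys: "eigsys V j e \<Longrightarrow> i < j \<Longrightarrow> en (e i) (e i) = minmax (Suc i) V"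
  unfolding eigsys_def by auto

lemma indep_prefix: assumes "indep l \<phi>" "j \<le> l" shows "indep j \<phi>"
  unfolding indep_def
proof (intro allI impI)
  fix c i assume c: "ip (lincomb j c \<phi>) (lincomb j c \<phi>) = 0" and "i < j"
  define d where "d i = (if i < j then c i else 0)" for i
  have "(\<Sum>i<l. d i * \<phi> i x) = (\<Sum>i<j. c i * \<phi> i x)" for x
    using assms(2) by (intro sum.mono_neutral_cong_right) (auto simp: d_def)
  then have "\<forall>i<l. d i = 0" using c assms(1) unfolding indep_def by simp
  then show "c i = 0" using \<open>i < j\<close> assms(2) by (auto simp: d_def dest!: spec[of _ i])
qed

text \<open>The next vector minimises the energy over unit vectors orthogonal to the earlier ones. A
  dimension count puts the infimum at or below the levels \<open>j + 1, ..., l\<close>, hence below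
  \<open>\<mu>\<close>, where minimising sequences are precompact; the minimiser and the earlier
  vectors then show that the infimum is the level \<open>Suc j\<close>.\<close>

theorem eigsys_exists:
  assumes V: "closed_subsp V" and co: "coercive V \<mu>" and less: "minmax l V < \<mu>"
    and \<phi>: "\<And>i. i < l \<Longrightarrow> \<phi> i \<in> V" "indep l \<phi>" and "j \<le> l"
  shows "\<exists>e. eigsys V j e"
  using \<open>j \<le> l\<close>
proof (induction j)
  case 0
  then show ?case by (simp add: eigsys_def)
next
  case (Suc j)
  then obtain e where E: "eigsys V j e" by auto
  note S = closed_subspD[OF V]
  have VH: "u \<in> V \<Longrightarrow> u \<in> H" for u by (rule subspD(6)[OF S])
  have eV: "\<And>k. k < j \<Longrightarrow> e k \<in> V" and eo: "\<And>k k'. k < j \<Longrightarrow> k' < j \<Longrightarrow> ip (e k) (e k') = (if k = k' then 1 else 0)"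
    and ee: "\<And>k \<phi>. k < j \<Longrightarrow> \<phi> \<in> V \<Longrightarrow> en (e k) \<phi> = minmax (Suc k) V * ip (e k) \<phi>"
    using eigsysD[OF E] by simp_all
  define P where "P = {u \<in> V. \<forall>k<j. ip u (e k) = 0}"
  have P: "closed_subsp P" unfolding P_def using eV VH by (intro closed_subsp_orth[OF V]) auto
  have PV: "P \<subseteq> V" by (auto simp: P_def)
  define A where "A = {en v v | v. v \<in> P \<and> ip v v = 1}"
  define \<nu> where "\<nu> = Inf A"
  \<comment> \<open>There are \<open>l > j\<close> independent vectors, so some unit vector of their
    span satisfies the \<open>j\<close> orthogonality conditions.\<close>
  have "A \<noteq> {}"
  proof -
    obtain c where c: "ip (lincomb l c \<phi>) (lincomb l c \<phi>) = 1"
      "\<forall>k<j. ip (lincomb l c \<phi>) (e k) = 0"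
      using indep_orth[OF VH[OF \<phi>(1)] \<phi>(2) Suc_le_lessD[OF Suc.prems] VH[OF eV], of "\<lambda>k. k"] by auto
    moreover have "(lincomb l c \<phi>) \<in> V" using subsp_sum[of V l \<phi> c, OF S \<phi>(1)] .
    ultimately have "(lincomb l c \<phi>) \<in> P" unfolding P_def by simp
    then show ?thesis using c(1) unfolding A_def by auto
  qed
  have bdd: "bdd_below A" unfolding A_def P_def using en.nonneg VH by (intro bdd_belowI[of _ 0]) blast
  have low1: "\<nu> \<le> en v v" if "v \<in> P" "ip v v = 1" for v
    unfolding \<nu>_def using that by (intro cInf_lower bdd) (auto simp: A_def)
  have low: "\<nu> * ip v v \<le> en v v" if "v \<in> P" for v
  proof (cases "ip v v = 0")
    case True
    then show ?thesis using en.nonneg[of v] that PV VH by auto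
  next
    case False
    have vH: "v \<in> H" using that PV VH by auto
    then have pos: "ip v v > 0" using False ip.nonneg[of v] by simp
    let ?a = "1 / sqrt (ip v v)"
    have "(\<lambda>x. ?a * v x) \<in> P" by (rule subspD(3)[OF closed_subspD[OF P] that])
    moreover have "ip (\<lambda>x. ?a * v x) (\<lambda>x. ?a * v x) = 1"
      using ip.square_scale[OF vH, of ?a] pos by (simp add: power_divide)
    ultimately have "\<nu> \<le> ?a\<^sup>2 * en v v" using low1 en.square_scale[OF vH, of ?a] by metis
    then show ?thesis using pos by (simp add: power_divide field_simps)
  qed
  \<comment> \<open>Used with \<open>i = l\<close> to get \<open>\<nu> < \<mu>\<close>, and with
    \<open>i = Suc j\<close> to identify \<open>\<nu>\<close> with the level.\<close>
  have lamle: "\<nu> \<le> minmax i V" if "j < i" "i \<le> l" for i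
  proof (rule minmax_ge[OF S _ \<open>j < i\<close>])
    show "\<exists>\<phi>. (\<forall>k<i. \<phi> k \<in> V) \<and> indep i \<phi>" using \<phi> that indep_prefix[of l \<phi> i] by (intro exI[of _ \<phi>]) auto
    show "e k \<in> H" if "k < j" for k using eV that VH by auto
    show "\<nu> \<le> en v v" if "v \<in> V" "ip v v = 1" "\<forall>k<j. ip v (e k) = 0" for v
      using low1 that by (auto simp: P_def)
  qed
  have "\<nu> < \<mu>" using lamle[of l] less Suc.prems by simp
  have "\<exists>v. v \<in> P \<and> ip v v = 1 \<and> en v v < \<nu> + 1 / real (Suc n)" for n
  proof -
    have "Inf A < \<nu> + 1 / real (Suc n)" by (simp add: \<nu>_def)
    then obtain y where "y \<in> A" "y < \<nu> + 1 / real (Suc n)" using cInf_lessD[OF \<open>A \<noteq> {}\<close>] by blast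
    then show ?thesis unfolding A_def by blast
  qed
  then obtain u where u: "\<And>n. u n \<in> P" "\<And>n. ip (u n) (u n) = 1" "\<And>n. en (u n) (u n) < \<nu> + 1 / real (Suc n)"
    by metis
  have "(\<lambda>n. \<nu> + inverse (real (Suc n))) \<longlonglongrightarrow> \<nu> + 0" by (intro tendsto_intros LIMSEQ_inverse_real_of_nat)
  then have lim0: "(\<lambda>n. \<nu> + inverse (real (Suc n))) \<longlonglongrightarrow> \<nu>" by simp
  have "(\<lambda>n. en (u n) (u n)) \<longlonglongrightarrow> \<nu>"
  proof (rule tendsto_sandwich[of "\<lambda>_. \<nu>", rotated 3])
    show "\<forall>\<^sub>F n in sequentially. \<nu> \<le> en (u n) (u n)" using low1 u by simp
    show "\<forall>\<^sub>F n in sequentially. en (u n) (u n) \<le> \<nu> + inverse (real (Suc n))"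
      using u(3) by (simp add: inverse_eq_divide less_imp_le)
  qed (use lim0 in auto)
  from minimizer_exists[OF P coercive_mono[OF co PV] \<open>\<nu> < \<mu>\<close> u(1,2) this low]
  obtain f where f: "f \<in> P" "ip f f = 1" "en f f = \<nu>" by blast
  have fV: "f \<in> V" and fH: "f \<in> H" using f PV VH by auto
  have fe: "ip f (e k) = 0" "ip (e k) f = 0" "en f (e k) = 0" "en (e k) f = 0" if "k < j" for k
    using f that eV[OF that] ee[OF that fV] fH VH ip.sym[of f "e k"] en.sym[of f "e k"] by (auto simp: P_def)
  \<comment> \<open>Minimality gives the equation only against vectors of \<open>P\<close>. A
    general \<open>\<phi>\<close> is reduced to this case by subtracting its projection
    \<open>?s\<close> to the span of the \<open>e k\<close>, to which \<open>f\<close> is orthogonal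
    in both forms.\<close>
  have weak: "en f \<phi> = \<nu> * ip f \<phi>" if "\<phi> \<in> V" for \<phi>
  proof -
    let ?s = "\<lambda>x. \<Sum>k<j. ip \<phi> (e k) * e k x"
    have sV: "?s \<in> V" by (rule subsp_sum[of V j e "\<lambda>k. ip \<phi> (e k)", OF S eV])
    have H: "\<phi> \<in> H" "?s \<in> H" using that sV VH by auto
    have "ip ?s (e k) = ip \<phi> (e k)" if "k < j" for k
    proof -
      have "ip ?s (e k) = (\<Sum>i<j. ip \<phi> (e i) * ip (e i) (e k))"
        using eV VH that by (intro ip.sum_left) auto
      also have "\<dots> = (\<Sum>i<j. if i = k then ip \<phi> (e k) else 0)" using that by (intro sum.cong) (auto simp: eo)
      finally show ?thesis using that by simp
    qed
    then have "(\<lambda>x. \<phi> x - ?s x) \<in> P"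
      unfolding P_def using subspD(5)[OF S \<open>\<phi> \<in> V\<close> sV] H eV VH by (simp add: ip.diff_left)
    then have "en f (\<lambda>x. \<phi> x - ?s x) = \<nu> * ip f (\<lambda>x. \<phi> x - ?s x)"
      using minimizer_weak[OF closed_subspD[OF P] f(1,3,2) low] by blast
    moreover have "en f ?s = 0" "ip f ?s = 0"
      using eV VH fH fe by (simp_all add: ip.sum_right en.sum_right)
    ultimately show ?thesis using H fH by (simp add: ip.diff_right en.diff_right)
  qed
  define e' where "e' k = (if k < j then e k else f)" for k
  have e'V: "e' k \<in> V" if "k < Suc j" for k using eV fV by (auto simp: e'_def)
  have e'o: "ip (e' k) (e' k') = (if k = k' then 1 else 0)" if "k < Suc j" "k' < Suc j" for k k'
    using that by (auto simp: e'_def eo fe f)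
  have "minmax (Suc j) V \<le> \<nu>"
  proof (rule minmax_le_orthonormal[OF S _ e'V e'o, where l = "\<lambda>k. if k < j then minmax (Suc k) V else \<nu>"])
    show "en (e' k) (e' k') = (if k = k' then if k < j then minmax (Suc k) V else \<nu> else 0)"
      if "k < Suc j" "k' < Suc j" for k k'
      using that by (auto simp: e'_def eo fe ee eV f)
    \<comment> \<open>Being orthogonal to all \<open>e k\<close>, the vector \<open>f\<close>
      competes in the characterisation of every earlier level.\<close>
    show "(if k < j then minmax (Suc k) V else \<nu>) \<le> \<nu>" if "k < Suc j" for k
      using eigsys_argmin[OF S E, of k f] f fV fe by auto
  qed auto
  then have lam: "minmax (Suc j) V = \<nu>" using lamle[of "Suc j"] Suc.prems by simp
  have "eigsys V (Suc j) e'"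
    unfolding eigsys_def using e'V e'o ee weak lam by (auto simp: e'_def less_Suc_eq)
  then show ?case by blast
qed

section \<open>Approximation by an increasing family of subspaces\<close>

lemma minmax_approx_upper:
  fixes n0 :: nat
  assumes S: "subsp V" and E: "eigsys V l e" and "i < l"
    and WV: "\<And>n. n \<ge> n0 \<Longrightarrow> subsp (W n)" "\<And>n m. n0 \<le> n \<Longrightarrow> n \<le> m \<Longrightarrow> W n \<subseteq> W m"
    and dense: "\<And>v \<epsilon>. v \<in> V \<Longrightarrow> \<epsilon> > 0 \<Longrightarrow> \<exists>n\<ge>n0. \<exists>w\<in>W n.
        sqdist ip v w < \<epsilon> \<and> sqdist en v w < \<epsilon>"
    and "\<epsilon> > 0"
  shows "\<exists>n\<ge>n0. minmax (Suc i) (W n) < minmax (Suc i) V + \<epsilon>"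
proof -
  define J where "J = Suc i"
  define \<Lambda> where "\<Lambda> = minmax J V"
  note eV = eigsysD(1)[OF E] and eo = eigsysD(2)[OF E] and ee = eigsysD(3)[OF E]
  have eH: "e k \<in> H" if "k < l" for k using subspD(6)[OF S eV[OF that]] .
  have Jl: "J \<le> l" using \<open>i < l\<close> by (simp add: J_def)
  have \<Lambda>0: "\<Lambda> \<ge> 0" using en_eigsys[OF E \<open>i < l\<close>] en.nonneg[OF eH[OF \<open>i < l\<close>]] by (simp add: \<Lambda>_def J_def)
  \<comment> \<open>Monotonicity of the levels up to \<open>i\<close>: by orthonormality
    \<open>e i\<close> is admissible in the characterisation of each earlier one.\<close>
  have lk: "minmax (Suc k) V \<le> \<Lambda>" if "k < J" for k
    using eigsys_argmin[OF S E, of k "e i"] that \<open>i < l\<close> eV[OF \<open>i < l\<close>] eo[of i i] eo[of i] en_eigsys[OF E \<open>i < l\<close>]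
    by (auto simp: \<Lambda>_def J_def less_Suc_eq)
  \<comment> \<open>The first \<open>J\<close> eigenvectors of \<open>V\<close> are replaced by
    vectors \<open>w k\<close> of one \<open>W n\<close>, closer than \<open>\<eta>\<close> in both
    seminorms. Every combination of the \<open>w k\<close> is then close to the same combination of
    the \<open>e k\<close>, relative to the length \<open>a\<close> of the coefficient
    vector.\<close>
  have main: "\<exists>n\<ge>n0. minmax J (W n) \<le> ((sqrt \<Lambda> + \<delta>) / (1 - \<delta>))\<^sup>2" if \<delta>: "0 < \<delta>" "\<delta> < 1" for \<delta>
  proof -
    \<comment> \<open>Each coefficient is at most \<open>a\<close>, so \<open>J\<close> errors of
      size \<open>\<eta>\<close> add up to at most \<open>\<delta> * a\<close>.\<close>
    define \<eta> where "\<eta> = \<delta> / real J"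
    have J0: "real J > 0" by (simp add: J_def)
    have \<eta>0: "\<eta> > 0" using \<delta> J0 by (simp add: \<eta>_def)
    define P where "P k n w \<longleftrightarrow> n \<ge> n0 \<and> w \<in> W n \<and>
        sqdist ip (e k) w < \<eta>\<^sup>2 \<and> sqdist en (e k) w < \<eta>\<^sup>2" for k n w
    have "\<exists>n w. P k n w" if "k < J" for k
      using dense[OF eV, of k "\<eta>\<^sup>2"] that Jl \<eta>0 unfolding P_def by auto
    then obtain N w where "\<And>k. k < J \<Longrightarrow> P k (N k) (w k)" by metis
    then have Nw: "\<And>k. k < J \<Longrightarrow> N k \<ge> n0" "\<And>k. k < J \<Longrightarrow> w k \<in> W (N k)"
      "\<And>k. k < J \<Longrightarrow> sqdist ip (e k) (w k) < \<eta>\<^sup>2"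
      "\<And>k. k < J \<Longrightarrow> sqdist en (e k) (w k) < \<eta>\<^sup>2"
      unfolding P_def by auto
    \<comment> \<open>Density is available for one vector at a time; since the spaces increase, any
      common upper bound of the finitely many \<open>N k\<close> serves.\<close>
    define n where "n = n0 + (\<Sum>k<J. N k)"
    have nN: "N k \<le> n" if "k < J" for k
      using member_le_sum[of k "{..<J}" N] that by (simp add: n_def)
    have wn: "w k \<in> W n" if "k < J" for k using WV(2)[OF Nw(1)[OF that] nN[OF that]] Nw(2)[OF that] by auto
    have Sn: "subsp (W n)" by (rule WV) (simp add: n_def)
    have wH: "w k \<in> H" if "k < J" for k using subspD(6)[OF Sn wn[OF that]] .
    \<comment> \<open>On the span of the \<open>w k\<close> the root of the energy is at most
      \<open>(sqrt \<Lambda> + \<delta>) * a\<close> and the root of the mass at least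
      \<open>(1 - \<delta>) * a\<close>. The quotient \<open>G\<close> tends to
      \<open>sqrt \<Lambda>\<close> as \<open>\<delta>\<close> tends to 0.\<close>
    define G where "G = (sqrt \<Lambda> + \<delta>) / (1 - \<delta>)"
    have G0: "G \<ge> 0" using \<Lambda>0 \<delta> by (simp add: G_def)
    have est: "(\<Sum>k<J. (c k)\<^sup>2) \<le> (1 / (1 - \<delta>))\<^sup>2 * ip (lincomb J c w) (lincomb J c w)"
       "en (lincomb J c w) (lincomb J c w)
          \<le> G\<^sup>2 * ip (lincomb J c w) (lincomb J c w)" for c
    proof -
      define a where "a = sqrt (\<Sum>k<J. (c k)\<^sup>2)"
      have a0: "a \<ge> 0" by (simp add: a_def sum_nonneg)
      have a2: "a\<^sup>2 = (\<Sum>k<J. (c k)\<^sup>2)" by (simp add: a_def sum_nonneg)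
      have ca: "\<bar>c k\<bar> \<le> a" if "k < J" for k
        unfolding a_def using member_le_sum[of k "{..<J}" "\<lambda>k. (c k)\<^sup>2"] that by (intro real_le_rsqrt) auto
      let ?X = "\<lambda>x. \<Sum>k<J. c k * e k x" and ?Y = "\<lambda>x. \<Sum>k<J. c k * w k x"
      have XH: "?X \<in> H" and YH: "?Y \<in> H" using eH wH Jl by (auto intro!: ip.H_sum)
      have D: "(\<lambda>x. ?X x - ?Y x) = (\<lambda>x. \<Sum>k<J. c k * (e k x - w k x))"
        by (simp add: sum_subtractf[symmetric] right_diff_distrib)
      have bound: "(\<Sum>k<J. \<bar>c k\<bar> * r k) \<le> \<delta> * a" if r: "\<And>k. k < J \<Longrightarrow> 0 \<le> r k \<and> r k \<le> \<eta>" for r :: "nat \<Rightarrow> real"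
      proof -
        have "(\<Sum>k<J. \<bar>c k\<bar> * r k) \<le> (\<Sum>k<J. a * \<eta>)"
          using r ca a0 by (intro sum_mono mult_mono) auto
        also have "\<dots> = \<delta> * a" using J0 by (simp add: \<eta>_def)
        finally show ?thesis .
      qed
      have dH: "\<And>k. k < J \<Longrightarrow> (\<lambda>x. e k x - w k x) \<in> H" using eH wH Jl by (intro ip.H_diff) auto
      have "sqrt (sqdist ip (e k) (w k)) \<le> \<eta>"
        "sqrt (sqdist en (e k) (w k)) \<le> \<eta>" if "k < J" for k
        using Nw(3,4)[OF that] \<eta>0 by (auto intro!: real_le_lsqrt)
      then have "(\<Sum>k<J. \<bar>c k\<bar> * sqrt (sqdist ip (e k) (w k))) \<le> \<delta> * a"
        "(\<Sum>k<J. \<bar>c k\<bar> * sqrt (sqdist en (e k) (w k))) \<le> \<delta> * a"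
        using ip.nonneg[OF dH] en.nonneg[OF dH] by (auto intro!: bound)
      then have "sqrt (sqdist ip ?X ?Y) \<le> \<delta> * a"
        "sqrt (sqdist en ?X ?Y) \<le> \<delta> * a"
        using ip.sqrt_sum_le[of J "\<lambda>k x. e k x - w k x" c, OF dH] en.sqrt_sum_le[of J "\<lambda>k x. e k x - w k x" c, OF dH]
        unfolding D by (auto intro: order_trans)
      then have t: "\<bar>sqrt (ip ?X ?X) - sqrt (ip ?Y ?Y)\<bar> \<le> \<delta> * a" "\<bar>sqrt (en ?X ?X) - sqrt (en ?Y ?Y)\<bar> \<le> \<delta> * a"
        using ip.sqrt_triangle[OF XH YH] en.sqrt_triangle[OF XH YH] by linarith+
      have "ip ?X ?X = a\<^sup>2" unfolding a2 by (rule orthonormal_comb) (use eH eo Jl in auto)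
      then have iX: "sqrt (ip ?X ?X) = a" using a0 by simp
      have "en ?X ?X = (\<Sum>k<J. minmax (Suc k) V * (c k)\<^sup>2)"
        by (rule orthonormal_comb_en) (use eH eo ee eV Jl in auto)
      also have "\<dots> \<le> \<Lambda> * a\<^sup>2" unfolding a2 sum_distrib_left using lk by (intro sum_mono mult_right_mono) auto
      finally have eX: "sqrt (en ?X ?X) \<le> sqrt \<Lambda> * a"
        using a0 \<Lambda>0 by (metis real_sqrt_le_mono real_sqrt_mult real_sqrt_abs abs_of_nonneg)
      have iY: "(1 - \<delta>) * a \<le> sqrt (ip ?Y ?Y)" using t(1) iX by (simp add: algebra_simps)
      have i0: "ip ?Y ?Y \<ge> 0" by (rule ip.nonneg[OF YH])
      have aY: "a \<le> 1 / (1 - \<delta>) * sqrt (ip ?Y ?Y)" using iY \<delta> by (simp add: field_simps)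
      then have "a\<^sup>2 \<le> (1 / (1 - \<delta>) * sqrt (ip ?Y ?Y))\<^sup>2" using a0 by (intro power_mono) auto
      then show "(\<Sum>k<J. (c k)\<^sup>2) \<le> (1 / (1 - \<delta>))\<^sup>2 * ip ?Y ?Y"
        using i0 unfolding a2[symmetric] by (simp add: power_mult_distrib power_divide)
      have "sqrt (en ?Y ?Y) \<le> (sqrt \<Lambda> + \<delta>) * a" using t(2) eX by (simp add: algebra_simps)
      also have "\<dots> \<le> (sqrt \<Lambda> + \<delta>) * (1 / (1 - \<delta>) * sqrt (ip ?Y ?Y))"
        using aY \<Lambda>0 \<delta> by (intro mult_left_mono) auto
      also have "\<dots> = G * sqrt (ip ?Y ?Y)" by (simp add: G_def)
      finally have "(sqrt (en ?Y ?Y))\<^sup>2 \<le> (G * sqrt (ip ?Y ?Y))\<^sup>2" using en.nonneg[OF YH] by (intro power_mono) auto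
      then show "en ?Y ?Y \<le> G\<^sup>2 * ip ?Y ?Y" using en.nonneg[OF YH] i0 by (simp add: power_mult_distrib)
    qed
    have "indep J w"
      unfolding indep_def
    proof (intro allI impI)
      fix c k assume "ip (lincomb J c w) (lincomb J c w) = 0" and k: "k < J"
      then have "(\<Sum>k<J. (c k)\<^sup>2) \<le> 0" using est(1)[of c] by simp
      then have "(\<Sum>k<J. (c k)\<^sup>2) = 0" by (simp add: sum_nonneg antisym)
      then show "c k = 0" using k by (simp add: sum_nonneg_eq_0_iff)
    qed
    then have "minmax J (W n) \<le> G\<^sup>2"
      using minmax_le[OF Sn _ wn _ est(2)] by (simp add: J_def)
    then show ?thesis unfolding G_def by (intro exI[of _ n]) (simp add: n_def)
  qed
  have "((\<lambda>\<delta>. ((sqrt \<Lambda> + \<delta>) / (1 - \<delta>))\<^sup>2) \<longlongrightarrow> ((sqrt \<Lambda> + 0) / (1 - 0))\<^sup>2) (at_right 0)"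
    by (intro tendsto_intros) auto
  then have "eventually (\<lambda>\<delta>. ((sqrt \<Lambda> + \<delta>) / (1 - \<delta>))\<^sup>2 < \<Lambda> + \<epsilon>) (at_right 0)"
    using \<open>\<epsilon> > 0\<close> \<Lambda>0 by (intro order_tendstoD) auto
  moreover have "eventually (\<lambda>\<delta>::real. 0 < \<delta> \<and> \<delta> < 1) (at_right 0)"
    by (auto simp: eventually_at_right_field intro!: exI[of _ 1])
  ultimately have "eventually (\<lambda>\<delta>. ((sqrt \<Lambda> + \<delta>) / (1 - \<delta>))\<^sup>2 < \<Lambda> + \<epsilon> \<and> 0 < \<delta> \<and> \<delta> < 1) (at_right 0)"
    by eventually_elim auto
  then obtain \<delta> where "((sqrt \<Lambda> + \<delta>) / (1 - \<delta>))\<^sup>2 < \<Lambda> + \<epsilon>" "0 < \<delta>" "\<delta> < 1"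
    using eventually_happens[of _ "at_right (0::real)"] by force
  then show ?thesis using main[of \<delta>] by (force simp: \<Lambda>_def J_def)
qed

text \<open>The levels of \<open>W n\<close> decrease to those of \<open>V\<close>, the eigenvectors
  of \<open>W n\<close> subconverge index by index, and the limits inherit orthonormality and the
  equations. Convergence of the levels is what makes the limit at index \<open>i\<close> an
  eigenvector for the level \<open>Suc i\<close> and not for some other eigenvalue.\<close>

theorem eigsys_approximation:
  fixes n0 :: nat
  assumes V: "closed_subsp V" and co: "coercive V \<mu>" and less: "minmax l V < \<mu>" and l1: "l \<ge> 1"
    and W: "\<And>n. n \<ge> n0 \<Longrightarrow> closed_subsp (W n)" "\<And>n m. n0 \<le> n \<Longrightarrow> n \<le> m \<Longrightarrow> W n \<subseteq> W m" "\<And>n. n \<ge> n0 \<Longrightarrow> W n \<subseteq> V"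
    and Wco: "\<And>n \<mu>'. n \<ge> n0 \<Longrightarrow> coercive (W n) \<mu>'"
    and Wdim: "\<And>n. n \<ge> n0 \<Longrightarrow> \<exists>\<phi>. (\<forall>i<l. \<phi> i \<in> W n) \<and> indep l \<phi>"
    and dense: "\<And>v \<epsilon>. v \<in> V \<Longrightarrow> \<epsilon> > 0 \<Longrightarrow> \<exists>n\<ge>n0. \<exists>w\<in>W n.
        sqdist ip v w < \<epsilon> \<and> sqdist en v w < \<epsilon>"
  shows "\<exists>U s u. (\<forall>n\<ge>n0. eigsys (W n) l (U n)) \<and> strict_mono s \<and> (\<forall>n. s n \<ge> n0) \<and> eigsys V l u \<and>
     (\<forall>i<l. conv (\<lambda>n. U (s n) i) (u i))"
proof -
  note S = closed_subspD[OF V]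
  note SW = closed_subspD[OF W(1)]
  have WH: "w \<in> H" if "w \<in> W n" "n \<ge> n0" for w n using subspD(6)[OF SW[OF that(2)] that(1)] .
  have "\<exists>U. eigsys (W n) l U" if n: "n \<ge> n0" for n
  proof -
    obtain \<phi> where "\<And>i. i < l \<Longrightarrow> \<phi> i \<in> W n" "indep l \<phi>" using Wdim[OF n] by blast
    \<comment> \<open>On \<open>W n\<close> every constant is admissible, so the threshold is put
      just above the level itself.\<close>
    then show ?thesis using eigsys_exists[OF W(1)[OF n] Wco[OF n, of "minmax l (W n) + 1"], of l \<phi> l] by simp
  qed
  then obtain U where U: "\<And>n. n \<ge> n0 \<Longrightarrow> eigsys (W n) l (U n)" by metis
  obtain \<phi> where \<phi>: "\<And>i. i < l \<Longrightarrow> \<phi> i \<in> W n0" "indep l \<phi>" using Wdim[of n0] by blast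
  have \<phi>V: "\<phi> i \<in> V" if "i < l" for i using \<phi>(1)[OF that] W(3)[of n0] by auto
  obtain e where E: "eigsys V l e" using eigsys_exists[OF V co less \<phi>V \<phi>(2)] by blast
  define ev where "ev i n = minmax (Suc i) (W n)" for i n
  have Wdim': "\<exists>\<phi>. (\<forall>k<Suc i. \<phi> k \<in> W n) \<and> indep (Suc i) \<phi>" if i: "i < l" and n: "n \<ge> n0" for i n
  proof -
    obtain \<phi> where "\<And>i. i < l \<Longrightarrow> \<phi> i \<in> W n" "indep l \<phi>" using Wdim[OF n] by blast
    then show ?thesis using indep_prefix[of l \<phi> "Suc i"] i by (intro exI[of _ \<phi>]) auto
  qed
  have lamV: "minmax (Suc i) V \<le> ev i n" if "i < l" "n \<ge> n0" for i n
    unfolding ev_def by (rule minmax_mono[OF S W(3)[OF that(2)] _ Wdim'[OF that]]) simp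
  have lamdec: "ev i m \<le> ev i n" if "i < l" "n \<ge> n0" "n \<le> m" for i n m
    unfolding ev_def using that by (intro minmax_mono[OF SW W(2)] Wdim') auto
  have lamlim: "ev i \<longlonglongrightarrow> minmax (Suc i) V" if "i < l" for i
  proof (rule LIMSEQ_I)
    fix \<epsilon> :: real assume "\<epsilon> > 0"
    then obtain n where n: "n \<ge> n0" "ev i n < minmax (Suc i) V + \<epsilon>"
      using minmax_approx_upper[OF S E \<open>i < l\<close> SW W(2) dense] unfolding ev_def by blast
    then have "norm (ev i m - minmax (Suc i) V) < \<epsilon>" if "m \<ge> n" for m
      using lamdec[OF \<open>i < l\<close> n(1) that] lamV[OF \<open>i < l\<close>, of m] that by simp
    then show "\<exists>N. \<forall>m\<ge>N. norm (ev i m - minmax (Suc i) V) < \<epsilon>" by blast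
  qed
  \<comment> \<open>All earlier levels lie below \<open>\<mu>\<close> too, because the last
    eigenvector \<open>e (l - 1)\<close> is a competitor for each of them.\<close>
  have lamlt: "minmax (Suc i) V < \<mu>" if "i < l" for i
  proof -
    have l1': "l - 1 < l" using l1 by simp
    note Eo = eigsysD[OF E]
    have "minmax (Suc i) V \<le> en (e (l - 1)) (e (l - 1))"
    proof (cases "i = l - 1")
      case True
      then show ?thesis using en_eigsys[OF E l1'] by simp
    next
      case False
      then show ?thesis using that Eo(1)[OF l1'] Eo(2)[OF l1' l1'] Eo(2)[OF l1']
        by (intro eigsys_argmin[OF S E that]) auto
    qed
    also have "\<dots> = minmax l V" using en_eigsys[OF E l1'] l1 by simp
    finally show ?thesis using less by simp
  qed
  have UW: "U n i \<in> W n" if "i < l" "n \<ge> n0" for n i using eigsysD(1)[OF U that(1)] that by simp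
  have UV: "U n i \<in> V" if "i < l" "n \<ge> n0" for n i using UW[OF that] W(3)[OF that(2)] by auto
  have UH: "U n i \<in> H" if "i < l" "n \<ge> n0" for n i using subspD(6)[OF S UV[OF that]] .
  have U1: "ip (U n i) (U n i) = 1" if "i < l" "n \<ge> n0" for n i using eigsysD(2)[OF U[OF that(2)] that(1,1)] by simp
  have Uen: "en (U n i) (U n i) = ev i n" if "i < l" "n \<ge> n0" for n i
    using en_eigsys[OF U[OF that(2)] that(1)] by (simp add: ev_def)
  txt \<open>Testing the eigenvalue equation on the larger domain with the eigenfunction of the smaller one.\<close>
  have Udiff: "sqdist en (U n i) (U m i)
      = ev i m * sqdist ip (U n i) (U m i) + (ev i n - ev i m)"
    if i: "i < l" and n: "n \<ge> n0" and nm: "n \<le> m" for n m i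
  proof -
    have m: "m \<ge> n0" using n nm by simp
    have "U n i \<in> W m" using UW[OF i n] W(2)[OF n nm] by auto
    then have "en (U m i) (U n i) = ev i m * ip (U m i) (U n i)"
      using eigsysD(3)[OF U[OF m] i] by (simp add: ev_def)
    then have "en (U n i) (U m i) = ev i m * ip (U n i) (U m i)"
      using UH[OF i n] UH[OF i m] by (simp add: ip.sym[of "U n i"] en.sym[of "U n i"])
    then show ?thesis using UH[OF i n] UH[OF i m] U1[OF i n] U1[OF i m] Uen[OF i n] Uen[OF i m]
      by (simp add: ip.square_diff en.square_diff algebra_simps)
  qed
  \<comment> \<open>One subsequence for all indices, refined once per index. It stays at or above
    \<open>n0\<close> because nothing is known of \<open>U n\<close> for smaller
    \<open>n\<close>.\<close>
  have "\<exists>s. strict_mono s \<and> (\<forall>n. s n \<ge> n0) \<and> (\<forall>i<p. \<exists>v\<in>V. conv (\<lambda>n. U (s n) i) v)" if "p \<le> l" for p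
    using that
  proof (induction p)
    case 0
    show ?case by (intro exI[of _ "\<lambda>n. n0 + n"]) (auto simp: strict_mono_def)
  next
    case (Suc p)
    then obtain s where s: "strict_mono s" "\<And>n. s n \<ge> n0" "\<And>i. i < p \<Longrightarrow> \<exists>v\<in>V. conv (\<lambda>n. U (s n) i) v" by auto
    have pl: "p < l" using Suc.prems by simp
    define L where "L = minmax (Suc p) V"
    \<comment> \<open>The energy of a difference exceeds \<open>L\<close> times its mass by two
      terms: a level excess times that mass, which is at most 4 for unit vectors, and a difference
      of two levels. The factor 5 covers both and is the same for the two indices.\<close>
    define \<delta> where "\<delta> n = 5 * \<bar>ev p (s n) - L\<bar>" for n
    have wbound: "sqdist ip (U n p) (U m p) \<le> 4" if "n \<ge> n0" "m \<ge> n0" for n m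
      using ip.square_diff_le[OF UH[OF pl that(1)] UH[OF pl that(2)]] U1[OF pl that(1)] U1[OF pl that(2)] by simp
    have wb0: "sqdist ip (U n p) (U m p) \<ge> 0" if "n \<ge> n0" "m \<ge> n0" for n m
      by (intro ip.nonneg ip.H_diff UH pl that)
    have one: "sqdist en (U (s n) p) (U (s m) p)
       \<le> L * sqdist ip (U (s n) p) (U (s m) p) + \<delta> n + \<delta> m"
      if nm: "n \<le> m" for n m
    proof -
      have snm: "s n \<le> s m" using s(1) nm by (simp add: strict_mono_less_eq)
      let ?w = "sqdist ip (U (s n) p) (U (s m) p)"
      have "ev p (s m) - L \<ge> 0" using lamV[OF pl s(2)] by (simp add: L_def)
      then have "(ev p (s m) - L) * ?w \<le> (ev p (s m) - L) * 4" using wbound[OF s(2) s(2)] by (intro mult_left_mono) auto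
      moreover have "ev p (s m) * ?w = (ev p (s m) - L) * ?w + L * ?w" by (simp add: algebra_simps)
      moreover have "xw + (y - x) \<le> Lw + 5 * \<bar>y - L\<bar> + 5 * \<bar>x - L\<bar>"
        if "z \<le> (x - L) * 4" "xw = z + Lw" for x y z xw Lw using that by (auto simp: abs_if)
      ultimately show ?thesis unfolding Udiff[OF pl s(2) snm] \<delta>_def by blast
    qed
    have "\<exists>r. strict_mono r \<and> Cauchy_seq (\<lambda>n. U (s (r n)) p)"
    proof (rule coercive_Cauchy_subseq[OF S co, where B = 1 and \<nu> = L and \<delta> = \<delta>])
      show "L < \<mu>" using lamlt[OF pl] by (simp add: L_def)
      show "U (s n) p \<in> V" for n using UV[OF pl s(2)] .
      show "ip (U (s n) p) (U (s n) p) \<le> 1" for n using U1[OF pl s(2)] by simp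
      have "(\<lambda>n. 5 * \<bar>ev p (s n) - L\<bar>) \<longlonglongrightarrow> 5 * \<bar>L - L\<bar>"
        using LIMSEQ_subseq_LIMSEQ[OF lamlim[OF pl] s(1)] by (intro tendsto_intros) (simp add: o_def L_def)
      then show "\<delta> \<longlonglongrightarrow> 0" unfolding \<delta>_def by simp
      fix m n
      show "sqdist en (U (s m) p) (U (s n) p)
       \<le> L * sqdist ip (U (s m) p) (U (s n) p) + \<delta> m + \<delta> n"
      proof (cases "m \<le> n")
        case True
        then show ?thesis by (rule one)
      next
        case False
        then show ?thesis using one[of n m] ip.square_diff_commute[OF UH[OF pl s(2)] UH[OF pl s(2)], of m n]
            en.square_diff_commute[OF UH[OF pl s(2)] UH[OF pl s(2)], of m n] by simp
      qed
    qed
    then obtain r where r: "strict_mono r" "Cauchy_seq (\<lambda>n. U (s (r n)) p)" by blast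
    then obtain v where v: "v \<in> V" "conv (\<lambda>n. U (s (r n)) p) v"
      using closed_subsp_limit[OF V UV[OF pl s(2)] r(2)] by blast
    have "\<exists>v\<in>V. conv (\<lambda>n. U ((s \<circ> r) n) i) v" if "i < Suc p" for i
    proof (cases "i = p")
      case True
      then show ?thesis using v by auto
    next
      case False
      then obtain v where "v \<in> V" "conv (\<lambda>n. U (s n) i) v" using s(3)[of i] \<open>i < Suc p\<close> by auto
      then show ?thesis using conv_subseq[OF _ r(1)] by (intro bexI[of _ v]) auto
    qed
    then show ?case using s r by (intro exI[of _ "s \<circ> r"]) (auto simp: strict_mono_def)
  qed
  then obtain s where s: "strict_mono s" "\<And>n. s n \<ge> n0" "\<And>i. i < l \<Longrightarrow> \<exists>v\<in>V. conv (\<lambda>n. U (s n) i) v"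
    by blast
  then obtain u where u: "\<And>i. i < l \<Longrightarrow> u i \<in> V" "\<And>i. i < l \<Longrightarrow> conv (\<lambda>n. U (s n) i) (u i)" by metis
  have uH: "u i \<in> H" if "i < l" for i using subspD(6)[OF S u(1)[OF that]] .
  have "eigsys V l u"
    unfolding eigsys_def
  proof (intro conjI allI impI ballI)
    show "u i \<in> V" if "i < l" for i using u that by blast
    show "ip (u i) (u k) = (if i = k then 1 else 0)" if i: "i < l" and k: "k < l" for i k
    proof -
      have "(\<lambda>n. ip (U (s n) i) (U (s n) k)) \<longlonglongrightarrow> ip (u i) (u k)"
        using u(2)[OF i] u(2)[OF k] uH[OF i] uH[OF k] UH[OF i s(2)] UH[OF k s(2)]
        by (intro ip.conv_inner2) (auto simp: conv_def)
      moreover have "ip (U (s n) i) (U (s n) k) = (if i = k then 1 else 0)" for n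
        using eigsysD(2)[OF U[OF s(2)] i k] .
      ultimately show ?thesis by (simp add: LIMSEQ_const_iff split: if_splits)
    qed
    fix i \<phi> assume i: "i < l" and \<phi>: "\<phi> \<in> V"
    \<comment> \<open>An element of \<open>W n1\<close> is an admissible test vector for all later
      spaces, so the equation passes to the limit along the subsequence.\<close>
    have test: "en (u i) w = minmax (Suc i) V * ip (u i) w" if w: "w \<in> W n1" "n1 \<ge> n0" for w n1
    proof -
      have wH: "w \<in> H" using WH[OF w] .
      have c1: "(\<lambda>n. en (U (s n) i) w) \<longlonglongrightarrow> en (u i) w"
        using u(2)[OF i] uH[OF i] UH[OF i s(2)] wH by (intro en.conv_inner) (auto simp: conv_def)
      have c2: "(\<lambda>n. ip (U (s n) i) w) \<longlonglongrightarrow> ip (u i) w"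
        using u(2)[OF i] uH[OF i] UH[OF i s(2)] wH by (intro ip.conv_inner) (auto simp: conv_def)
      have c3: "(\<lambda>n. ev i (s n)) \<longlonglongrightarrow> minmax (Suc i) V"
        using LIMSEQ_subseq_LIMSEQ[OF lamlim[OF i] s(1)] by (simp add: o_def)
      have "en (U (s n) i) w = ev i (s n) * ip (U (s n) i) w" if "n \<ge> n1" for n
      proof -
        have "s n \<ge> n1" using strict_mono_imp_increasing[OF s(1), of n] that by simp
        then have "w \<in> W (s n)" using W(2)[OF w(2)] w(1) by auto
        then show ?thesis using eigsysD(3)[OF U[OF s(2)] i] by (simp add: ev_def)
      qed
      then have "\<forall>\<^sub>F n in sequentially. ev i (s n) * ip (U (s n) i) w = en (U (s n) i) w"
        unfolding eventually_sequentially by (intro exI[of _ n1]) auto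
      then have "(\<lambda>n. en (U (s n) i) w) \<longlonglongrightarrow> minmax (Suc i) V * ip (u i) w"
        using tendsto_mult[OF c3 c2] by (rule Lim_transform_eventually[rotated])
      then show ?thesis using c1 LIMSEQ_unique by blast
    qed
    \<comment> \<open>General test vectors of \<open>V\<close> are reached by density from the union
      of the \<open>W n\<close>; both sides of the equation are continuous in the test
      vector.\<close>
    define P where "P k w \<longleftrightarrow> (\<exists>n\<ge>n0. w \<in> W n) \<and> sqdist ip \<phi> w < inverse (real (Suc k)) \<and>
       sqdist en \<phi> w < inverse (real (Suc k))" for k w
    have "\<exists>w. P k w" for k
      using dense[OF \<phi>, of "inverse (real (Suc k))"] unfolding P_def by auto
    then obtain w where "\<And>k. P k (w k)" by metis
    then have w: "\<And>k. \<exists>n\<ge>n0. w k \<in> W n" "\<And>k. sqdist ip \<phi> (w k) < inverse (real (Suc k))"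
      "\<And>k. sqdist en \<phi> (w k) < inverse (real (Suc k))" unfolding P_def by auto
    have wH: "w k \<in> H" for k using w(1)[of k] WH by blast
    have \<phi>H: "\<phi> \<in> H" using subspD(6)[OF S \<phi>] .
    have sw: "sqdist ip (w k) \<phi> = sqdist ip \<phi> (w k)"
      "sqdist en (w k) \<phi> = sqdist en \<phi> (w k)" for k
      by (rule ip.square_diff_commute[OF wH \<phi>H], rule en.square_diff_commute[OF wH \<phi>H])
    have "ip.conv w \<phi>" unfolding ip.conv_def
      using w(2) ip.nonneg[OF ip.H_diff[OF \<phi>H wH]] unfolding sw
      by (intro tendsto_sandwich[OF _ _ tendsto_const LIMSEQ_inverse_real_of_nat]) (auto simp: less_imp_le)
    moreover have "en.conv w \<phi>" unfolding en.conv_def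
      using w(3) en.nonneg[OF en.H_diff[OF \<phi>H wH]] unfolding sw
      by (intro tendsto_sandwich[OF _ _ tendsto_const LIMSEQ_inverse_real_of_nat]) (auto simp: less_imp_le)
    ultimately have lims: "(\<lambda>k. ip (w k) (u i)) \<longlonglongrightarrow> ip \<phi> (u i)" "(\<lambda>k. en (w k) (u i)) \<longlonglongrightarrow> en \<phi> (u i)"
      using wH \<phi>H uH[OF i] by (auto intro!: ip.conv_inner en.conv_inner)
    have "en (w k) (u i) = minmax (Suc i) V * ip (w k) (u i)" for k
      using w(1)[of k] test wH[of k] uH[OF i] by (auto simp: ip.sym[of "w k"] en.sym[of "w k"])
    then have "(\<lambda>k. en (w k) (u i)) \<longlonglongrightarrow> minmax (Suc i) V * ip \<phi> (u i)"
      using tendsto_mult_left[OF lims(1)] by simp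
    then have "en \<phi> (u i) = minmax (Suc i) V * ip \<phi> (u i)" using lims(2) LIMSEQ_unique by blast
    then show "en (u i) \<phi> = minmax (Suc i) V * ip (u i) \<phi>"
      using uH[OF i] \<phi>H by (simp add: ip.sym[of \<phi>] en.sym[of \<phi>])
  qed
  then show ?thesis using U s u by blast
qed

section \<open>Extending estimates from a dense set\<close>

lemma functional_conv:
  assumes "functional f" "\<And>n. u n \<in> H" "v \<in> H" "ip.conv u v"
  shows "(\<lambda>n. f (u n)) \<longlonglongrightarrow> f v"
proof -
  obtain K where K: "\<And>u. u \<in> H \<Longrightarrow> \<bar>f u\<bar> \<le> K * sqrt (ip u u)"
    using assms(1) unfolding functional_def by blast
  have "(\<lambda>n. K * sqrt (sqdist ip (u n) v)) \<longlonglongrightarrow> K * sqrt 0"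
    using assms(4) unfolding ip.conv_def by (intro tendsto_intros)
  then have lim: "(\<lambda>n. K * sqrt (sqdist ip (u n) v)) \<longlonglongrightarrow> 0" by simp
  have "(\<lambda>n. f (u n) - f v) \<longlonglongrightarrow> 0"
  proof (rule Lim_null_comparison[OF always_eventually lim], rule allI)
    fix n
    show "norm (f (u n) - f v) \<le> K * sqrt (sqdist ip (u n) v)"
      using K[OF ip.H_diff[OF assms(2,3)], of n] functional_diff[OF assms(1,2,3), of n] by simp
  qed
  then show ?thesis by (simp add: LIM_zero_iff)
qed

text \<open>All terms are continuous under \<open>conv\<close>. In the application \<open>D\<close>
  consists of test functions, the only functions for which the estimates are computed
  directly.\<close>

lemma estimate_dense:
  assumes V: "V \<subseteq> H" and dense: "\<And>u. u \<in> V \<Longrightarrow> \<exists>\<phi>. (\<forall>k. \<phi> k \<in> D) \<and> conv \<phi> u" and D: "D \<subseteq> H"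
    and f: "\<And>i. i < M \<Longrightarrow> functional (f i)"
    and est: "\<And>u. u \<in> D \<Longrightarrow> \<mu> * ip u u \<le> en u u + C * (\<Sum>i<(M::nat). (f i u)\<^sup>2)"
    and u: "u \<in> V"
  shows "\<mu> * ip u u \<le> en u u + C * (\<Sum>i<M. (f i u)\<^sup>2)"
proof -
  obtain \<phi> where \<phi>: "\<And>k. \<phi> k \<in> D" "conv \<phi> u" using dense[OF u] by blast
  have H: "\<And>k. \<phi> k \<in> H" "u \<in> H" using \<phi>(1) D u V by auto
  have c: "ip.conv \<phi> u" "en.conv \<phi> u" using \<phi>(2) by (simp_all add: conv_def)
  have "(\<lambda>k. \<mu> * ip (\<phi> k) (\<phi> k)) \<longlonglongrightarrow> \<mu> * ip u u"
    by (intro tendsto_intros ip.conv_square H c)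
  moreover have "(\<lambda>k. en (\<phi> k) (\<phi> k) + C * (\<Sum>i<M. (f i (\<phi> k))\<^sup>2)) \<longlonglongrightarrow> en u u + C * (\<Sum>i<M. (f i u)\<^sup>2)"
    by (intro tendsto_intros en.conv_square functional_conv f H c) auto
  ultimately show ?thesis using est[OF \<phi>(1)] by (intro LIMSEQ_le) auto
qed

lemma coercive_dense:
  assumes "V \<subseteq> H" "\<And>u. u \<in> V \<Longrightarrow> \<exists>\<phi>. (\<forall>k. \<phi> k \<in> D) \<and> conv \<phi> u" "D \<subseteq> H"
    and f: "\<And>i. i < M \<Longrightarrow> functional (f i)" and "C \<ge> 0"
    and "\<And>u. u \<in> D \<Longrightarrow> \<mu> * ip u u \<le> en u u + C * (\<Sum>i<(M::nat). (f i u)\<^sup>2)"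
  shows "coercive V \<mu>"
  unfolding coercive_def
  using estimate_dense[OF assms(1-4,6)] f \<open>C \<ge> 0\<close> by (intro exI[of _ M] exI[of _ f] exI[of _ C]) simp

end

section \<open>Square integrable functions\<close>

text \<open>Values in a Euclidean space, so that a function and its gradient are covered by the same
  lemmas.\<close>

definition sqint :: "'a measure \<Rightarrow> ('a \<Rightarrow> 'b::euclidean_space) \<Rightarrow> bool" where
  "sqint M f \<longleftrightarrow> f \<in> borel_measurable M \<and> integrable M (\<lambda>x. (norm (f x))\<^sup>2)"

lemma sqintD: assumes "sqint M f"
  shows "f \<in> borel_measurable M" "integrable M (\<lambda>x. (norm (f x))\<^sup>2)"
  using assms by (auto simp: sqint_def)

lemma norm_add_square_le: "(norm (a + b))\<^sup>2 \<le> 2 * (norm a)\<^sup>2 + 2 * (norm b)\<^sup>2" for a b :: "'b::real_inner"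
proof -
  have "(norm (a + b))\<^sup>2 + (norm (a - b))\<^sup>2 = 2 * (norm a)\<^sup>2 + 2 * (norm b)\<^sup>2"
    by (simp add: power2_norm_eq_inner inner_add inner_diff inner_commute)
  then show ?thesis using zero_le_power2[of "norm (a - b)"] by linarith
qed

lemma sqint_add: assumes "sqint M f" "sqint M g" shows "sqint M (\<lambda>x. f x + g x)"
  unfolding sqint_def
proof
  note [measurable] = sqintD(1)[OF assms(1)] sqintD(1)[OF assms(2)]
  show "(\<lambda>x. f x + g x) \<in> borel_measurable M" by measurable
  show "integrable M (\<lambda>x. (norm (f x + g x))\<^sup>2)"
  proof (rule Bochner_Integration.integrable_bound)
    show "integrable M (\<lambda>x. 2 * (norm (f x))\<^sup>2 + 2 * (norm (g x))\<^sup>2)" using assms by (simp add: sqint_def)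
    show "AE x in M. norm ((norm (f x + g x))\<^sup>2) \<le> norm (2 * (norm (f x))\<^sup>2 + 2 * (norm (g x))\<^sup>2)"
      using norm_add_square_le[of "f _" "g _"] by (intro AE_I2) (simp add: abs_of_nonneg)
  qed measurable
qed

lemma sqint_scaleR: assumes "sqint M f" shows "sqint M (\<lambda>x. (a::real) *\<^sub>R f x)"
  using assms by (auto simp: sqint_def power_mult_distrib)

lemma sqint_diff: assumes "sqint M f" "sqint M g" shows "sqint M (\<lambda>x. f x - g x)"
  using sqint_add[OF assms(1) sqint_scaleR[OF assms(2), of "-1"]] by simp

lemma sqint_inner: assumes "sqint M f" "sqint M g" shows "integrable M (\<lambda>x. f x \<bullet> g x)"
proof (rule Bochner_Integration.integrable_bound)
  note [measurable] = sqintD(1)[OF assms(1)] sqintD(1)[OF assms(2)]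
  show "integrable M (\<lambda>x. (norm (f x))\<^sup>2 + (norm (g x))\<^sup>2)" using assms by (simp add: sqint_def)
  show "(\<lambda>x. f x \<bullet> g x) \<in> borel_measurable M" by measurable
  have "\<bar>f x \<bullet> g x\<bar> \<le> (norm (f x))\<^sup>2 + (norm (g x))\<^sup>2" for x
  proof -
    have "\<bar>f x \<bullet> g x\<bar> \<le> norm (f x) * norm (g x)" by (rule Cauchy_Schwarz_ineq2)
    moreover have "2 * norm (f x) * norm (g x) \<le> (norm (f x))\<^sup>2 + (norm (g x))\<^sup>2" by (rule sum_squares_bound)
    moreover have "0 \<le> norm (f x) * norm (g x)" by simp
    ultimately show ?thesis by linarith
  qed
  then show "AE x in M. norm (f x \<bullet> g x) \<le> norm ((norm (f x))\<^sup>2 + (norm (g x))\<^sup>2)" by simp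
qed

lemma sqint_cong_AE: assumes "sqint M f" "g \<in> borel_measurable M" "AE x in M. f x = g x"
  shows "sqint M g"
  unfolding sqint_def
proof
  show "integrable M (\<lambda>x. (norm (g x))\<^sup>2)"
    by (rule integrable_cong_AE_imp[OF sqintD(2)[OF assms(1)]]) (use assms in auto)
qed fact

text \<open>Riesz-Fischer. On an infinite measure space L2 distances do not bound L1 distances, so
  pointwise convergence of a subsequence is drawn from weighted squares of the increments. Fatou's
  lemma then gives convergence of the full sequence.\<close>

lemma L2_complete:
  fixes f :: "nat \<Rightarrow> 'a \<Rightarrow> 'b::euclidean_space"
  assumes f: "\<And>n. sqint M (f n)"
    and Cauchy: "\<And>e::real. e > 0 \<Longrightarrow> \<exists>N. \<forall>m\<ge>N. \<forall>n\<ge>N. (\<integral>x. (norm (f m x - f n x))\<^sup>2 \<partial>M) < e"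
  shows "\<exists>g. sqint M g \<and> (\<lambda>n. \<integral>x. (norm (f n x - g x))\<^sup>2 \<partial>M) \<longlonglongrightarrow> 0"
proof -
  have [measurable]: "f n \<in> borel_measurable M" for n using sqintD(1)[OF f] .
  have "\<exists>N. \<forall>m\<ge>N. \<forall>n\<ge>N. (\<integral>x. (norm (f m x - f n x))\<^sup>2 \<partial>M) < (1/4)^k" for k :: nat
    by (rule Cauchy) simp
  then obtain N where N: "\<And>k m n. m \<ge> N k \<Longrightarrow> n \<ge> N k \<Longrightarrow> (\<integral>x. (norm (f m x - f n x))\<^sup>2 \<partial>M) < (1/4)^k"
    by metis
  \<comment> \<open>The sum dominates every \<open>N i\<close> with \<open>i \<le> k\<close> and
    makes \<open>r\<close> monotone; the summand \<open>k\<close> makes it unbounded.\<close>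
  define r where "r k = (\<Sum>i\<le>k. N i) + k" for k
  have rN: "r k \<ge> N k" for k using member_le_sum[of k "{..k}" N] by (simp add: r_def)
  have rSuc: "r k \<le> r (Suc k)" for k by (simp add: r_def)
  have rk: "r k \<ge> k" for k by (simp add: r_def)
  define D where "D k x = norm (f (r (Suc k)) x - f (r k) x)" for k x
  have [measurable]: "D k \<in> borel_measurable M" for k unfolding D_def by measurable
  have Dint: "integrable M (\<lambda>x. (D k x)\<^sup>2)" for k
    unfolding D_def by (rule sqintD(2)[OF sqint_diff[OF f f]])
  have Dle: "(\<integral>x. (D k x)\<^sup>2 \<partial>M) \<le> (1/4)^k" for k
    using N[of k "r (Suc k)" "r k"] rN[of k] rSuc[of k] by (simp add: D_def)
  \<comment> \<open>The weight \<open>2^k\<close> leaves a summable bound, \<open>(1/4)^k\<close>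
    becoming \<open>(1/2)^k\<close>.\<close>
  have nnD: "(\<integral>\<^sup>+x. ennreal (2^k * (D k x)\<^sup>2) \<partial>M) \<le> ennreal ((1/2)^k)" for k
  proof -
    have "(\<integral>\<^sup>+x. ennreal (2^k * (D k x)\<^sup>2) \<partial>M) = ennreal (\<integral>x. 2^k * (D k x)\<^sup>2 \<partial>M)"
      using Dint by (intro nn_integral_eq_integral) auto
    also have "\<dots> \<le> ennreal (2^k * (1/4)^k)" using Dle by (intro ennreal_leI) simp
    also have "(2::real)^k * (1/4)^k = (1/2)^k" by (simp add: power_mult_distrib[symmetric])
    finally show ?thesis .
  qed
  have "(\<integral>\<^sup>+x. (\<Sum>k. ennreal (2^k * (D k x)\<^sup>2)) \<partial>M) = (\<Sum>k. \<integral>\<^sup>+x. ennreal (2^k * (D k x)\<^sup>2) \<partial>M)"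
    by (rule nn_integral_suminf) measurable
  also have "\<dots> \<le> (\<Sum>k. ennreal ((1/2)^k))" using nnD by (intro suminf_le) auto
  also have "\<dots> = ennreal (\<Sum>k. (1/2)^k)" by (intro suminf_ennreal2) auto
  also have "\<dots> < \<infinity>" by simp
  finally have fin: "(\<integral>\<^sup>+x. (\<Sum>k. ennreal (2^k * (D k x)\<^sup>2)) \<partial>M) \<noteq> \<infinity>" by simp
  have "AE x in M. (\<Sum>k. ennreal (2^k * (D k x)\<^sup>2)) \<noteq> \<infinity>"
    by (rule nn_integral_noteq_infinite[OF _ fin]) measurable
  then have conv: "AE x in M. convergent (\<lambda>k. f (r k) x)"
  proof eventually_elim
    fix x assume "(\<Sum>k. ennreal (2^k * (D k x)\<^sup>2)) \<noteq> \<infinity>"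
    then have s1: "summable (\<lambda>k. 2^k * (D k x)\<^sup>2)" by (intro summable_suminf_not_top) auto
    have s2: "summable (\<lambda>k. (1/2::real)^k)" by simp
    \<comment> \<open>With \<open>a = 2^k * D k x\<close> this is \<open>a \<le> 1 + a^2\<close>
      divided by \<open>2^k\<close>. It bounds the increments by the sum of two convergent
      series.\<close>
    have "D k x \<le> (1/2)^k + 2^k * (D k x)\<^sup>2" for k
    proof -
      have "(1/2::real)^k * 2^k = 1" by (simp add: power_mult_distrib[symmetric])
      then have "((1/2)^k + 2^k * (D k x)\<^sup>2 - D k x) = (1/2)^k * ((1 - 2^k * D k x / 2)\<^sup>2 + 3/4 * (2^k * D k x)\<^sup>2)"
        by (simp add: power2_eq_square algebra_simps)
      also have "\<dots> \<ge> 0" by simp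
      finally show ?thesis by simp
    qed
    moreover have "D k x \<ge> 0" for k by (simp add: D_def)
    ultimately have "summable (\<lambda>k. D k x)"
      by (intro summable_comparison_test[OF _ summable_add[OF s2 s1]]) auto
    then have "summable (\<lambda>k. f (r (Suc k)) x - f (r k) x)"
      unfolding D_def by (rule summable_norm_cancel)
    then have "convergent (\<lambda>n. \<Sum>k<n. f (r (Suc k)) x - f (r k) x)" by (simp add: summable_iff_convergent)
    then have "convergent (\<lambda>n. f (r n) x - f (r 0) x)" unfolding sum_lessThan_telescope[of "\<lambda>k. f (r k) x"] .
    then have "convergent (\<lambda>n. (f (r n) x - f (r 0) x) + f (r 0) x)" by (intro convergent_add convergent_const)
    then show "convergent (\<lambda>k. f (r k) x)" by simp
  qed
  define g where "g x = lim (\<lambda>k. f (r k) x)" for x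
  have [measurable]: "g \<in> borel_measurable M" unfolding g_def by measurable
  have glim: "AE x in M. (\<lambda>k. f (r k) x) \<longlonglongrightarrow> g x"
    using conv by eventually_elim (simp add: g_def convergent_LIMSEQ_iff)
  \<comment> \<open>Fatou's lemma along the subsequence \<open>r k\<close>, with \<open>n\<close>
    held fixed.\<close>
  have key: "(\<integral>\<^sup>+x. ennreal ((norm (f n x - g x))\<^sup>2) \<partial>M) \<le> ennreal e"
    if e: "e > 0" and N0: "\<And>m n. m \<ge> N0 \<Longrightarrow> n \<ge> N0 \<Longrightarrow> (\<integral>x. (norm (f m x - f n x))\<^sup>2 \<partial>M) < e" and n: "n \<ge> N0" for e N0 n
  proof -
    have "(\<integral>\<^sup>+x. ennreal ((norm (f n x - g x))\<^sup>2) \<partial>M) = (\<integral>\<^sup>+x. liminf (\<lambda>k. ennreal ((norm (f n x - f (r k) x))\<^sup>2)) \<partial>M)"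
    proof (rule nn_integral_cong_AE)
      show "AE x in M. ennreal ((norm (f n x - g x))\<^sup>2) = liminf (\<lambda>k. ennreal ((norm (f n x - f (r k) x))\<^sup>2))"
        using glim
      proof eventually_elim
        fix x assume "(\<lambda>k. f (r k) x) \<longlonglongrightarrow> g x"
        then have "(\<lambda>k. ennreal ((norm (f n x - f (r k) x))\<^sup>2)) \<longlonglongrightarrow> ennreal ((norm (f n x - g x))\<^sup>2)"
          by (intro tendsto_intros)
        then show "ennreal ((norm (f n x - g x))\<^sup>2) = liminf (\<lambda>k. ennreal ((norm (f n x - f (r k) x))\<^sup>2))"
          by (rule lim_imp_Liminf[OF trivial_limit_sequentially, symmetric])
      qed
    qed
    also have "\<dots> \<le> liminf (\<lambda>k. \<integral>\<^sup>+x. ennreal ((norm (f n x - f (r k) x))\<^sup>2) \<partial>M)"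
      by (rule nn_integral_liminf) measurable
    also have "\<dots> \<le> ennreal e"
    proof (rule Liminf_le)
      have "(\<integral>\<^sup>+x. ennreal ((norm (f n x - f (r k) x))\<^sup>2) \<partial>M) \<le> ennreal e" if "k \<ge> N0" for k
      proof -
        have "(\<integral>\<^sup>+x. ennreal ((norm (f n x - f (r k) x))\<^sup>2) \<partial>M) = ennreal (\<integral>x. (norm (f n x - f (r k) x))\<^sup>2 \<partial>M)"
          by (intro nn_integral_eq_integral sqintD(2)[OF sqint_diff[OF f f]]) auto
        then show ?thesis using N0[OF n, of "r k"] rk[of k] that by (simp add: ennreal_leI)
      qed
      then show "\<forall>\<^sub>F k in sequentially. (\<integral>\<^sup>+x. ennreal ((norm (f n x - f (r k) x))\<^sup>2) \<partial>M) \<le> ennreal e"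
        unfolding eventually_sequentially by blast
    qed simp
    finally show ?thesis .
  qed
  have sqd: "sqint M (\<lambda>x. f n x - g x)" if "n \<ge> N 0" for n
    unfolding sqint_def
  proof
    show "integrable M (\<lambda>x. (norm (f n x - g x))\<^sup>2)"
    proof (rule integrableI_bounded)
      have "(\<integral>\<^sup>+x. ennreal (norm ((norm (f n x - g x))\<^sup>2)) \<partial>M) \<le> ennreal 1"
        using key[of 1 "N 0" n] N[of 0] that by simp
      then show "(\<integral>\<^sup>+x. ennreal (norm ((norm (f n x - g x))\<^sup>2)) \<partial>M) < \<infinity>"
        by (metis ennreal_less_top infinity_ennreal_def order_le_less_trans)
    qed measurable
  qed measurable
  have sqg: "sqint M g" using sqint_diff[OF f sqd[OF order_refl], of "N 0"] by simp
  have "(\<lambda>n. \<integral>x. (norm (f n x - g x))\<^sup>2 \<partial>M) \<longlonglongrightarrow> 0"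
  proof (rule LIMSEQ_I)
    fix e :: real assume "e > 0"
    then obtain N0 where N0: "\<And>m n. m \<ge> N0 \<Longrightarrow> n \<ge> N0 \<Longrightarrow> (\<integral>x. (norm (f m x - f n x))\<^sup>2 \<partial>M) < e/2"
      using Cauchy[of "e/2"] by auto
    have "norm ((\<integral>x. (norm (f n x - g x))\<^sup>2 \<partial>M) - 0) < e" if n: "n \<ge> N0" for n
    proof -
      have "integrable M (\<lambda>x. (norm (f n x - g x))\<^sup>2)" by (rule sqintD(2)[OF sqint_diff[OF f sqg]])
      then have "ennreal (\<integral>x. (norm (f n x - g x))\<^sup>2 \<partial>M) = (\<integral>\<^sup>+x. ennreal ((norm (f n x - g x))\<^sup>2) \<partial>M)"
        by (intro nn_integral_eq_integral[symmetric]) auto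
      also have "\<dots> \<le> ennreal (e/2)" using key[OF _ N0 n] \<open>e > 0\<close> by simp
      finally have "(\<integral>x. (norm (f n x - g x))\<^sup>2 \<partial>M) \<le> e/2" using \<open>e > 0\<close> by (simp add: ennreal_le_iff)
      moreover have "(\<integral>x. (norm (f n x - g x))\<^sup>2 \<partial>M) \<ge> 0" by simp
      ultimately show ?thesis using \<open>e > 0\<close> by simp
    qed
    then show "\<exists>N. \<forall>n\<ge>N. norm ((\<integral>x. (norm (f n x - g x))\<^sup>2 \<partial>M) - 0) < e" by blast
  qed
  then show ?thesis using sqg by blast
qed

section \<open>Smooth test functions\<close>

definition pd :: "'n \<Rightarrow> (real^'n \<Rightarrow> real) \<Rightarrow> real^'n \<Rightarrow> real" where
  "pd i f x = frechet_derivative f (at x) (axis i 1)"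

text \<open>Differentiability of finite order. It replaces the coinductive \<open>smoothC\<close> in
  the closure proofs, which then go by induction on the order.\<close>

primrec Ck :: "nat \<Rightarrow> (real^'n \<Rightarrow> real) \<Rightarrow> bool" where
  "Ck 0 f \<longleftrightarrow> continuous_on UNIV f"
| "Ck (Suc k) f \<longleftrightarrow> continuous_on UNIV f \<and> f differentiable_on UNIV \<and> (\<forall>i. Ck k (pd i f))"

lemma smoothC_iff_Ck: "smoothC f \<longleftrightarrow> (\<forall>k. Ck k f)"
proof
  have "Ck k f" if "smoothC f" for k
    using that
  proof (induction k arbitrary: f)
    case 0
    then show ?case by (auto elim: smoothC.cases)
  next
    case (Suc k)
    from Suc.prems have "continuous_on UNIV f" "f differentiable_on UNIV" "\<forall>i. smoothC (pd i f)"
      by (auto elim: smoothC.cases simp: pd_def[abs_def])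
    then show ?case using Suc.IH by simp
  qed
  then show "smoothC f \<Longrightarrow> \<forall>k. Ck k f" by blast
next
  assume "\<forall>k. Ck k f"
  then show "smoothC f"
  proof (coinduction arbitrary: f)
    case smoothC
    have "Ck k (pd i f)" for k i using spec[OF smoothC, of "Suc k"] by simp
    moreover have "continuous_on UNIV f" "f differentiable_on UNIV" using spec[OF smoothC, of 1] by simp_all
    ultimately show ?case by (auto simp: pd_def[abs_def])
  qed
qed

lemma pd_eqI: "(f has_derivative f') (at x) \<Longrightarrow> pd i f x = f' (axis i 1)"
  by (simp add: pd_def frechet_derivative_at[symmetric])

lemma Ck_cont: "Ck k f \<Longrightarrow> continuous_on UNIV f"
  by (cases k) auto

lemma Ck_Suc_diff: "Ck (Suc k) f \<Longrightarrow> f differentiable (at x)"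
  by (simp add: differentiable_on_def)

lemma Ck_Suc_has_derivative: "Ck (Suc k) f \<Longrightarrow> (f has_derivative frechet_derivative f (at x)) (at x)"
  using Ck_Suc_diff frechet_derivative_works by blast

lemma Ck_SucI:
  assumes "\<And>x. (f has_derivative f' x) (at x)" "\<And>i. Ck k (\<lambda>x. f' x (axis i 1))"
  shows "Ck (Suc k) f"
proof -
  have "pd i f = (\<lambda>x. f' x (axis i 1))" for i using pd_eqI[OF assms(1)] by blast
  moreover have "f differentiable_on UNIV" using assms(1) by (auto simp: differentiable_on_def differentiable_def)
  ultimately show ?thesis using assms(2) by (simp add: differentiable_imp_continuous_on)
qed

lemma Ck_Suc_imp: "Ck (Suc k) f \<Longrightarrow> Ck k f"
  by (induction k arbitrary: f) auto

lemma Ck_const: "Ck k (\<lambda>x. c)"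
proof (induction k arbitrary: c)
  case (Suc k)
  show ?case by (rule Ck_SucI[where f' = "\<lambda>_ _. 0"]) (use Suc in auto)
qed auto

lemma Ck_add: "Ck k f \<Longrightarrow> Ck k g \<Longrightarrow> Ck k (\<lambda>x. f x + g x)"
proof (induction k arbitrary: f g)
  case (Suc k)
  show ?case
  proof (rule Ck_SucI)
    show "((\<lambda>x. f x + g x) has_derivative (\<lambda>h. frechet_derivative f (at x) h + frechet_derivative g (at x) h)) (at x)" for x
      using Suc.prems by (intro has_derivative_add Ck_Suc_has_derivative)
    show "Ck k (\<lambda>x. frechet_derivative f (at x) (axis i 1) + frechet_derivative g (at x) (axis i 1))" for i
      using Suc.IH[of "pd i f" "pd i g"] Suc.prems by (simp add: pd_def[abs_def])
  qed
qed (auto intro: continuous_intros)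

lemma Ck_mult: "Ck k f \<Longrightarrow> Ck k g \<Longrightarrow> Ck k (\<lambda>x. f x * g x)"
proof (induction k arbitrary: f g)
  case (Suc k)
  show ?case
  proof (rule Ck_SucI)
    show "((\<lambda>x. f x * g x) has_derivative (\<lambda>h. f x * frechet_derivative g (at x) h + frechet_derivative f (at x) h * g x)) (at x)" for x
      using Suc.prems by (intro has_derivative_mult Ck_Suc_has_derivative)
    show "Ck k (\<lambda>x. f x * frechet_derivative g (at x) (axis i 1) + frechet_derivative f (at x) (axis i 1) * g x)" for i
      using Ck_add[OF Suc.IH[of f "pd i g"] Suc.IH[of "pd i f" g]] Suc.prems Ck_Suc_imp[of k f] Ck_Suc_imp[of k g]
      by (simp add: pd_def[abs_def])
  qed
qed (auto intro: continuous_intros)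

lemma Ck_component: "Ck k (\<lambda>x. x $ i)"
proof (cases k)
  case (Suc k)
  show ?thesis unfolding Suc
    by (rule Ck_SucI[where f' = "\<lambda>_ h. h $ i"]) (auto intro: Ck_const bounded_linear.has_derivative[OF bounded_linear_vec_nth] derivative_eq_intros)
qed (auto intro: continuous_intros)

text \<open>The function \<open>exp (- (1/t))\<close> continued by 0, with a polynomial factor in
  \<open>1/t\<close>. The family is closed under differentiation: the polynomial \<open>p\<close>
  becomes \<open>X^2 * (p - p')\<close>, so smoothness of every order follows by induction.\<close>

definition flat :: "real poly \<Rightarrow> real \<Rightarrow> real" where
  "flat p t = (if t > 0 then poly p (1/t) * exp (- (1/t)) else 0)"

lemma poly_exp_decay: "((\<lambda>s. poly p s * exp (-s)) \<longlongrightarrow> 0) at_top" for p :: "real poly"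
proof -
  have "((\<lambda>s. \<Sum>i\<le>degree p. coeff p i * (s ^ i / exp s)) \<longlongrightarrow> (\<Sum>i\<le>degree p. coeff p i * 0)) at_top"
    by (intro tendsto_intros tendsto_power_div_exp_0)
  then show ?thesis by (simp add: poly_altdef sum_distrib_right exp_minus field_simps sum_divide_distrib)
qed

lemma flat_has_derivative:
  "(flat p has_real_derivative flat ([:0, 0, 1:] * (p - pderiv p)) t) (at t)"
proof (cases t "0 :: real" rule: linorder_cases)
  case greater
  have "((\<lambda>t. poly p (1/t) * exp (- (1/t))) has_real_derivative
     (poly (pderiv p) (1/t) * (- 1 / t\<^sup>2) * exp (- (1/t)) + poly p (1/t) * (exp (- (1/t)) * (1 / t\<^sup>2)))) (at t)"
    using greater by (auto intro!: derivative_eq_intros DERIV_chain'[OF _ poly_DERIV] simp: power2_eq_square)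
  moreover have "(poly (pderiv p) (1/t) * (- 1 / t\<^sup>2) * exp (- (1/t)) + poly p (1/t) * (exp (- (1/t)) * (1 / t\<^sup>2)))
     = flat ([:0, 0, 1:] * (p - pderiv p)) t"
    using greater by (simp add: flat_def power2_eq_square algebra_simps)
  moreover have "\<forall>\<^sub>F s in nhds t. flat p s = poly p (1/s) * exp (- (1/s))"
    using eventually_nhds_in_open[of "{0<..}" t] greater by (auto elim!: eventually_mono simp: flat_def)
  from DERIV_cong_ev[OF refl this refl]
  have "(flat p has_real_derivative D) (at t) \<longleftrightarrow> ((\<lambda>s. poly p (1/s) * exp (- (1/s))) has_real_derivative D) (at t)" for D .
  ultimately show ?thesis by simp
next
  case less
  have "\<forall>\<^sub>F s in nhds t. flat p s = 0"
    using eventually_nhds_in_open[of "{..<0}" t] less by (auto elim!: eventually_mono simp: flat_def)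
  from DERIV_cong_ev[OF refl this refl]
  have "(flat p has_real_derivative 0) (at t) \<longleftrightarrow> ((\<lambda>s. 0) has_real_derivative 0) (at t)" .
  then show ?thesis using less by (simp add: flat_def)
next
  case equal
  \<comment> \<open>The right difference quotient at 0 is
    \<open>poly p (1/h) * exp (- (1/h)) / h\<close>; multiplying the polynomial by its variable, as
    \<open>pCons 0 p\<close> does, absorbs the factor \<open>1/h\<close>.\<close>
  have "((\<lambda>s. poly (pCons 0 p) s * exp (- s)) \<longlongrightarrow> 0) at_top" by (rule poly_exp_decay)
  then have "((\<lambda>h. poly (pCons 0 p) (inverse h) * exp (- inverse h)) \<longlongrightarrow> 0) (at_right 0)"
    by (rule filterlim_compose[OF _ filterlim_inverse_at_top_right])
  moreover have "\<forall>\<^sub>F h::real in at_right 0. 0 < h" by (simp add: eventually_at_right_less)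
  then have "\<forall>\<^sub>F h in at_right 0. poly (pCons 0 p) (inverse h) * exp (- inverse h) = (flat p (0 + h) - flat p 0) / h"
    by eventually_elim (simp add: flat_def field_simps)
  ultimately have R: "((\<lambda>h. (flat p (0 + h) - flat p 0) / h) \<longlongrightarrow> 0) (at_right 0)"
    by (rule Lim_transform_eventually)
  have "\<forall>\<^sub>F h::real in at_left 0. h < 0" by (auto simp: eventually_at_left_field intro!: exI[of _ "-1"])
  then have "\<forall>\<^sub>F h in at_left 0. 0 = (flat p (0 + h) - flat p 0) / h"
    by eventually_elim (simp add: flat_def)
  then have L: "((\<lambda>h. (flat p (0 + h) - flat p 0) / h) \<longlongrightarrow> 0) (at_left 0)"
    by (rule Lim_transform_eventually[rotated]) simp
  from L R have "((\<lambda>h. (flat p (0 + h) - flat p 0) / h) \<longlongrightarrow> 0) (at 0)" by (simp add: filterlim_split_at_real)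
  then have "(flat p has_real_derivative 0) (at 0)" by (simp add: DERIV_def)
  then show ?thesis using equal by (simp add: flat_def)
qed

lemma Ck_flat: "Ck k (\<lambda>x. flat p (c - (x - a) \<bullet> (x - a)))"
proof (induction k arbitrary: p)
  case 0
  have "continuous_on UNIV (flat p)"
    using flat_has_derivative by (intro continuous_at_imp_continuous_on ballI DERIV_isCont)
  then show ?case by (auto intro!: continuous_on_compose2[of UNIV "flat p"] continuous_intros)
next
  case (Suc k)
  let ?q = "[:0, 0, 1:] * (p - pderiv p)"
  show ?case
  proof (rule Ck_SucI)
    show "((\<lambda>x. flat p (c - (x - a) \<bullet> (x - a))) has_derivative
       (\<lambda>h. (- (2 * (h \<bullet> (x - a)))) * flat ?q (c - (x - a) \<bullet> (x - a)))) (at x)" for x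
      by (rule DERIV_compose_FDERIV[OF flat_has_derivative])
         (auto intro!: derivative_eq_intros simp: inner_commute)
    have "Ck k (\<lambda>x. (- 2 * (x $ i + (- a $ i))) * flat ?q (c - (x - a) \<bullet> (x - a)))" for i
      by (intro Ck_mult Suc.IH Ck_const Ck_component Ck_add)
    then show "Ck k (\<lambda>x. - (2 * (axis i 1 \<bullet> (x - a))) * flat ?q (c - (x - a) \<bullet> (x - a)))" for i
      by (simp add: inner_axis')
  qed
qed

text \<open>The profile \<open>flat 1\<close> is positive exactly for positive arguments, and
  \<open>r\<^sup>2 - (x - a) \<bullet> (x - a)\<close> is positive exactly on the ball.\<close>

lemma bump_exists:
  assumes "r > 0" "cball a r \<subseteq> A"
  shows "\<exists>f\<in>Cc_inf A. (\<forall>x\<in>ball a r. f x > 0) \<and> (\<forall>x. x \<notin> ball a r \<longrightarrow> f x = 0)"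
proof -
  define f where "f x = flat 1 (r\<^sup>2 - (x - a) \<bullet> (x - a))" for x
  have iff: "r\<^sup>2 - (x - a) \<bullet> (x - a) > 0 \<longleftrightarrow> x \<in> ball a r" for x
  proof -
    have "(norm (x - a))\<^sup>2 < r\<^sup>2 \<longleftrightarrow> norm (x - a) < r"
      using assms(1) power2_less_imp_less[of "norm (x - a)" r] power_strict_mono[of "norm (x - a)" r 2] by auto
    moreover have "dist a x = norm (x - a)" by (simp add: dist_norm norm_minus_commute)
    ultimately show ?thesis by (simp add: power2_norm_eq_inner)
  qed
  have f: "f x > 0 \<longleftrightarrow> x \<in> ball a r" "x \<notin> ball a r \<Longrightarrow> f x = 0" for x
    using iff[of x] by (auto simp: f_def flat_def)
  have "smoothC f" unfolding smoothC_iff_Ck f_def using Ck_flat by blast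
  moreover have "{x. f x \<noteq> 0} \<subseteq> cball a r" using f(2) ball_subset_cball by blast
  then have "closure {x. f x \<noteq> 0} \<subseteq> cball a r" by (simp add: closure_minimal)
  moreover then have "compact (closure {x. f x \<noteq> 0})"
    by (meson bounded_cball bounded_subset compact_closure bounded_closure closure_subset)
  ultimately have "f \<in> Cc_inf A" using assms(2) by (auto simp: Cc_inf_def)
  then show ?thesis using f by blast
qed

section \<open>Algebra and gradients of test functions\<close>

lemma Cc_infD:
  assumes "f \<in> Cc_inf A"
  shows "Ck k f" "compact (closure {x. f x \<noteq> 0})" "closure {x. f x \<noteq> 0} \<subseteq> A"
    "x \<notin> closure {x. f x \<noteq> 0} \<Longrightarrow> f x = 0" "x \<notin> A \<Longrightarrow> f x = 0"
proof -
  show "Ck k f" "compact (closure {x. f x \<noteq> 0})" and *: "closure {x. f x \<noteq> 0} \<subseteq> A"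
    using assms by (auto simp: Cc_inf_def smoothC_iff_Ck)
  show 1: "x \<notin> closure {x. f x \<noteq> 0} \<Longrightarrow> f x = 0" for x
    using closure_subset[of "{x. f x \<noteq> 0}"] by blast
  show "x \<notin> A \<Longrightarrow> f x = 0" using 1[of x] * by blast
qed

lemma Cc_infI:
  assumes "\<And>k. Ck k f" "compact K" "K \<subseteq> A" "\<And>x. x \<notin> K \<Longrightarrow> f x = 0"
  shows "f \<in> Cc_inf A"
proof -
  have "{x. f x \<noteq> 0} \<subseteq> K" using assms(4) by blast
  then have "closure {x. f x \<noteq> 0} \<subseteq> K" using compact_imp_closed[OF assms(2)] by (simp add: closure_minimal)
  moreover from this have "compact (closure {x. f x \<noteq> 0})"
    using compact_Int_closed[OF assms(2) closed_closure[of "{x. f x \<noteq> 0}"]] by (simp add: inf_absorb2)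
  ultimately show ?thesis using assms(1,3) by (auto simp: Cc_inf_def smoothC_iff_Ck)
qed

lemma Cc_inf_mono: "A \<subseteq> B \<Longrightarrow> Cc_inf A \<subseteq> Cc_inf B"
  by (auto simp: Cc_inf_def)

lemma Cc_inf_has_derivative:
  assumes "f \<in> Cc_inf A" shows "(f has_derivative (\<lambda>h. cgrad f x \<bullet> h)) (at x)"
proof -
  have D: "(f has_derivative frechet_derivative f (at x)) (at x)"
    using Ck_Suc_has_derivative[of 0] Cc_infD(1)[OF assms] by blast
  interpret linear "frechet_derivative f (at x)" using D has_derivative_linear by blast
  have "frechet_derivative f (at x) h = cgrad f x \<bullet> h" for h
  proof -
    have "h = (\<Sum>i\<in>UNIV. (h $ i) *\<^sub>R axis i 1)"
      using basis_expansion[of h] by (simp add: scalar_mult_eq_scaleR)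
    then have "frechet_derivative f (at x) h = frechet_derivative f (at x) (\<Sum>i\<in>UNIV. (h $ i) *\<^sub>R axis i 1)"
      by (rule arg_cong)
    also have "\<dots> = (\<Sum>i\<in>UNIV. h $ i * frechet_derivative f (at x) (axis i 1))"
      by (simp add: sum scaleR)
    also have "\<dots> = cgrad f x \<bullet> h" by (simp add: cgrad_def inner_vec_def mult.commute)
    finally show ?thesis .
  qed
  then have "frechet_derivative f (at x) = (\<lambda>h. cgrad f x \<bullet> h)" by blast
  then show ?thesis using D by simp
qed

lemma cgrad_eqI:
  assumes "(f has_derivative (\<lambda>h. g \<bullet> h)) (at x)" shows "cgrad f x = g"
  using pd_eqI[OF assms] by (simp add: cgrad_def pd_def vec_eq_iff inner_axis)

lemma cgrad_pd: "cgrad f x $ i = pd i f x"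
  by (simp add: cgrad_def pd_def)

lemma Cc_inf_lin:
  assumes "f \<in> Cc_inf A" "g \<in> Cc_inf A" shows "(\<lambda>x. a * f x + b * g x) \<in> Cc_inf A"
proof (rule Cc_infI)
  show "Ck k (\<lambda>x. a * f x + b * g x)" for k using Cc_infD(1)[OF assms(1)] Cc_infD(1)[OF assms(2)]
    by (intro Ck_add Ck_mult Ck_const)
  show "compact (closure {x. f x \<noteq> 0} \<union> closure {x. g x \<noteq> 0})"
    using Cc_infD(2)[OF assms(1)] Cc_infD(2)[OF assms(2)] by (rule compact_Un)
  show "closure {x. f x \<noteq> 0} \<union> closure {x. g x \<noteq> 0} \<subseteq> A"
    using Cc_infD(3)[OF assms(1)] Cc_infD(3)[OF assms(2)] by blast
  show "a * f x + b * g x = 0" if "x \<notin> closure {x. f x \<noteq> 0} \<union> closure {x. g x \<noteq> 0}" for x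
    using Cc_infD(4)[OF assms(1), of x] Cc_infD(4)[OF assms(2), of x] that by simp
qed

lemma Cc_inf_mult:
  assumes "f \<in> Cc_inf A" "g \<in> Cc_inf B" shows "(\<lambda>x. f x * g x) \<in> Cc_inf A"
proof (rule Cc_infI)
  show "Ck k (\<lambda>x. f x * g x)" for k using Cc_infD(1)[OF assms(1)] Cc_infD(1)[OF assms(2)]
    by (intro Ck_mult)
  show "f x * g x = 0" if "x \<notin> closure {x. f x \<noteq> 0}" for x
    using Cc_infD(4)[OF assms(1), of x] that by simp
qed (rule Cc_infD(2)[OF assms(1)], rule Cc_infD(3)[OF assms(1)])

lemma cgrad_lin:
  assumes "f \<in> Cc_inf A" "g \<in> Cc_inf A"
  shows "cgrad (\<lambda>x. a * f x + b * g x) x = a *\<^sub>R cgrad f x + b *\<^sub>R cgrad g x"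
proof (rule cgrad_eqI)
  show "((\<lambda>x. a * f x + b * g x) has_derivative (\<lambda>h. (a *\<^sub>R cgrad f x + b *\<^sub>R cgrad g x) \<bullet> h)) (at x)"
    by (rule has_derivative_eq_rhs[OF has_derivative_add[OF
          has_derivative_mult_right[OF Cc_inf_has_derivative[OF assms(1)]]
          has_derivative_mult_right[OF Cc_inf_has_derivative[OF assms(2)]]]])
       (simp add: fun_eq_iff inner_add_left)
qed

lemma cgrad_mult:
  assumes "f \<in> Cc_inf A" "g \<in> Cc_inf B"
  shows "cgrad (\<lambda>x. f x * g x) x = f x *\<^sub>R cgrad g x + g x *\<^sub>R cgrad f x"
proof (rule cgrad_eqI)
  show "((\<lambda>x. f x * g x) has_derivative (\<lambda>h. (f x *\<^sub>R cgrad g x + g x *\<^sub>R cgrad f x) \<bullet> h)) (at x)"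
    by (rule has_derivative_eq_rhs[OF has_derivative_mult[OF
          Cc_inf_has_derivative[OF assms(1)] Cc_inf_has_derivative[OF assms(2)]]])
       (simp add: fun_eq_iff inner_add_left)
qed

lemma cgrad_outside:
  assumes "f \<in> Cc_inf A" "x \<notin> closure {x. f x \<noteq> 0}" shows "cgrad f x = 0"
proof (rule cgrad_eqI)
  have "((\<lambda>_. 0) has_derivative (\<lambda>h. 0 \<bullet> h)) (at x)" by simp
  then show "(f has_derivative (\<lambda>h. 0 \<bullet> h)) (at x)"
  proof (rule has_derivative_transform_within_open[of _ _ _ _ "- closure {x. f x \<noteq> 0}"])
    show "0 = f y" if "y \<in> - closure {x. f x \<noteq> 0}" for y
      by (rule Cc_infD(4)[OF assms(1), symmetric]) (use that in blast)
    show "x \<in> - closure {x. f x \<noteq> 0}" using assms(2) by blast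
  qed blast
qed

lemma Cc_inf_pd: assumes "f \<in> Cc_inf A" shows "pd i f \<in> Cc_inf A"
proof (rule Cc_infI)
  show "Ck k (pd i f)" for k using Cc_infD(1)[OF assms, of "Suc k"] by simp
  show "pd i f x = 0" if "x \<notin> closure {x. f x \<noteq> 0}" for x
    using cgrad_outside[OF assms that] by (simp add: cgrad_pd[symmetric])
qed (rule Cc_infD(2)[OF assms], rule Cc_infD(3)[OF assms])

lemma continuous_on_Cc_inf: "f \<in> Cc_inf A \<Longrightarrow> continuous_on S f"
  by (rule continuous_on_subset[OF Ck_cont[OF Cc_infD(1)]]) simp_all

lemma continuous_on_cgrad: assumes "f \<in> Cc_inf A" shows "continuous_on S (cgrad f)"
proof -
  have "cgrad f = (\<lambda>x. \<chi> i. pd i f x)" by (simp add: cgrad_def pd_def fun_eq_iff)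
  then show ?thesis using continuous_on_Cc_inf[OF Cc_inf_pd[OF assms]]
    by (simp add: continuous_on_vec_lambda)
qed

section \<open>Integrals of test functions and integration by parts\<close>

lemma integrable_continuous_compact_support:
  fixes f :: "'a::euclidean_space \<Rightarrow> 'b::{banach, second_countable_topology}"
  assumes "continuous_on UNIV f" "compact K" "\<And>x. x \<notin> K \<Longrightarrow> f x = 0"
  shows "integrable lborel f"
proof -
  have "integrable lborel (\<lambda>x. indicator K x *\<^sub>R f x)"
    by (rule borel_integrable_compact[OF assms(2) continuous_on_subset[OF assms(1)]]) simp
  moreover have "(\<lambda>x. indicator K x *\<^sub>R f x) = f" using assms(3) by (auto simp: indicator_def fun_eq_iff)
  ultimately show ?thesis by simp
qed

lemma integrable_lborel_lebesgue: "integrable lborel f \<Longrightarrow> integrable lebesgue f"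
  for f :: "'a::euclidean_space \<Rightarrow> 'b::{banach, second_countable_topology}"
  by (subst integrable_completion) (rule borel_measurable_integrable)

lemma integral_lebesgue_lborel: "f \<in> borel_measurable borel \<Longrightarrow> integral\<^sup>L lebesgue f = integral\<^sup>L lborel f"
  for f :: "'a::euclidean_space \<Rightarrow> 'b::{banach, second_countable_topology}"
  by (rule integral_completion) simp

lemma sqint_continuous_compact_support:
  fixes f :: "'a::euclidean_space \<Rightarrow> 'b::euclidean_space"
  assumes "continuous_on UNIV f" "compact K" "\<And>x. x \<notin> K \<Longrightarrow> f x = 0"
  shows "sqint lebesgue f"
  unfolding sqint_def
proof
  show "f \<in> borel_measurable lebesgue"
    using borel_measurable_continuous_onI[OF assms(1)] by (intro measurable_completion) simp
  show "integrable lebesgue (\<lambda>x. (norm (f x))\<^sup>2)"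
  proof (rule integrable_lborel_lebesgue, rule integrable_continuous_compact_support[OF _ assms(2)])
    show "continuous_on UNIV (\<lambda>x. (norm (f x))\<^sup>2)" by (intro continuous_intros assms(1))
    show "(norm (f x))\<^sup>2 = 0" if "x \<notin> K" for x using assms(3)[OF that] by simp
  qed
qed

lemma Cc_inf_sqint: assumes "f \<in> Cc_inf A" shows "sqint lebesgue f" "sqint lebesgue (cgrad f)"
  by (rule sqint_continuous_compact_support[OF continuous_on_Cc_inf[OF assms] Cc_infD(2)[OF assms] Cc_infD(4)[OF assms]],
      assumption,
      rule sqint_continuous_compact_support[OF continuous_on_cgrad[OF assms] Cc_infD(2)[OF assms] cgrad_outside[OF assms]])

lemma Cc_inf_lipschitz:
  assumes "f \<in> Cc_inf A" shows "\<exists>B\<ge>0. \<forall>x y. \<bar>f x - f y\<bar> \<le> B * norm (x - y)"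
proof -
  let ?K = "closure {x. f x \<noteq> 0}"
  have "compact (cgrad f ` ?K)"
    using Cc_infD(2)[OF assms] continuous_on_cgrad[OF assms] by (intro compact_continuous_image)
  then have "\<exists>B>0. \<forall>y\<in>cgrad f ` ?K. norm y \<le> B"
    using compact_imp_bounded by (simp only: bounded_pos[symmetric])
  then obtain B where B: "B > 0" "\<And>x. x \<in> ?K \<Longrightarrow> norm (cgrad f x) \<le> B" by blast
  have B': "norm (cgrad f x) \<le> B" for x 
  proof (cases "x \<in> ?K")
    case True
    then show ?thesis by (rule B(2))
  next
    case False
    then show ?thesis using cgrad_outside[OF assms False] B(1) by simp
  qed
  have "norm (f x - f y) \<le> B * norm (x - y)" for x y
  proof (rule differentiable_bound[of UNIV])
    show "(f has_derivative (\<lambda>h. cgrad f x \<bullet> h)) (at x within UNIV)" for x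
      using Cc_inf_has_derivative[OF assms] by simp
    show "onorm (\<lambda>h. cgrad f x \<bullet> h) \<le> B" for x
    proof (rule onorm_le)
      fix h
      have "norm (cgrad f x \<bullet> h) \<le> norm (cgrad f x) * norm h" by (simp add: Cauchy_Schwarz_ineq2)
      also have "\<dots> \<le> B * norm h" using B' by (intro mult_right_mono) auto
      finally show "norm (cgrad f x \<bullet> h) \<le> B * norm h" .
    qed
  qed auto
  then show ?thesis using B(1) by (intro exI[of _ B]) auto
qed

lemma lborel_integral_shift:
  fixes f :: "'a::euclidean_space \<Rightarrow> real"
  assumes "f \<in> borel_measurable borel"
  shows "(\<integral>x. f (x + c) \<partial>lborel) = (\<integral>x. f x \<partial>lborel)"
proof -
  have "(\<integral>x. f x \<partial>lborel) = (\<integral>x. f x \<partial>(distr lborel borel ((+) c)))" by (subst lborel_distr_plus) (rule refl)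
  also have "\<dots> = (\<integral>x. f (c + x) \<partial>lborel)" by (rule integral_distr) (simp_all add: assms)
  finally show ?thesis by (simp add: add.commute)
qed

text \<open>The difference quotients in direction \<open>i\<close> have integral 0 by translation
  invariance and converge pointwise. They are dominated by the Lipschitz constant of
  \<open>f\<close> on the ball of radius \<open>R + 1\<close>, the increments being at most
  1.\<close>

lemma integral_pd_zero:
  fixes f :: "real^'n::finite \<Rightarrow> real"
  assumes "f \<in> Cc_inf A" shows "(\<integral>x. pd i f x \<partial>lborel) = 0"
proof -
  let ?K = "closure {x. f x \<noteq> 0}"
  obtain R where R: "\<And>x. x \<in> ?K \<Longrightarrow> norm x \<le> R"
    using compact_imp_bounded[OF Cc_infD(2)[OF assms]] unfolding bounded_iff by blast
  have f0: "f x = 0" if "norm x > R" for x 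
  proof (rule Cc_infD(4)[OF assms])
    show "x \<notin> ?K" using R[of x] that by linarith
  qed
  obtain B where B: "B \<ge> 0" "\<And>x y. \<bar>f x - f y\<bar> \<le> B * norm (x - y)" using Cc_inf_lipschitz[OF assms] by blast
  define t where "t n = inverse (real (Suc n))" for n
  have t: "t n > 0" "t n \<le> 1" for n by (simp_all add: t_def field_simps)
  have t0: "t \<longlonglongrightarrow> 0" unfolding t_def by (rule LIMSEQ_inverse_real_of_nat)
  define D where "D n x = (f (x + t n *\<^sub>R axis i 1) - f x) / t n" for n x
  have fc: "continuous_on S f" for S using continuous_on_Cc_inf[OF assms] .
  have fm[measurable]: "f \<in> borel_measurable borel" using fc by (rule borel_measurable_continuous_onI)
  have fi: "integrable lborel f"
    by (rule integrable_continuous_compact_support[OF fc Cc_infD(2)[OF assms] Cc_infD(4)[OF assms]])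
  have "(\<lambda>n. \<integral>x. D n x \<partial>lborel) \<longlonglongrightarrow> (\<integral>x. pd i f x \<partial>lborel)"
  proof (rule integral_dominated_convergence[where w = "\<lambda>x. indicator (cball 0 (R + 1)) x *\<^sub>R B"])
    show "pd i f \<in> borel_measurable lborel"
      using borel_measurable_continuous_onI[OF continuous_on_Cc_inf[OF Cc_inf_pd[OF assms]]] by simp
    show "D n \<in> borel_measurable lborel" for n unfolding D_def by measurable
    show "integrable lborel (\<lambda>x::real^'n. indicator (cball 0 (R + 1)) x *\<^sub>R B)"
      by (rule borel_integrable_compact) simp_all
    show "AE x in lborel. (\<lambda>n. D n x) \<longlonglongrightarrow> pd i f x"
    proof (rule AE_I2)
      fix x
      have "((\<lambda>s. f (x + s *\<^sub>R axis i 1)) has_derivative (\<lambda>s. cgrad f x \<bullet> (s *\<^sub>R axis i 1))) (at 0)"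
        by (rule has_derivative_compose[of "\<lambda>s. x + s *\<^sub>R axis i 1" _ _ _ f "\<lambda>h. cgrad f x \<bullet> h"])
           (auto intro!: derivative_eq_intros Cc_inf_has_derivative[OF assms])
      then have "((\<lambda>s. f (x + s *\<^sub>R axis i 1)) has_real_derivative pd i f x) (at 0)"
        unfolding has_field_derivative_def
        by (rule has_derivative_eq_rhs) (auto simp: fun_eq_iff inner_axis cgrad_pd)
      then have "((\<lambda>s. (f (x + s *\<^sub>R axis i 1) - f x) / s) \<longlongrightarrow> pd i f x) (at 0)"
        by (simp add: DERIV_def)
      moreover have "filterlim t (at 0) sequentially"
        using t0 t(1) by (simp add: filterlim_at less_imp_neq[OF t(1), symmetric])
      ultimately show "(\<lambda>n. D n x) \<longlonglongrightarrow> pd i f x" unfolding D_def by (rule filterlim_compose)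
    qed
    show "AE x in lborel. norm (D n x) \<le> indicator (cball 0 (R + 1)) x *\<^sub>R B" for n
    proof (rule AE_I2)
      fix x :: "real^'n"
      have "\<bar>f (x + t n *\<^sub>R axis i 1) - f x\<bar> \<le> B * t n"
        using B(2)[of "x + t n *\<^sub>R axis i 1" x] t[of n] by simp
      then have 1: "norm (D n x) \<le> B" using t[of n] by (simp add: D_def field_simps)
      have 2: "D n x = 0" if "x \<notin> cball 0 (R + 1)"
      proof -
        have "norm x > R + 1" using that by simp
        moreover have "norm (x + t n *\<^sub>R axis i 1) \<ge> norm x - norm (t n *\<^sub>R axis i (1::real))"
          by (rule norm_diff_ineq)
        ultimately have "norm x > R" "norm (x + t n *\<^sub>R axis i 1) > R" using t[of n] by auto
        then show ?thesis using f0 by (simp add: D_def)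
      qed
      show "norm (D n x) \<le> indicator (cball 0 (R + 1)) x *\<^sub>R B" using 1 2 by (cases "x \<in> cball 0 (R + 1)") auto
    qed
  qed
  moreover have "(\<integral>x. D n x \<partial>lborel) = 0" for n
  proof -
    have "integrable lborel (\<lambda>x. f (x + t n *\<^sub>R axis i 1))"
    proof (rule integrable_continuous_compact_support[of _ "cball 0 (R + 1)"])
      show "continuous_on UNIV (\<lambda>x. f (x + t n *\<^sub>R axis i 1))"
        by (rule continuous_on_compose2[OF fc[of UNIV]]) (auto intro!: continuous_intros)
      show "f (x + t n *\<^sub>R axis i 1) = 0" if "x \<notin> cball 0 (R + 1)" for x
      proof (rule f0)
        have "norm (x + t n *\<^sub>R axis i 1) \<ge> norm x - norm (t n *\<^sub>R axis i (1::real))"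
          by (rule norm_diff_ineq)
        then show "R < norm (x + t n *\<^sub>R axis i 1)" using that t[of n] by auto
      qed
    qed simp
    then have "(\<integral>x. f (x + t n *\<^sub>R axis i 1) - f x \<partial>lborel) = 0"
      using fi lborel_integral_shift[OF fm] by simp
    then show ?thesis unfolding D_def by simp
  qed
  ultimately show ?thesis by (simp add: LIMSEQ_const_iff)
qed

lemma integration_by_parts:
  assumes "f \<in> Cc_inf A" "g \<in> Cc_inf B"
  shows "(\<integral>x. pd i f x * g x \<partial>lebesgue) = - (\<integral>x. f x * pd i g x \<partial>lebesgue)"
proof -
  have int: "integrable lebesgue (\<lambda>x. u x * v x)" if "u \<in> Cc_inf A'" "v \<in> Cc_inf B'" for u v :: "real^'n \<Rightarrow> real" and A' B'
    using sqint_inner[OF Cc_inf_sqint(1)[OF that(1)] Cc_inf_sqint(1)[OF that(2)]] by simp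
  have "(\<integral>x. pd i (\<lambda>x. f x * g x) x \<partial>lebesgue) = 0"
    using integral_pd_zero[OF Cc_inf_mult[OF assms], of i] continuous_on_Cc_inf[OF Cc_inf_pd[OF Cc_inf_mult[OF assms]]]
    by (subst integral_lebesgue_lborel) (auto intro: borel_measurable_continuous_onI)
  moreover have "pd i (\<lambda>x. f x * g x) x = f x * pd i g x + pd i f x * g x" for x
    using cgrad_mult[OF assms, of x] by (simp add: cgrad_pd[symmetric])
  ultimately show ?thesis
    using int[OF assms(1) Cc_inf_pd[OF assms(2)]] int[OF Cc_inf_pd[OF assms(1)] assms(2)] by simp
qed

section \<open>The Sobolev spaces of functions vanishing on the boundary\<close>

lemma L2_cauchy_schwarz:
  assumes f: "sqint M f" and g: "sqint M g"
  shows "(\<integral>x. f x \<bullet> g x \<partial>M)\<^sup>2 \<le> (\<integral>x. (norm (f x))\<^sup>2 \<partial>M) * (\<integral>x. (norm (g x))\<^sup>2 \<partial>M)"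
proof (rule psd_2x2_det)
  fix t
  have "0 \<le> (\<integral>x. (norm (f x + t *\<^sub>R g x))\<^sup>2 \<partial>M)" by simp
  also have "\<dots> = (\<integral>x. (norm (f x))\<^sup>2 + 2 * t * (f x \<bullet> g x) + t\<^sup>2 * (norm (g x))\<^sup>2 \<partial>M)"
  proof (rule Bochner_Integration.integral_cong[OF refl])
    fix x
    show "(norm (f x + t *\<^sub>R g x))\<^sup>2 = (norm (f x))\<^sup>2 + 2 * t * (f x \<bullet> g x) + t\<^sup>2 * (norm (g x))\<^sup>2"
      unfolding power2_norm_eq_inner
      by (simp add: inner_add_left inner_add_right inner_commute[of "g x" "f x"] power2_eq_square algebra_simps)
  qed
  also have "\<dots> = (\<integral>x. (norm (f x))\<^sup>2 \<partial>M) + 2 * t * (\<integral>x. f x \<bullet> g x \<partial>M) + t\<^sup>2 * (\<integral>x. (norm (g x))\<^sup>2 \<partial>M)"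
    using sqintD(2)[OF f] sqintD(2)[OF g] sqint_inner[OF f g] by simp
  finally show "0 \<le> (\<integral>x. (norm (f x))\<^sup>2 \<partial>M) + 2 * t * (\<integral>x. f x \<bullet> g x \<partial>M) + t\<^sup>2 * (\<integral>x. (norm (g x))\<^sup>2 \<partial>M)" .
qed

lemma L2_tendsto_inner:
  assumes f: "\<And>n. sqint M (f n)" "sqint M f0" and g: "sqint M g"
    and lim: "(\<lambda>n. \<integral>x. (norm (f n x - f0 x))\<^sup>2 \<partial>M) \<longlonglongrightarrow> 0"
  shows "(\<lambda>n. \<integral>x. f n x \<bullet> g x \<partial>M) \<longlonglongrightarrow> (\<integral>x. f0 x \<bullet> g x \<partial>M)"
proof -
  let ?G = "\<integral>x. (norm (g x))\<^sup>2 \<partial>M"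
  have "(\<lambda>n. sqrt ((\<integral>x. (norm (f n x - f0 x))\<^sup>2 \<partial>M) * ?G)) \<longlonglongrightarrow> sqrt (0 * ?G)"
    by (intro tendsto_intros lim)
  then have lim': "(\<lambda>n. sqrt ((\<integral>x. (norm (f n x - f0 x))\<^sup>2 \<partial>M) * ?G)) \<longlonglongrightarrow> 0" by simp
  have "(\<lambda>n. (\<integral>x. f n x \<bullet> g x \<partial>M) - (\<integral>x. f0 x \<bullet> g x \<partial>M)) \<longlonglongrightarrow> 0"
  proof (rule Lim_null_comparison[OF always_eventually lim'], rule allI)
    fix n
    have "(\<integral>x. f n x \<bullet> g x \<partial>M) - (\<integral>x. f0 x \<bullet> g x \<partial>M) = (\<integral>x. (f n x - f0 x) \<bullet> g x \<partial>M)"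
      using sqint_inner[OF f(1) g] sqint_inner[OF f(2) g] by (simp add: inner_diff_left)
    then show "norm ((\<integral>x. f n x \<bullet> g x \<partial>M) - (\<integral>x. f0 x \<bullet> g x \<partial>M)) \<le> sqrt ((\<integral>x. (norm (f n x - f0 x))\<^sup>2 \<partial>M) * ?G)"
      using L2_cauchy_schwarz[OF sqint_diff[OF f(1) f(2)] g] by (auto intro: real_le_rsqrt)
  qed
  then show ?thesis by (simp add: LIM_zero_iff)
qed

lemma L2_tendsto_lin:
  assumes f: "\<And>n. sqint M (f n)" "sqint M f0" and g: "\<And>n. sqint M (g n)" "sqint M g0"
    and lf: "(\<lambda>n. \<integral>x. (norm (f n x - f0 x))\<^sup>2 \<partial>M) \<longlonglongrightarrow> 0"
    and lg: "(\<lambda>n. \<integral>x. (norm (g n x - g0 x))\<^sup>2 \<partial>M) \<longlonglongrightarrow> 0"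
  shows "(\<lambda>n. \<integral>x. (norm ((a *\<^sub>R f n x + b *\<^sub>R g n x) - (a *\<^sub>R f0 x + b *\<^sub>R g0 x)))\<^sup>2 \<partial>M) \<longlonglongrightarrow> 0"
proof (rule tendsto_sandwich[OF always_eventually always_eventually tendsto_const])
  let ?F = "\<lambda>n. \<integral>x. (norm (f n x - f0 x))\<^sup>2 \<partial>M" and ?G = "\<lambda>n. \<integral>x. (norm (g n x - g0 x))\<^sup>2 \<partial>M"
  show "\<forall>n. 0 \<le> (\<integral>x. (norm ((a *\<^sub>R f n x + b *\<^sub>R g n x) - (a *\<^sub>R f0 x + b *\<^sub>R g0 x)))\<^sup>2 \<partial>M)" by simp
  show "\<forall>n. (\<integral>x. (norm ((a *\<^sub>R f n x + b *\<^sub>R g n x) - (a *\<^sub>R f0 x + b *\<^sub>R g0 x)))\<^sup>2 \<partial>M) \<le> 2 * a\<^sup>2 * ?F n + 2 * b\<^sup>2 * ?G n"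
  proof
    fix n
    note df = sqint_diff[OF f(1) f(2), of n] and dg = sqint_diff[OF g(1) g(2), of n]
    have "(\<integral>x. (norm ((a *\<^sub>R f n x + b *\<^sub>R g n x) - (a *\<^sub>R f0 x + b *\<^sub>R g0 x)))\<^sup>2 \<partial>M)
      \<le> (\<integral>x. 2 * a\<^sup>2 * (norm (f n x - f0 x))\<^sup>2 + 2 * b\<^sup>2 * (norm (g n x - g0 x))\<^sup>2 \<partial>M)"
    proof (rule integral_mono)
      show "integrable M (\<lambda>x. (norm ((a *\<^sub>R f n x + b *\<^sub>R g n x) - (a *\<^sub>R f0 x + b *\<^sub>R g0 x)))\<^sup>2)"
        by (intro sqintD(2) sqint_diff sqint_add sqint_scaleR f g)
      show "integrable M (\<lambda>x. 2 * a\<^sup>2 * (norm (f n x - f0 x))\<^sup>2 + 2 * b\<^sup>2 * (norm (g n x - g0 x))\<^sup>2)"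
        using sqintD(2)[OF df] sqintD(2)[OF dg] by simp
      fix x
      have "(a *\<^sub>R f n x + b *\<^sub>R g n x) - (a *\<^sub>R f0 x + b *\<^sub>R g0 x) = a *\<^sub>R (f n x - f0 x) + b *\<^sub>R (g n x - g0 x)"
        by (simp add: scaleR_diff_right)
      then show "(norm ((a *\<^sub>R f n x + b *\<^sub>R g n x) - (a *\<^sub>R f0 x + b *\<^sub>R g0 x)))\<^sup>2
         \<le> 2 * a\<^sup>2 * (norm (f n x - f0 x))\<^sup>2 + 2 * b\<^sup>2 * (norm (g n x - g0 x))\<^sup>2"
        using norm_add_square_le[of "a *\<^sub>R (f n x - f0 x)" "b *\<^sub>R (g n x - g0 x)"] by (simp add: power_mult_distrib)
    qed
    also have "\<dots> = 2 * a\<^sup>2 * ?F n + 2 * b\<^sup>2 * ?G n" using sqintD(2)[OF df] sqintD(2)[OF dg] by simp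
    finally show "(\<integral>x. (norm ((a *\<^sub>R f n x + b *\<^sub>R g n x) - (a *\<^sub>R f0 x + b *\<^sub>R g0 x)))\<^sup>2 \<partial>M) \<le> 2 * a\<^sup>2 * ?F n + 2 * b\<^sup>2 * ?G n" .
  qed
  have "(\<lambda>n. 2 * a\<^sup>2 * ?F n + 2 * b\<^sup>2 * ?G n) \<longlonglongrightarrow> 2 * a\<^sup>2 * 0 + 2 * b\<^sup>2 * 0" by (intro tendsto_intros lf lg)
  then show "(\<lambda>n. 2 * a\<^sup>2 * ?F n + 2 * b\<^sup>2 * ?G n) \<longlonglongrightarrow> 0" by simp
qed

lemma L2_zero_AE:
  assumes "sqint M f" "(\<integral>x. (norm (f x))\<^sup>2 \<partial>M) = 0" shows "AE x in M. f x = 0"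
proof -
  have "AE x in M. (norm (f x))\<^sup>2 = 0"
    using integral_nonneg_eq_0_iff_AE[OF sqintD(2)[OF assms(1)]] assms(2) by simp
  then show ?thesis by simp
qed

text \<open>Closability of the gradient: the limit \<open>\<gamma>\<close> is orthogonal to every \<open>pd i \<theta>\<close>, so in particular to the
  gradients that converge to it.\<close>
lemma gradient_closable:
  assumes \<psi>: "\<And>k. \<psi> k \<in> Cc_inf UNIV" and \<gamma>: "sqint lebesgue \<gamma>"
    and l0: "(\<lambda>k. \<integral>x. (norm (\<psi> k x))\<^sup>2 \<partial>lebesgue) \<longlonglongrightarrow> 0"
    and l1: "(\<lambda>k. \<integral>x. (norm (cgrad (\<psi> k) x - \<gamma> x))\<^sup>2 \<partial>lebesgue) \<longlonglongrightarrow> 0"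
  shows "AE x in lebesgue. \<gamma> x = 0"
proof -
  have comp: "(\<integral>x. \<gamma> x $ i * \<theta> x \<partial>lebesgue) = 0" "integrable lebesgue (\<lambda>x. \<gamma> x $ i * \<theta> x)"
    if \<theta>: "\<theta> \<in> Cc_inf UNIV" for i \<theta>
  proof -
    let ?\<Theta> = "\<lambda>x. \<theta> x *\<^sub>R axis i (1::real)"
    have S: "sqint lebesgue ?\<Theta>"
      using Cc_inf_sqint(1)[OF \<theta>] by (auto simp: sqint_def)
    have e: "v \<bullet> ?\<Theta> x = v $ i * \<theta> x" for v x by (simp add: inner_axis)
    show "integrable lebesgue (\<lambda>x. \<gamma> x $ i * \<theta> x)" using sqint_inner[OF \<gamma> S] unfolding e .
    have "(\<lambda>k. \<integral>x. cgrad (\<psi> k) x \<bullet> ?\<Theta> x \<partial>lebesgue) \<longlonglongrightarrow> (\<integral>x. \<gamma> x \<bullet> ?\<Theta> x \<partial>lebesgue)"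
      by (rule L2_tendsto_inner[OF Cc_inf_sqint(2)[OF \<psi>] \<gamma> S l1])
    then have 1: "(\<lambda>k. \<integral>x. pd i (\<psi> k) x * \<theta> x \<partial>lebesgue) \<longlonglongrightarrow> (\<integral>x. \<gamma> x $ i * \<theta> x \<partial>lebesgue)"
      unfolding e cgrad_pd .
    have "(\<lambda>k. \<integral>x. \<psi> k x \<bullet> pd i \<theta> x \<partial>lebesgue) \<longlonglongrightarrow> (\<integral>x. 0 \<bullet> pd i \<theta> x \<partial>lebesgue)"
      using l0 by (intro L2_tendsto_inner Cc_inf_sqint(1)[OF \<psi>] Cc_inf_sqint(1)[OF Cc_inf_pd[OF \<theta>]])
         (auto simp: sqint_def)
    then have "(\<lambda>k. - (\<integral>x. \<psi> k x * pd i \<theta> x \<partial>lebesgue)) \<longlonglongrightarrow> - 0" by (intro tendsto_minus) simp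
    then have 2: "(\<lambda>k. \<integral>x. pd i (\<psi> k) x * \<theta> x \<partial>lebesgue) \<longlonglongrightarrow> 0"
      unfolding integration_by_parts[OF \<psi> \<theta>] by simp
    show "(\<integral>x. \<gamma> x $ i * \<theta> x \<partial>lebesgue) = 0" using LIMSEQ_unique[OF 1 2] .
  qed
  have "(\<integral>x. cgrad (\<psi> m) x \<bullet> \<gamma> x \<partial>lebesgue) = 0" for m
  proof -
    have "(\<integral>x. cgrad (\<psi> m) x \<bullet> \<gamma> x \<partial>lebesgue) = (\<integral>x. (\<Sum>i\<in>UNIV. \<gamma> x $ i * pd i (\<psi> m) x) \<partial>lebesgue)"
      by (simp add: inner_vec_def cgrad_pd mult.commute)
    also have "\<dots> = (\<Sum>i\<in>UNIV. \<integral>x. \<gamma> x $ i * pd i (\<psi> m) x \<partial>lebesgue)"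
      by (intro Bochner_Integration.integral_sum comp(2) Cc_inf_pd \<psi>)
    also have "\<dots> = 0" by (intro sum.neutral ballI comp(1) Cc_inf_pd \<psi>)
    finally show ?thesis .
  qed
  moreover have "(\<lambda>m. \<integral>x. cgrad (\<psi> m) x \<bullet> \<gamma> x \<partial>lebesgue) \<longlonglongrightarrow> (\<integral>x. \<gamma> x \<bullet> \<gamma> x \<partial>lebesgue)"
    by (rule L2_tendsto_inner[OF Cc_inf_sqint(2)[OF \<psi>] \<gamma> \<gamma> l1])
  ultimately have "(\<integral>x. \<gamma> x \<bullet> \<gamma> x \<partial>lebesgue) = 0" by (simp add: LIMSEQ_const_iff)
  then show ?thesis using L2_zero_AE[OF \<gamma>] by (simp add: power2_norm_eq_inner)
qed

section \<open>Functions paired with their weak gradients\<close>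

lemma W0pair_alt: "W0pair A u g \<longleftrightarrow> sqint lebesgue u \<and> sqint lebesgue g \<and>
     (\<exists>\<phi>. (\<forall>k. \<phi> k \<in> Cc_inf A) \<and>
        (\<lambda>k. \<integral>x. (norm (\<phi> k x - u x))\<^sup>2 \<partial>lebesgue) \<longlonglongrightarrow> 0 \<and>
        (\<lambda>k. \<integral>x. (norm (cgrad (\<phi> k) x - g x))\<^sup>2 \<partial>lebesgue) \<longlonglongrightarrow> 0)"
  unfolding W0pair_def sqint_def by auto

lemma W0pairD: assumes "W0pair A u g" shows "sqint lebesgue u" "sqint lebesgue g"
  using assms by (auto simp: W0pair_alt)

lemma W0pairE:
  assumes "W0pair A u g"
  obtains \<phi> where "\<And>k. \<phi> k \<in> Cc_inf A"
    "(\<lambda>k. \<integral>x. (norm (\<phi> k x - u x))\<^sup>2 \<partial>lebesgue) \<longlonglongrightarrow> 0"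
    "(\<lambda>k. \<integral>x. (norm (cgrad (\<phi> k) x - g x))\<^sup>2 \<partial>lebesgue) \<longlonglongrightarrow> 0"
  using assms unfolding W0pair_alt by blast

lemma W0pair_mono: assumes "A \<subseteq> B" "W0pair A u g" shows "W0pair B u g"
  using Cc_inf_mono[OF assms(1)] assms(2) unfolding W0pair_alt by blast

lemma W0pair_Cc_inf: assumes "f \<in> Cc_inf A" shows "W0pair A f (cgrad f)"
  unfolding W0pair_alt using Cc_inf_sqint[OF assms] assms by (auto intro!: exI[of _ "\<lambda>_. f"])

lemma W0pair_lin:
  assumes u: "W0pair A u g" and v: "W0pair A v h"
  shows "W0pair A (\<lambda>x. a * u x + b * v x) (\<lambda>x. a *\<^sub>R g x + b *\<^sub>R h x)"
proof -
  obtain \<phi> where \<phi>: "\<And>k. \<phi> k \<in> Cc_inf A"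
    "(\<lambda>k. \<integral>x. (norm (\<phi> k x - u x))\<^sup>2 \<partial>lebesgue) \<longlonglongrightarrow> 0"
    "(\<lambda>k. \<integral>x. (norm (cgrad (\<phi> k) x - g x))\<^sup>2 \<partial>lebesgue) \<longlonglongrightarrow> 0" by (rule W0pairE[OF u]) (rule that)
  obtain \<psi> where \<psi>: "\<And>k. \<psi> k \<in> Cc_inf A"
    "(\<lambda>k. \<integral>x. (norm (\<psi> k x - v x))\<^sup>2 \<partial>lebesgue) \<longlonglongrightarrow> 0"
    "(\<lambda>k. \<integral>x. (norm (cgrad (\<psi> k) x - h x))\<^sup>2 \<partial>lebesgue) \<longlonglongrightarrow> 0" by (rule W0pairE[OF v]) (rule that)
  have S: "sqint lebesgue (\<lambda>x. a * u x + b * v x)" "sqint lebesgue (\<lambda>x. a *\<^sub>R g x + b *\<^sub>R h x)"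
    using sqint_add[OF sqint_scaleR[OF W0pairD(1)[OF u]] sqint_scaleR[OF W0pairD(1)[OF v]], of a b]
      sqint_add[OF sqint_scaleR[OF W0pairD(2)[OF u]] sqint_scaleR[OF W0pairD(2)[OF v]], of a b] by simp_all
  have 1: "(\<lambda>k. \<integral>x. (norm ((a *\<^sub>R \<phi> k x + b *\<^sub>R \<psi> k x) - (a *\<^sub>R u x + b *\<^sub>R v x)))\<^sup>2 \<partial>lebesgue) \<longlonglongrightarrow> 0"
    by (rule L2_tendsto_lin[OF Cc_inf_sqint(1)[OF \<phi>(1)] W0pairD(1)[OF u] Cc_inf_sqint(1)[OF \<psi>(1)] W0pairD(1)[OF v] \<phi>(2) \<psi>(2)])
  have 2: "(\<lambda>k. \<integral>x. (norm ((a *\<^sub>R cgrad (\<phi> k) x + b *\<^sub>R cgrad (\<psi> k) x) - (a *\<^sub>R g x + b *\<^sub>R h x)))\<^sup>2 \<partial>lebesgue) \<longlonglongrightarrow> 0"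
    by (rule L2_tendsto_lin[OF Cc_inf_sqint(2)[OF \<phi>(1)] W0pairD(2)[OF u] Cc_inf_sqint(2)[OF \<psi>(1)] W0pairD(2)[OF v] \<phi>(3) \<psi>(3)])
  show ?thesis unfolding W0pair_alt
  proof (intro conjI exI[of _ "\<lambda>k x. a * \<phi> k x + b * \<psi> k x"] allI S)
    show "(\<lambda>x. a * \<phi> k x + b * \<psi> k x) \<in> Cc_inf A" for k by (rule Cc_inf_lin[OF \<phi>(1) \<psi>(1)])
    show "(\<lambda>k. \<integral>x. (norm (a * \<phi> k x + b * \<psi> k x - (a * u x + b * v x)))\<^sup>2 \<partial>lebesgue) \<longlonglongrightarrow> 0"
      using 1 by (simp only: real_scaleR_def)
    show "(\<lambda>k. \<integral>x. (norm (cgrad (\<lambda>x. a * \<phi> k x + b * \<psi> k x) x - (a *\<^sub>R g x + b *\<^sub>R h x)))\<^sup>2 \<partial>lebesgue) \<longlonglongrightarrow> 0"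
      using 2 by (simp only: cgrad_lin[OF \<phi>(1) \<psi>(1)])
  qed
qed

text \<open>The difference of the pairs is a pair over the whole space whose function vanishes
  almost everywhere, so closability applies. Allowing two domains shows that the gradient does not
  depend on the set in which the function is considered.\<close>

lemma W0pair_unique:
  assumes "W0pair A u g" "W0pair B v h" "AE x in lebesgue. u x = v x"
  shows "AE x in lebesgue. g x = h x"
proof -
  have P: "W0pair UNIV (\<lambda>x. 1 * u x + (-1) * v x) (\<lambda>x. 1 *\<^sub>R g x + (-1) *\<^sub>R h x)"
    by (intro W0pair_lin W0pair_mono[OF subset_UNIV assms(1)] W0pair_mono[OF subset_UNIV assms(2)])
  obtain \<phi> where \<phi>: "\<And>k. \<phi> k \<in> Cc_inf UNIV"
    "(\<lambda>k. \<integral>x. (norm (\<phi> k x - (1 * u x + (-1) * v x)))\<^sup>2 \<partial>lebesgue) \<longlonglongrightarrow> 0"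
    "(\<lambda>k. \<integral>x. (norm (cgrad (\<phi> k) x - (1 *\<^sub>R g x + (-1) *\<^sub>R h x)))\<^sup>2 \<partial>lebesgue) \<longlonglongrightarrow> 0"
    by (rule W0pairE[OF P]) (rule that)
  have [measurable]: "u \<in> borel_measurable lebesgue" "v \<in> borel_measurable lebesgue" "\<phi> k \<in> borel_measurable lebesgue" for k
    using sqintD(1)[OF W0pairD(1)[OF assms(1)]] sqintD(1)[OF W0pairD(1)[OF assms(2)]] sqintD(1)[OF Cc_inf_sqint(1)[OF \<phi>(1)]] .
  have "(\<integral>x. (norm (\<phi> k x - (1 * u x + (-1) * v x)))\<^sup>2 \<partial>lebesgue) = (\<integral>x. (norm (\<phi> k x))\<^sup>2 \<partial>lebesgue)" for k
    by (rule integral_cong_AE) (use assms(3) in auto)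
  then have "AE x in lebesgue. 1 *\<^sub>R g x + (-1) *\<^sub>R h x = 0"
    using \<phi> W0pairD(2)[OF P] by (intro gradient_closable[of \<phi>]) auto
  then show ?thesis by eventually_elim simp
qed

text \<open>An L2 limit of functions that vanish off \<open>A\<close> vanishes almost everywhere off
  \<open>A\<close>. This turns the integrals over \<open>A\<close> of the given definitions into
  integrals over the whole space.\<close>

lemma W0pair_vanish:
  fixes A :: "(real^'n::finite) set"
  assumes "W0pair A u g" "A \<in> sets lebesgue"
  shows "AE x in lebesgue. x \<notin> A \<longrightarrow> u x = 0" "AE x in lebesgue. x \<notin> A \<longrightarrow> g x = 0"
proof -
  have gen: "AE x in lebesgue. x \<notin> A \<longrightarrow> f x = 0"
    if f: "sqint lebesgue f" and F: "\<And>k. sqint lebesgue (F k)" and z: "\<And>k x. x \<notin> A \<Longrightarrow> F k x = 0"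
      and lim: "(\<lambda>k. \<integral>x. (norm (F k x - f x))\<^sup>2 \<partial>lebesgue) \<longlonglongrightarrow> 0"
    for f :: "real^'n \<Rightarrow> 'b::euclidean_space" and F :: "nat \<Rightarrow> real^'n \<Rightarrow> 'b"
  proof -
    have fm[measurable]: "f \<in> borel_measurable lebesgue" using sqintD(1)[OF f] .
    have Am[measurable]: "- A \<in> sets lebesgue" using assms(2) by (simp add: Compl_in_sets_lebesgue)
    define w where "w = (\<lambda>x. indicator (- A) x *\<^sub>R f x)"
    have "integrable lebesgue (\<lambda>x. indicator (- A) x *\<^sub>R (norm (f x))\<^sup>2)"
      by (rule integrable_mult_indicator[OF Am sqintD(2)[OF f]])
    moreover have "(\<lambda>x. indicator (- A) x *\<^sub>R (norm (f x))\<^sup>2) = (\<lambda>x. (norm (w x))\<^sup>2)"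
      by (auto simp: w_def indicator_def)
    ultimately have w: "sqint lebesgue w" unfolding sqint_def w_def by auto
    have "(\<integral>x. (norm (w x))\<^sup>2 \<partial>lebesgue) \<le> (\<integral>x. (norm (F k x - f x))\<^sup>2 \<partial>lebesgue)" for k
      using z by (intro integral_mono sqintD(2)[OF w] sqintD(2)[OF sqint_diff[OF F f]]) (auto simp: w_def indicator_def)
    then have "(\<integral>x. (norm (w x))\<^sup>2 \<partial>lebesgue) \<le> 0" by (intro LIMSEQ_le_const[OF lim]) auto
    then have "(\<integral>x. (norm (w x))\<^sup>2 \<partial>lebesgue) = 0" by (intro antisym) auto
    from L2_zero_AE[OF w this] show ?thesis by eventually_elim (auto simp: w_def indicator_def)
  qed
  obtain \<phi> where \<phi>: "\<And>k. \<phi> k \<in> Cc_inf A"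
    "(\<lambda>k. \<integral>x. (norm (\<phi> k x - u x))\<^sup>2 \<partial>lebesgue) \<longlonglongrightarrow> 0"
    "(\<lambda>k. \<integral>x. (norm (cgrad (\<phi> k) x - g x))\<^sup>2 \<partial>lebesgue) \<longlonglongrightarrow> 0" by (rule W0pairE[OF assms(1)]) (rule that)
  show "AE x in lebesgue. x \<notin> A \<longrightarrow> u x = 0"
    by (rule gen[OF W0pairD(1)[OF assms(1)] Cc_inf_sqint(1)[OF \<phi>(1)] Cc_infD(5)[OF \<phi>(1)] \<phi>(2)])
  show "AE x in lebesgue. x \<notin> A \<longrightarrow> g x = 0"
  proof (rule gen[OF W0pairD(2)[OF assms(1)] Cc_inf_sqint(2)[OF \<phi>(1)] _ \<phi>(3)])
    show "cgrad (\<phi> k) x = 0" if "x \<notin> A" for k x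
      by (rule cgrad_outside[OF \<phi>(1)]) (use that Cc_infD(3)[OF \<phi>(1)] in blast)
  qed
qed

section \<open>Mass and energy on the whole space\<close>

definition ipL :: "(real^'n \<Rightarrow> real) \<Rightarrow> (real^'n \<Rightarrow> real) \<Rightarrow> real" where
  "ipL u v = (\<integral>x. u x * v x \<partial>lebesgue)"

text \<open>Chosen with respect to the whole space, so that one expression serves all domains; for
  elements of \<open>W0 A\<close> it agrees almost everywhere with \<open>wgrad A\<close>.\<close>

abbreviation grad :: "(real^'n \<Rightarrow> real) \<Rightarrow> real^'n \<Rightarrow> real^'n" where
  "grad \<equiv> wgrad UNIV"

definition enL :: "(real^'n \<Rightarrow> real) \<Rightarrow> (real^'n \<Rightarrow> real) \<Rightarrow> real" where
  "enL u v = (\<integral>x. grad u x \<bullet> grad v x \<partial>lebesgue)"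

lemma W0_mono: "A \<subseteq> B \<Longrightarrow> W0 A \<subseteq> W0 B"
  unfolding W0_def using W0pair_mono by blast

lemma Cc_inf_subset_W0: "Cc_inf A \<subseteq> W0 A"
  unfolding W0_def using W0pair_Cc_inf by blast

lemma W0pair_wgrad: assumes "u \<in> W0 A" shows "W0pair A u (wgrad A u)"
  using assms someI_ex[of "W0pair A u"] unfolding W0_def wgrad_def by blast

lemma W0pair_cong_AE:
  assumes P: "W0pair A u g" and h: "h \<in> borel_measurable lebesgue" "AE x in lebesgue. g x = h x"
  shows "W0pair A u h"
proof -
  obtain \<phi> where \<phi>: "\<And>k. \<phi> k \<in> Cc_inf A"
    "(\<lambda>k. \<integral>x. (norm (\<phi> k x - u x))\<^sup>2 \<partial>lebesgue) \<longlonglongrightarrow> 0"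
    "(\<lambda>k. \<integral>x. (norm (cgrad (\<phi> k) x - g x))\<^sup>2 \<partial>lebesgue) \<longlonglongrightarrow> 0" by (rule W0pairE[OF P]) (rule that)
  note [measurable] = h(1) sqintD(1)[OF W0pairD(2)[OF P]] sqintD(1)[OF Cc_inf_sqint(2)[OF \<phi>(1)]]
  have "(\<integral>x. (norm (cgrad (\<phi> k) x - g x))\<^sup>2 \<partial>lebesgue) = (\<integral>x. (norm (cgrad (\<phi> k) x - h x))\<^sup>2 \<partial>lebesgue)" for k
    by (rule integral_cong_AE) (use h(2) in auto)
  then show ?thesis unfolding W0pair_alt using \<phi> W0pairD[OF P] sqint_cong_AE[OF W0pairD(2)[OF P] h] by auto
qed

lemma W0pair_grad: assumes "u \<in> W0 A" shows "W0pair A u (grad u)"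
proof -
  have "u \<in> W0 UNIV" using assms W0_mono[of A UNIV] by auto
  note P = W0pair_wgrad[OF assms] and Q = W0pair_wgrad[OF this]
  show ?thesis by (rule W0pair_cong_AE[OF P sqintD(1)[OF W0pairD(2)[OF Q]] W0pair_unique[OF P Q]]) simp
qed

text \<open>Frees later computations from the choice hidden in \<open>grad\<close>: any
  representative of the gradient, from any domain, may be inserted.\<close>

lemma enL_pair:
  assumes "W0pair A u g" "W0pair B v h" shows "enL u v = (\<integral>x. g x \<bullet> h x \<partial>lebesgue)"
  unfolding enL_def
proof (rule integral_cong_AE)
  have W: "u \<in> W0 UNIV" "v \<in> W0 UNIV" using assms W0pair_mono[OF subset_UNIV] unfolding W0_def by blast+
  note P = W0pair_grad[OF W(1)] and Q = W0pair_grad[OF W(2)]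
  note [measurable] = sqintD(1)[OF W0pairD(2)[OF P]] sqintD(1)[OF W0pairD(2)[OF Q]]
    sqintD(1)[OF W0pairD(2)[OF assms(1)]] sqintD(1)[OF W0pairD(2)[OF assms(2)]]
  show "(\<lambda>x. grad u x \<bullet> grad v x) \<in> borel_measurable lebesgue" "(\<lambda>x. g x \<bullet> h x) \<in> borel_measurable lebesgue"
    by measurable
  have "AE x in lebesgue. grad u x = g x" "AE x in lebesgue. grad v x = h x"
    by (rule W0pair_unique[OF P assms(1)], simp) (rule W0pair_unique[OF Q assms(2)], simp)
  then show "AE x in lebesgue. grad u x \<bullet> grad v x = g x \<bullet> h x" by eventually_elim simp
qed

lemma enL_square_pair: "W0pair A u g \<Longrightarrow> enL u u = (\<integral>x. (norm (g x))\<^sup>2 \<partial>lebesgue)"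
  using enL_pair[of A u g A u g] by (simp add: power2_norm_eq_inner)

lemma ipL_square: "ipL u u = (\<integral>x. (norm (u x))\<^sup>2 \<partial>lebesgue)"
  by (simp add: ipL_def power2_eq_square)

lemma enL_Cc_inf: "f \<in> Cc_inf A \<Longrightarrow> enL f f = (\<integral>x. (norm (cgrad f x))\<^sup>2 \<partial>lebesgue)"
  by (rule enL_square_pair[OF W0pair_Cc_inf])

lemma W0_lin: assumes "u \<in> W0 A" "v \<in> W0 A" shows "(\<lambda>x. a * u x + b * v x) \<in> W0 A"
  using W0pair_lin[OF W0pair_wgrad[OF assms(1)] W0pair_wgrad[OF assms(2)]] unfolding W0_def by blast

lemma zero_in_Cc_inf: "(\<lambda>x. 0) \<in> Cc_inf A"
  by (rule Cc_infI[of _ "{}"]) (auto intro: Ck_const)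

text \<open>All spaces \<open>W0 A\<close> are subspaces of \<open>W0 UNIV\<close>, so extension by
  zero is inclusion and functions on different truncated sets can be subtracted.\<close>

interpretation sob: hform "W0 (UNIV :: (real^'n::finite) set)" ipL enL
proof
  fix u v w :: "real^'n \<Rightarrow> real" and \<alpha> \<beta> :: real
  show "(\<lambda>x::real^'n. 0) \<in> W0 UNIV" using zero_in_Cc_inf Cc_inf_subset_W0 by blast
  assume u: "u \<in> W0 UNIV"
  show "0 \<le> ipL u u" "0 \<le> enL u u"
    unfolding ipL_square enL_square_pair[OF W0pair_grad[OF u]] by simp_all
  assume v: "v \<in> W0 UNIV"
  show "(\<lambda>x. \<alpha> * u x + \<beta> * v x) \<in> W0 UNIV" by (rule W0_lin[OF u v])
  show "ipL u v = ipL v u" "enL u v = enL v u" by (simp_all add: ipL_def enL_def mult.commute inner_commute)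
  assume w: "w \<in> W0 UNIV"
  note pu = W0pair_grad[OF u] and pv = W0pair_grad[OF v] and pw = W0pair_grad[OF w]
  note su = W0pairD[OF pu] and sv = W0pairD[OF pv] and sw = W0pairD[OF pw]
  show "ipL (\<lambda>x. \<alpha> * u x + \<beta> * v x) w = \<alpha> * ipL u w + \<beta> * ipL v w"
    using sqint_inner[OF su(1) sw(1)] sqint_inner[OF sv(1) sw(1)]
    by (simp add: ipL_def distrib_right mult.assoc)
  show "enL (\<lambda>x. \<alpha> * u x + \<beta> * v x) w = \<alpha> * enL u w + \<beta> * enL v w"
    using sqint_inner[OF su(2) sw(2)] sqint_inner[OF sv(2) sw(2)]
    unfolding enL_pair[OF W0pair_lin[OF pu pv] pw] enL_pair[OF pu pw] enL_pair[OF pv pw]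
    by (simp add: inner_add_left)
qed

lemma W0_subsp: "sob.subsp (W0 A)"
  unfolding sob.subsp_def
  using W0_mono[of A UNIV] zero_in_Cc_inf[of A] Cc_inf_subset_W0[of A] W0_lin[of _ A] by auto

lemma ipL_diff: "sqdist ipL u v = (\<integral>x. (norm (u x - v x))\<^sup>2 \<partial>lebesgue)"
  by (rule ipL_square)

lemma W0pair_diff:
  assumes "W0pair A u g" "W0pair A v h" shows "W0pair A (\<lambda>x. u x - v x) (\<lambda>x. g x - h x)"
  using W0pair_lin[OF assms, of 1 "-1"] by simp

lemma enL_diff:
  assumes "W0pair A u g" "W0pair A v h"
  shows "sqdist enL u v = (\<integral>x. (norm (g x - h x))\<^sup>2 \<partial>lebesgue)"
  by (rule enL_square_pair[OF W0pair_diff[OF assms]])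

lemma W0_dense: assumes u: "u \<in> W0 A" shows "\<exists>\<phi>. (\<forall>k. \<phi> k \<in> Cc_inf A) \<and> sob.conv \<phi> u"
proof -
  obtain \<phi> where \<phi>: "\<And>k. \<phi> k \<in> Cc_inf A"
    "(\<lambda>k. \<integral>x. (norm (\<phi> k x - u x))\<^sup>2 \<partial>lebesgue) \<longlonglongrightarrow> 0"
    "(\<lambda>k. \<integral>x. (norm (cgrad (\<phi> k) x - grad u x))\<^sup>2 \<partial>lebesgue) \<longlonglongrightarrow> 0"
    by (rule W0pairE[OF W0pair_grad[OF u]]) (rule that)
  have "sob.conv \<phi> u"
    unfolding sob.conv_def sob.ip.conv_def sob.en.conv_def ipL_diff enL_diff[OF W0pair_Cc_inf[OF \<phi>(1)] W0pair_grad[OF u]]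
    using \<phi>(2,3) by simp
  then show ?thesis using \<phi>(1) by blast
qed

lemma L2_dist_triangle:
  assumes "sqint M f" "sqint M g" "sqint M h"
  shows "(\<integral>x. (norm (f x - h x))\<^sup>2 \<partial>M) \<le> 2 * (\<integral>x. (norm (f x - g x))\<^sup>2 \<partial>M) + 2 * (\<integral>x. (norm (g x - h x))\<^sup>2 \<partial>M)"
proof -
  note i1 = sqintD(2)[OF sqint_diff[OF assms(1,2)]] and i2 = sqintD(2)[OF sqint_diff[OF assms(2,3)]]
  have "(\<integral>x. (norm (f x - h x))\<^sup>2 \<partial>M) \<le> (\<integral>x. 2 * (norm (f x - g x))\<^sup>2 + 2 * (norm (g x - h x))\<^sup>2 \<partial>M)"
  proof (rule integral_mono)
    show "integrable M (\<lambda>x. (norm (f x - h x))\<^sup>2)" by (rule sqintD(2)[OF sqint_diff[OF assms(1,3)]])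
    show "integrable M (\<lambda>x. 2 * (norm (f x - g x))\<^sup>2 + 2 * (norm (g x - h x))\<^sup>2)" using i1 i2 by simp
    show "(norm (f x - h x))\<^sup>2 \<le> 2 * (norm (f x - g x))\<^sup>2 + 2 * (norm (g x - h x))\<^sup>2" for x
      using norm_add_square_le[of "f x - g x" "g x - h x"] by simp
  qed
  then show ?thesis using i1 i2 by simp
qed

lemma W0_closed: "sob.closed_subsp (W0 A)"
  unfolding sob.closed_subsp_def
proof (intro conjI W0_subsp allI impI)
  fix u assume u: "\<forall>n. u n \<in> W0 A" and C: "sob.Cauchy_seq u"
  have uA: "u n \<in> W0 A" for n using u by blast
  note P = W0pair_grad[OF uA]
  have C1: "\<exists>N. \<forall>m\<ge>N. \<forall>n\<ge>N. (\<integral>x. (norm (u m x - u n x))\<^sup>2 \<partial>lebesgue) < e"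
    and C2: "\<exists>N. \<forall>m\<ge>N. \<forall>n\<ge>N. (\<integral>x. (norm (grad (u m) x - grad (u n) x))\<^sup>2 \<partial>lebesgue) < e" if "e > 0" for e
    using C that unfolding sob.Cauchy_seq_def ipL_diff enL_diff[OF P P] by meson+
  obtain v where v: "sqint lebesgue v" "(\<lambda>n. \<integral>x. (norm (u n x - v x))\<^sup>2 \<partial>lebesgue) \<longlonglongrightarrow> 0"
    using L2_complete[of lebesgue u, OF W0pairD(1)[OF P] C1] by blast
  obtain g where g: "sqint lebesgue g" "(\<lambda>n. \<integral>x. (norm (grad (u n) x - g x))\<^sup>2 \<partial>lebesgue) \<longlonglongrightarrow> 0"
    using L2_complete[of lebesgue "\<lambda>n. grad (u n)", OF W0pairD(2)[OF P] C2] by blast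
  \<comment> \<open>For each \<open>n\<close> a test function within squared distance
    \<open>1 / (n + 1)\<close> of \<open>u n\<close>, in value and in gradient. These test functions
    converge to \<open>v\<close> and \<open>g\<close>, which makes the limits a pair.\<close>
  define T where "T n \<phi> \<longleftrightarrow> \<phi> \<in> Cc_inf A \<and> (\<integral>x. (norm (\<phi> x - u n x))\<^sup>2 \<partial>lebesgue) < inverse (real (Suc n)) \<and>
      (\<integral>x. (norm (cgrad \<phi> x - grad (u n) x))\<^sup>2 \<partial>lebesgue) < inverse (real (Suc n))" for n \<phi>
  have "\<exists>\<phi>. T n \<phi>" for n
  proof -
    obtain \<phi> where \<phi>: "\<And>k. \<phi> k \<in> Cc_inf A"
      "(\<lambda>k. \<integral>x. (norm (\<phi> k x - u n x))\<^sup>2 \<partial>lebesgue) \<longlonglongrightarrow> 0"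
      "(\<lambda>k. \<integral>x. (norm (cgrad (\<phi> k) x - grad (u n) x))\<^sup>2 \<partial>lebesgue) \<longlonglongrightarrow> 0"
      by (rule W0pairE[OF P]) (rule that)
    have "0 < inverse (real (Suc n))" by simp
    from order_tendstoD(2)[OF \<phi>(2) this] order_tendstoD(2)[OF \<phi>(3) this]
    have "\<forall>\<^sub>F k in sequentially. T n (\<phi> k)" unfolding T_def by eventually_elim (use \<phi>(1) in auto)
    then show ?thesis by (meson eventually_happens sequentially_bot)
  qed
  then obtain \<phi> where T: "\<And>n. T n (\<phi> n)" by metis
  have \<phi>: "\<phi> n \<in> Cc_inf A" for n using T[of n] by (simp add: T_def)
  have l1: "(\<lambda>n. 2 * inverse (real (Suc n)) + 2 * (\<integral>x. (norm (u n x - v x))\<^sup>2 \<partial>lebesgue)) \<longlonglongrightarrow> 2 * 0 + 2 * 0"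
    by (intro tendsto_intros LIMSEQ_inverse_real_of_nat v)
  have l2: "(\<lambda>n. 2 * inverse (real (Suc n)) + 2 * (\<integral>x. (norm (grad (u n) x - g x))\<^sup>2 \<partial>lebesgue)) \<longlonglongrightarrow> 2 * 0 + 2 * 0"
    by (intro tendsto_intros LIMSEQ_inverse_real_of_nat g)
  have b1: "(\<integral>x. (norm (\<phi> n x - v x))\<^sup>2 \<partial>lebesgue) \<le> 2 * inverse (real (Suc n)) + 2 * (\<integral>x. (norm (u n x - v x))\<^sup>2 \<partial>lebesgue)" for n
    using L2_dist_triangle[OF Cc_inf_sqint(1)[OF \<phi>] W0pairD(1)[OF P] v(1), of n n] T[of n] unfolding T_def by linarith
  have b2: "(\<integral>x. (norm (cgrad (\<phi> n) x - g x))\<^sup>2 \<partial>lebesgue) \<le> 2 * inverse (real (Suc n)) + 2 * (\<integral>x. (norm (grad (u n) x - g x))\<^sup>2 \<partial>lebesgue)" for n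
    using L2_dist_triangle[OF Cc_inf_sqint(2)[OF \<phi>] W0pairD(2)[OF P] g(1), of n n] T[of n] unfolding T_def by linarith
  have "(\<lambda>n. \<integral>x. (norm (\<phi> n x - v x))\<^sup>2 \<partial>lebesgue) \<longlonglongrightarrow> 0"
    by (rule tendsto_sandwich[OF always_eventually always_eventually tendsto_const l1[simplified]]) (use b1 in simp_all)
  moreover have "(\<lambda>n. \<integral>x. (norm (cgrad (\<phi> n) x - g x))\<^sup>2 \<partial>lebesgue) \<longlonglongrightarrow> 0"
    by (rule tendsto_sandwich[OF always_eventually always_eventually tendsto_const l2[simplified]]) (use b2 in simp_all)
  ultimately have vg: "W0pair A v g" unfolding W0pair_alt using v(1) g(1) \<phi> by blast
  have "sob.conv u v"
    unfolding sob.conv_def sob.ip.conv_def sob.en.conv_def ipL_diff enL_diff[OF P vg] using v(2) g(2) by simp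
  moreover have "v \<in> W0 A" using vg unfolding W0_def by blast
  ultimately show "\<exists>v\<in>W0 A. sob.conv u v" by blast
qed

lemma functional_set_integral:
  assumes "S \<in> lmeasurable"
  shows "sob.functional (\<lambda>u. \<integral>x. indicator S x * u x \<partial>lebesgue)"
proof -
  have S: "sqint lebesgue (\<lambda>x. indicator S x :: real)"
    unfolding sqint_def
  proof
    have "(\<lambda>x. (norm (indicator S x :: real))\<^sup>2) = indicator S" by (auto simp: indicator_def)
    moreover have "integrable lebesgue (indicator S :: _ \<Rightarrow> real)"
      using assms unfolding fmeasurable_def by (intro integrable_real_indicator) blast+
    ultimately show "integrable lebesgue (\<lambda>x. (norm (indicator S x :: real))\<^sup>2)" by simp
  qed (rule borel_measurable_indicator[OF fmeasurableD[OF assms]])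
  have sq: "sqint lebesgue u" if "u \<in> W0 UNIV" for u using W0pairD(1)[OF W0pair_grad[OF that]] .
  have i: "integrable lebesgue (\<lambda>x. indicator S x * u x)" if "u \<in> W0 UNIV" for u
    using sqint_inner[OF S sq[OF that]] by simp
  let ?K = "sqrt (\<integral>x. (norm (indicator S x :: real))\<^sup>2 \<partial>lebesgue)"
  show ?thesis
    unfolding sob.functional_def
  proof (intro conjI ballI exI[of _ ?K])
    show "(\<integral>x. indicator S x * (u x - v x) \<partial>lebesgue) = (\<integral>x. indicator S x * u x \<partial>lebesgue) - (\<integral>x. indicator S x * v x \<partial>lebesgue)"
      if "u \<in> W0 UNIV" "v \<in> W0 UNIV" for u v
      using i[OF that(1)] i[OF that(2)] by (simp add: right_diff_distrib)
    show "\<bar>\<integral>x. indicator S x * u x \<partial>lebesgue\<bar> \<le> ?K * sqrt (ipL u u)" if "u \<in> W0 UNIV" for u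
      using L2_cauchy_schwarz[OF S sq[OF that]] unfolding real_sqrt_mult[symmetric] ipL_square
      by (intro real_le_rsqrt) simp
  qed simp
qed

section \<open>The stated quantities expressed by the whole-space forms\<close>

context
  fixes A :: "(real^'n::finite) set"
  assumes A: "A \<in> sets lebesgue"
begin

lemma set_integral_eq:
  assumes "f \<in> borel_measurable lebesgue" "g \<in> borel_measurable lebesgue"
    "AE x in lebesgue. x \<in> A \<longrightarrow> f x = g x" "AE x in lebesgue. x \<notin> A \<longrightarrow> g x = 0"
  shows "(LINT x:A|lebesgue. (f x :: real)) = (\<integral>x. g x \<partial>lebesgue)"
  unfolding set_lebesgue_integral_def
proof (rule integral_cong_AE)
  show "(\<lambda>x. indicator A x *\<^sub>R f x) \<in> borel_measurable lebesgue"
    using A assms(1) by measurable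
  show "AE x in lebesgue. indicator A x *\<^sub>R f x = g x"
    using assms(3,4) by eventually_elim (auto simp: indicator_def)
qed fact

lemma L2inner_eq_ipL:
  assumes "u \<in> W0 A" "v \<in> W0 UNIV"
  shows "L2inner A u v = ipL u v"
proof -
  note P = W0pair_grad[OF assms(1)] and Q = W0pair_grad[OF assms(2)]
  note [measurable] = sqintD(1)[OF W0pairD(1)[OF P]] sqintD(1)[OF W0pairD(1)[OF Q]]
  show ?thesis
    unfolding L2inner_def ipL_def
  proof (rule set_integral_eq)
    show "AE x in lebesgue. x \<notin> A \<longrightarrow> u x * v x = 0"
      using W0pair_vanish(1)[OF P A] by eventually_elim auto
  qed simp_all
qed

lemma L2norm_eq: assumes "u \<in> W0 A" shows "L2norm A u = sqrt (ipL u u)"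
  using L2inner_eq_ipL[OF assms subsetD[OF W0_mono[OF subset_UNIV] assms]]
  by (simp add: L2norm_def L2sq_def L2inner_def power2_eq_square)

lemma wgrad_inner_eq:
  assumes u: "u \<in> W0 A" and v: "v \<in> W0 A"
  shows "(LINT x:A|lebesgue. wgrad A u x \<bullet> wgrad A v x) = enL u v"
proof -
  note P = W0pair_wgrad[OF u] and Q = W0pair_wgrad[OF v]
  note [measurable] = sqintD(1)[OF W0pairD(2)[OF P]] sqintD(1)[OF W0pairD(2)[OF Q]]
  show ?thesis
    unfolding enL_pair[OF P Q]
  proof (rule set_integral_eq)
    show "AE x in lebesgue. x \<notin> A \<longrightarrow> wgrad A u x \<bullet> wgrad A v x = 0"
      using W0pair_vanish(2)[OF P A] by eventually_elim auto
  qed simp_all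
qed

lemma Dirichlet_eq: assumes "u \<in> W0 A" shows "Dirichlet A u = enL u u"
  using wgrad_inner_eq[OF assms assms] by (simp add: Dirichlet_def power2_norm_eq_inner)

lemma S2_eq: "S2 A = {u \<in> W0 A. ipL u u = 1}"
  unfolding S2_def using L2norm_eq by auto

lemma eigenfun_iff:
  "eigenfun A \<mu> u \<longleftrightarrow> u \<in> W0 A \<and> ipL u u = 1 \<and> (\<forall>\<phi>\<in>W0 A. enL u \<phi> = \<mu> * ipL u \<phi>)"
proof (cases "u \<in> W0 A")
  case True
  have "(\<forall>\<phi>\<in>W0 A. (LINT x:A|lebesgue. wgrad A u x \<bullet> wgrad A \<phi> x) = \<mu> * L2inner A u \<phi>) \<longleftrightarrow>
      (\<forall>\<phi>\<in>W0 A. enL u \<phi> = \<mu> * ipL u \<phi>)"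
  proof (rule ball_cong[OF refl])
    fix \<phi> assume \<phi>: "\<phi> \<in> W0 A"
    have "\<phi> \<in> W0 UNIV" using \<phi> W0_mono[of A UNIV] by auto
    then show "(LINT x:A|lebesgue. wgrad A u x \<bullet> wgrad A \<phi> x) = \<mu> * L2inner A u \<phi> \<longleftrightarrow> enL u \<phi> = \<mu> * ipL u \<phi>"
      by (simp only: wgrad_inner_eq[OF True \<phi>] L2inner_eq_ipL[OF True])
  qed
  then show ?thesis unfolding eigenfun_def S2_eq by simp
next
  case False
  then show ?thesis unfolding eigenfun_def S2_eq by simp
qed

text \<open>Vanishing almost everywhere is the same as having mass 0, so the condition on the basis
  in \<open>lam\<close> is \<open>sob.indep\<close>, and the energies of the normalised combinations
  form \<open>sob.levels\<close>.\<close>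

lemma lam_eq: "lam j A = sob.minmax j (W0 A)"
proof -
  have lin: "(lincomb j c \<phi>) \<in> W0 A" if "\<forall>i<j. \<phi> i \<in> W0 A" for c \<phi>
    using that by (intro sob.subsp_sum[OF W0_subsp]) auto
  have lev: "{Dirichlet A (lincomb j c \<phi>) | c. (lincomb j c \<phi>) \<in> S2 A} = sob.levels j \<phi>"
    if "\<forall>i<j. \<phi> i \<in> W0 A" for \<phi>
    unfolding sob.levels_def S2_eq using lin[OF that] Dirichlet_eq[OF lin[OF that]] by auto
  have zero: "(AE x in lebesgue. w x = 0) \<longleftrightarrow> ipL w w = 0" if "w \<in> W0 A" for w
  proof -
    note P = W0pairD(1)[OF W0pair_wgrad[OF that]]
    show ?thesis
      using L2_zero_AE[OF P] integral_nonneg_eq_0_iff_AE[OF sqintD(2)[OF P]] unfolding ipL_square by auto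
  qed
  have ind: "(\<forall>c. (AE x in lebesgue. (\<Sum>i<j. c i * \<phi> i x) = 0) \<longrightarrow> (\<forall>i<j. c i = 0)) \<longleftrightarrow> sob.indep j \<phi>"
    if "\<forall>i<j. \<phi> i \<in> W0 A" for \<phi>
    unfolding sob.indep_def using zero[OF lin[OF that]] by simp
  have "{Sup {Dirichlet A (lincomb j c \<phi>) | c. (lincomb j c \<phi>) \<in> S2 A} | \<phi>.
      (\<forall>i<j. \<phi> i \<in> W0 A) \<and> (\<forall>c. (AE x in lebesgue. (\<Sum>i<j. c i * \<phi> i x) = 0) \<longrightarrow> (\<forall>i<j. c i = 0))}
    = {Sup (sob.levels j \<phi>) | \<phi>. (\<forall>i<j. \<phi> i \<in> W0 A) \<and> sob.indep j \<phi>}"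
  proof (rule Collect_cong, rule ex_cong1)
    fix x \<phi>
    show "(x = Sup {Dirichlet A (lincomb j c \<phi>) | c. (lincomb j c \<phi>) \<in> S2 A} \<and>
      (\<forall>i<j. \<phi> i \<in> W0 A) \<and> (\<forall>c. (AE x in lebesgue. (\<Sum>i<j. c i * \<phi> i x) = 0) \<longrightarrow> (\<forall>i<j. c i = 0))) \<longleftrightarrow>
      (x = Sup (sob.levels j \<phi>) \<and> (\<forall>i<j. \<phi> i \<in> W0 A) \<and> sob.indep j \<phi>)"
    proof (cases "\<forall>i<j. \<phi> i \<in> W0 A")
      case True
      show ?thesis by (simp only: lev[OF True] ind[OF True])
    next
      case False
      then show ?thesis by blast
    qed
  qed
  then show ?thesis unfolding lam_def sob.minmax_def by simp
qed

end

section \<open>Local compactness\<close>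

lemma nn_integral_lborel_shift:
  fixes f :: "'a::euclidean_space \<Rightarrow> ennreal"
  assumes [measurable]: "f \<in> borel_measurable borel"
  shows "(\<integral>\<^sup>+x. f (c + x) \<partial>lborel) = (\<integral>\<^sup>+x. f x \<partial>lborel)"
proof -
  have "(\<integral>\<^sup>+x. f x \<partial>lborel) = (\<integral>\<^sup>+x. f x \<partial>(distr lborel borel ((+) c)))" by (subst lborel_distr_plus) (rule refl)
  also have "\<dots> = (\<integral>\<^sup>+x. f (c + x) \<partial>lborel)" by (rule nn_integral_distr) measurable
  finally show ?thesis by simp
qed

lemma Cc_inf_borel: assumes "f \<in> Cc_inf A" shows "f \<in> borel_measurable borel" "cgrad f \<in> borel_measurable borel"
  by (rule borel_measurable_continuous_onI[OF continuous_on_Cc_inf[OF assms]],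
      rule borel_measurable_continuous_onI[OF continuous_on_cgrad[OF assms]])

lemma Cc_inf_nn_integral_grad:
  assumes "f \<in> Cc_inf A"
  shows "(\<integral>\<^sup>+x. ennreal ((norm (cgrad f x))\<^sup>2) \<partial>lborel) = ennreal (enL f f)"
proof -
  have i: "integrable lebesgue (\<lambda>x. (norm (cgrad f x))\<^sup>2)" by (rule sqintD(2)[OF Cc_inf_sqint(2)[OF assms]])
  have "(\<integral>\<^sup>+x. ennreal ((norm (cgrad f x))\<^sup>2) \<partial>lborel) = (\<integral>\<^sup>+x. ennreal ((norm (cgrad f x))\<^sup>2) \<partial>lebesgue)"
    by (simp add: nn_integral_completion)
  also have "\<dots> = ennreal (\<integral>x. (norm (cgrad f x))\<^sup>2 \<partial>lebesgue)" using i by (intro nn_integral_eq_integral) auto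
  finally show ?thesis by (simp add: enL_Cc_inf[OF assms])
qed

text \<open>The fundamental theorem of calculus along the segment from \<open>x\<close> to
  \<open>x + h\<close>, followed by Cauchy-Schwarz against the indicator of \<open>{0..1}\<close>.
  The bound is kept as a nonnegative integral so that the order of integration can be exchanged
  afterwards.\<close>

lemma square_increment_le:
  assumes f: "f \<in> Cc_inf A"
  shows "ennreal ((f (x + h) - f x)\<^sup>2)
    \<le> (\<integral>\<^sup>+s. indicator {0..1} s * ennreal ((norm h)\<^sup>2 * (norm (cgrad f (x + s *\<^sub>R h)))\<^sup>2) \<partial>lborel)"
proof -
  define d where "d s = cgrad f (x + s *\<^sub>R h) \<bullet> h" for s
  have cd: "continuous_on S d" for S
    unfolding d_def by (intro continuous_intros continuous_on_compose2[OF continuous_on_cgrad[OF f, of UNIV]]) auto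
  have cg: "continuous_on S (\<lambda>s. (norm h)\<^sup>2 * (norm (cgrad f (x + s *\<^sub>R h)))\<^sup>2)" for S
    by (intro continuous_intros continuous_on_compose2[OF continuous_on_cgrad[OF f, of UNIV]]) auto
  have "(\<integral>s. d s * indicator {0..1} s \<partial>lborel) = f (x + 1 *\<^sub>R h) - f (x + 0 *\<^sub>R h)"
  proof (rule integral_FTC_Icc_real)
    show "isCont d s" for s using cd[of UNIV] by (simp add: continuous_on_eq_continuous_at)
    show "((\<lambda>s. f (x + s *\<^sub>R h)) has_real_derivative d s) (at s)" for s
    proof -
      have "((\<lambda>s. f (x + s *\<^sub>R h)) has_derivative (\<lambda>t. cgrad f (x + s *\<^sub>R h) \<bullet> (t *\<^sub>R h))) (at s)"
        by (rule has_derivative_compose[of "\<lambda>s. x + s *\<^sub>R h" _ _ _ f "\<lambda>k. cgrad f (x + s *\<^sub>R h) \<bullet> k"])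
           (auto intro!: derivative_eq_intros Cc_inf_has_derivative[OF f])
      then show ?thesis unfolding has_field_derivative_def
        by (rule has_derivative_eq_rhs) (auto simp: fun_eq_iff d_def)
    qed
  qed simp
  then have eq: "f (x + h) - f x = (\<integral>s. (d s * indicator {0..1} s) \<bullet> indicator {0..1} s \<partial>lborel)"
  proof -
    have "(\<lambda>s. (d s * indicator {0..1} s) \<bullet> indicator {0..1} s) = (\<lambda>s. d s * indicator {0..1} s)"
      by (auto simp: indicator_def)
    then show ?thesis using \<open>(\<integral>s. d s * indicator {0..1} s \<partial>lborel) = f (x + 1 *\<^sub>R h) - f (x + 0 *\<^sub>R h)\<close> by simp
  qed
  have dm[measurable]: "d \<in> borel_measurable borel" by (rule borel_measurable_continuous_onI[OF cd])
  have e: "(\<lambda>s. (norm (d s * indicator {0..1} s))\<^sup>2) = (\<lambda>s. indicator {0..1} s *\<^sub>R (d s)\<^sup>2)"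
    "(\<lambda>s. (norm (indicator {0..1::real} s :: real))\<^sup>2) = indicator {0..1}" by (auto simp: indicator_def)
  have s1: "sqint lborel (\<lambda>s. d s * indicator {0..1} s)"
    unfolding sqint_def e
  proof
    have "continuous_on {0..1} (\<lambda>s. (d s)\<^sup>2)" by (intro continuous_intros cd)
    then show "integrable lborel (\<lambda>s. indicator {0..1} s *\<^sub>R (d s)\<^sup>2)" by (intro borel_integrable_compact) simp_all
  qed measurable
  have s2: "sqint lborel (\<lambda>s::real. indicator {0..1} s :: real)"
    unfolding sqint_def e by (auto intro!: integrable_real_indicator)
  have ig: "integrable lborel (\<lambda>s. indicator {0..1::real} s *\<^sub>R ((norm h)\<^sup>2 * (norm (cgrad f (x + s *\<^sub>R h)))\<^sup>2))"
    by (intro borel_integrable_compact cg) simp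
  have "(f (x + h) - f x)\<^sup>2 \<le> (\<integral>s. indicator {0..1} s *\<^sub>R (d s)\<^sup>2 \<partial>lborel)"
    using L2_cauchy_schwarz[OF s1 s2] unfolding eq e by simp
  also have "\<dots> \<le> (\<integral>s. indicator {0..1} s *\<^sub>R ((norm h)\<^sup>2 * (norm (cgrad f (x + s *\<^sub>R h)))\<^sup>2) \<partial>lborel)"
  proof (rule integral_mono)
    show "integrable lborel (\<lambda>s. indicator {0..1} s *\<^sub>R (d s)\<^sup>2)" using sqintD(2)[OF s1] unfolding e .
    fix s
    have "\<bar>d s\<bar> \<le> norm (cgrad f (x + s *\<^sub>R h)) * norm h" unfolding d_def by (rule Cauchy_Schwarz_ineq2)
    then have "\<bar>d s\<bar>\<^sup>2 \<le> (norm (cgrad f (x + s *\<^sub>R h)) * norm h)\<^sup>2" by (rule power_mono) simp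
    then show "indicator {0..1} s *\<^sub>R (d s)\<^sup>2 \<le> indicator {0..1} s *\<^sub>R ((norm h)\<^sup>2 * (norm (cgrad f (x + s *\<^sub>R h)))\<^sup>2)"
      by (simp add: power_mult_distrib mult.commute indicator_def)
  qed (rule ig)
  finally have "ennreal ((f (x + h) - f x)\<^sup>2) \<le> ennreal (\<integral>s. indicator {0..1} s *\<^sub>R ((norm h)\<^sup>2 * (norm (cgrad f (x + s *\<^sub>R h)))\<^sup>2) \<partial>lborel)"
    by (rule ennreal_leI)
  also have "\<dots> = (\<integral>\<^sup>+s. ennreal (indicator {0..1} s *\<^sub>R ((norm h)\<^sup>2 * (norm (cgrad f (x + s *\<^sub>R h)))\<^sup>2)) \<partial>lborel)"
    by (rule nn_integral_eq_integral[OF ig, symmetric]) simp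
  also have "\<dots> = (\<integral>\<^sup>+s. indicator {0..1} s * ennreal ((norm h)\<^sup>2 * (norm (cgrad f (x + s *\<^sub>R h)))\<^sup>2) \<partial>lborel)"
    by (intro nn_integral_cong) (auto simp: indicator_def)
  finally show ?thesis .
qed

text \<open>After exchanging the integrals every \<open>s\<close> in \<open>{0..1}\<close>
  contributes the same amount, by translation invariance.\<close>

lemma translation_estimate:
  assumes f: "f \<in> Cc_inf A"
  shows "(\<integral>\<^sup>+x. ennreal ((f (x + h) - f x)\<^sup>2) \<partial>lborel) \<le> ennreal ((norm h)\<^sup>2 * enL f f)"
proof -
  note [measurable] = Cc_inf_borel[OF f]
  have e0: "enL f f \<ge> 0" by (simp add: enL_Cc_inf[OF f])
  have "(\<integral>\<^sup>+x. ennreal ((f (x + h) - f x)\<^sup>2) \<partial>lborel)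
      \<le> (\<integral>\<^sup>+x. (\<integral>\<^sup>+s. indicator {0..1} s * ennreal ((norm h)\<^sup>2 * (norm (cgrad f (x + s *\<^sub>R h)))\<^sup>2) \<partial>lborel) \<partial>lborel)"
    by (intro nn_integral_mono square_increment_le[OF f])
  also have "\<dots> = (\<integral>\<^sup>+s. (\<integral>\<^sup>+x. indicator {0..1::real} s * ennreal ((norm h)\<^sup>2 * (norm (cgrad f (x + s *\<^sub>R h)))\<^sup>2) \<partial>lborel) \<partial>lborel)"
    by (rule lborel_pair.Fubini') measurable
  also have "\<dots> = (\<integral>\<^sup>+s. indicator {0..1::real} s * ennreal ((norm h)\<^sup>2 * enL f f) \<partial>lborel)"
  proof (rule nn_integral_cong)
    fix s :: real
    have "(\<integral>\<^sup>+x. indicator {0..1::real} s * ennreal ((norm h)\<^sup>2 * (norm (cgrad f (x + s *\<^sub>R h)))\<^sup>2) \<partial>lborel)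
      = indicator {0..1::real} s * (ennreal ((norm h)\<^sup>2) * (\<integral>\<^sup>+x. ennreal ((norm (cgrad f (s *\<^sub>R h + x)))\<^sup>2) \<partial>lborel))"
      by (simp add: nn_integral_cmult ennreal_mult add.commute)
    also have "(\<integral>\<^sup>+x. ennreal ((norm (cgrad f (s *\<^sub>R h + x)))\<^sup>2) \<partial>lborel) = ennreal (enL f f)"
      by (subst nn_integral_lborel_shift) (simp_all add: Cc_inf_nn_integral_grad[OF f])
    finally show "(\<integral>\<^sup>+x. indicator {0..1::real} s * ennreal ((norm h)\<^sup>2 * (norm (cgrad f (x + s *\<^sub>R h)))\<^sup>2) \<partial>lborel)
      = indicator {0..1::real} s * ennreal ((norm h)\<^sup>2 * enL f f)"
      using e0 by (simp add: ennreal_mult)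
  qed
  also have "\<dots> = ennreal ((norm h)\<^sup>2 * enL f f)"
    by (simp add: nn_integral_multc)
  finally show ?thesis .
qed

text \<open>Half-open cubes of edge \<open>r\<close>, so that they partition the space. The cube
  sees a label only through its values on \<open>Basis\<close>; labels are later taken in
  \<open>extensional Basis\<close>, so that distinct labels give disjoint cubes.\<close>

definition gridcube :: "real \<Rightarrow> ('a::euclidean_space \<Rightarrow> int) \<Rightarrow> 'a set" where
  "gridcube r z = {x. \<forall>b\<in>Basis. \<lfloor>x \<bullet> b / r\<rfloor> = z b}"

lemma gridcube_measure:
  fixes z :: "'a::euclidean_space \<Rightarrow> int"
  assumes r: "r > 0"
  shows "gridcube r z \<in> sets borel" "emeasure lborel (gridcube r z) = ennreal (r ^ DIM('a))"
proof -
  define l u where "l = (\<Sum>b\<in>Basis. (r * z b) *\<^sub>R b)" and "u = (\<Sum>b\<in>Basis. (r * (z b + 1)) *\<^sub>R b)"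
  have lu: "l \<bullet> b = r * z b" "u \<bullet> b = r * (z b + 1)" if "b \<in> Basis" for b
    using that by (simp_all add: l_def u_def)
  have iff: "\<lfloor>x \<bullet> b / r\<rfloor> = z b \<longleftrightarrow> l \<bullet> b \<le> x \<bullet> b \<and> x \<bullet> b < u \<bullet> b" if "b \<in> Basis" for x b
    using r that by (simp add: lu floor_eq_iff field_simps)
  have eq: "gridcube r z = (\<Inter>b\<in>Basis. {x. l \<bullet> b \<le> x \<bullet> b} \<inter> {x. x \<bullet> b < u \<bullet> b})"
    using iff by (auto simp: gridcube_def)
  show m: "gridcube r z \<in> sets borel" unfolding eq
    by (intro sets.finite_INT) auto
  have "box l u \<subseteq> gridcube r z" "gridcube r z \<subseteq> cbox l u" unfolding eq by (auto simp: mem_box less_imp_le)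
  then have "emeasure lborel (box l u) \<le> emeasure lborel (gridcube r z)" "emeasure lborel (gridcube r z) \<le> emeasure lborel (cbox l u)"
    using m by (auto intro!: emeasure_mono)
  moreover have "emeasure lborel (box l u) = ennreal (r ^ DIM('a))" "emeasure lborel (cbox l u) = ennreal (r ^ DIM('a))"
    using r by (simp_all add: emeasure_lborel_box_eq emeasure_lborel_cbox_eq lu inner_diff_left algebra_simps)
  ultimately show "emeasure lborel (gridcube r z) = ennreal (r ^ DIM('a))" by (simp add: antisym)
qed

text \<open>Writes the deviation of \<open>f\<close> from its mean on \<open>Q\<close> as a double
  integral of increments, which the translation estimate can bound.\<close>

lemma variance_identity:
  fixes f :: "'a::euclidean_space \<Rightarrow> real"
  assumes f: "integrable lborel f" "integrable lborel (\<lambda>x. (f x)\<^sup>2)" and Q: "Q \<in> sets borel" "emeasure lborel Q = ennreal V" "V \<ge> 0"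
  shows "(\<integral>\<^sup>+x. (\<integral>\<^sup>+y. ennreal (indicator Q x * indicator Q y * (f y - f x)\<^sup>2) \<partial>lborel) \<partial>lborel)
     = ennreal (2 * V * (\<integral>x. indicator Q x * (f x)\<^sup>2 \<partial>lborel) - 2 * (\<integral>x. indicator Q x * f x \<partial>lborel)\<^sup>2)"
proof -
  define a b where "a = (\<integral>x. indicator Q x * f x \<partial>lborel)" and "b = (\<integral>x. indicator Q x * (f x)\<^sup>2 \<partial>lborel)"
  have iQ: "integrable lborel (indicator Q :: 'a \<Rightarrow> real)" using Q by (intro integrable_real_indicator) auto
  have mQ: "(\<integral>x. indicator Q x \<partial>lborel) = V" using Q by (simp add: measure_def)
  have i1: "integrable lborel (\<lambda>x. indicator Q x * f x)"
    using integrable_mult_indicator[OF _ f(1), of Q] Q by simp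
  have i2: "integrable lborel (\<lambda>x. indicator Q x * (f x)\<^sup>2)"
    using integrable_mult_indicator[OF _ f(2), of Q] Q by simp
  have ex: "indicator Q x * indicator Q y * (f y - f x)\<^sup>2
      = indicator Q x * (indicator Q y * (f y)\<^sup>2) - 2 * (indicator Q x * f x) * (indicator Q y * f y) + (indicator Q x * (f x)\<^sup>2) * indicator Q y" for x y
    by (auto simp: indicator_def power2_diff)
  have I: "integrable lborel (\<lambda>y. indicator Q x * indicator Q y * (f y - f x)\<^sup>2)" for x
    unfolding ex using i1 i2 iQ by simp
  have inner: "(\<integral>y. indicator Q x * indicator Q y * (f y - f x)\<^sup>2 \<partial>lborel)
      = indicator Q x * b - 2 * (indicator Q x * f x) * a + (indicator Q x * (f x)\<^sup>2) * V" for x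
    unfolding ex using i1 i2 iQ mQ by (simp add: a_def b_def)
  have nn: "0 \<le> indicator Q x * b - 2 * (indicator Q x * f x) * a + (indicator Q x * (f x)\<^sup>2) * V" for x
    unfolding inner[symmetric] by simp
  have "(\<integral>\<^sup>+x. (\<integral>\<^sup>+y. ennreal (indicator Q x * indicator Q y * (f y - f x)\<^sup>2) \<partial>lborel) \<partial>lborel)
    = (\<integral>\<^sup>+x. ennreal (indicator Q x * b - 2 * (indicator Q x * f x) * a + (indicator Q x * (f x)\<^sup>2) * V) \<partial>lborel)"
    by (intro nn_integral_cong) (subst nn_integral_eq_integral[OF I], simp_all add: inner)
  also have "\<dots> = ennreal (\<integral>x. indicator Q x * b - 2 * (indicator Q x * f x) * a + (indicator Q x * (f x)\<^sup>2) * V \<partial>lborel)"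
    using nn i1 i2 iQ by (intro nn_integral_eq_integral) auto
  also have "(\<integral>x. indicator Q x * b - 2 * (indicator Q x * f x) * a + (indicator Q x * (f x)\<^sup>2) * V \<partial>lborel) = 2 * V * b - 2 * a\<^sup>2"
  proof -
    have "(\<integral>x. indicator Q x * b - 2 * (indicator Q x * f x) * a + (indicator Q x * (f x)\<^sup>2) * V \<partial>lborel) = V * b - 2 * a * a + b * V"
      using i1 i2 iQ mQ by (simp add: a_def[symmetric] b_def[symmetric])
    then show ?thesis by (simp add: power2_eq_square)
  qed
  finally show ?thesis unfolding a_def b_def .
qed

text \<open>Two points of one cube differ by a vector \<open>h\<close> with coordinates in
  \<open>[-r, r]\<close>. The double integrals over all cubes together are thus at most the integral
  of the translation estimate over these \<open>h\<close>, where the squared norm is at most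
  \<open>N * r^2\<close> and the volume is \<open>(2 * r)^N\<close>. Division by twice the volume
  \<open>r^N\<close> of a cube gives half the stated constant.\<close>

lemma gridcube_poincare:
  fixes f :: "real^'n::finite \<Rightarrow> real"
  assumes f: "f \<in> Cc_inf A" and r: "r > 0" and Z: "finite Z" "Z \<subseteq> extensional Basis"
  shows "(\<Sum>z\<in>Z. \<integral>x. indicator (gridcube r z) x * (f x)\<^sup>2 \<partial>lborel)
    \<le> r\<^sup>2 * DIM(real^'n) * 2 ^ DIM(real^'n) * enL f f
      + (\<Sum>z\<in>Z. (\<integral>x. indicator (gridcube r z) x * f x \<partial>lborel)\<^sup>2) / r ^ DIM(real^'n)"
proof -
  let ?N = "DIM(real^'n)"
  define V where "V = r ^ ?N"
  have V: "V > 0" using r by (simp add: V_def)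
  note [measurable] = Cc_inf_borel[OF f] gridcube_measure(1)[OF r]
  have e0: "enL f f \<ge> 0" by (simp add: enL_Cc_inf[OF f])
  have fi: "integrable lborel f" "integrable lborel (\<lambda>x. (f x)\<^sup>2)"
  proof -
    show "integrable lborel f"
      by (rule integrable_continuous_compact_support[OF continuous_on_Cc_inf[OF f] Cc_infD(2)[OF f] Cc_infD(4)[OF f]])
    show "integrable lborel (\<lambda>x. (f x)\<^sup>2)"
    proof (rule integrable_continuous_compact_support[OF _ Cc_infD(2)[OF f]])
      show "continuous_on UNIV (\<lambda>x. (f x)\<^sup>2)" by (intro continuous_intros continuous_on_Cc_inf[OF f])
      show "(f x)\<^sup>2 = 0" if "x \<notin> closure {x. f x \<noteq> 0}" for x by (simp add: Cc_infD(4)[OF f that])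
    qed
  qed
  define a b where "a z = (\<integral>x. indicator (gridcube r z) x * f x \<partial>lborel)" and "b z = (\<integral>x. indicator (gridcube r z) x * (f x)\<^sup>2 \<partial>lborel)" for z
  define One' where "One' = (\<Sum>b\<in>Basis. r *\<^sub>R b :: real^'n)"
  have One': "One' \<bullet> b = r" if "b \<in> Basis" for b using that by (simp add: One'_def)
  define K where "K = cbox (- One') One'"
  have var: "ennreal (2 * V * b z - 2 * (a z)\<^sup>2)
     = (\<integral>\<^sup>+x. (\<integral>\<^sup>+y. ennreal (indicator (gridcube r z) x * indicator (gridcube r z) y * (f y - f x)\<^sup>2) \<partial>lborel) \<partial>lborel)" for z
    unfolding a_def b_def V_def
    by (rule variance_identity[OF fi gridcube_measure[OF r], symmetric]) (use r in simp)
  \<comment> \<open>Since \<open>ennreal\<close> cuts negative numbers to 0, each deviation must be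
    known nonnegative before it is summed.\<close>
  have var0: "2 * V * b z - 2 * (a z)\<^sup>2 \<ge> 0" for z
  proof -
    have S: "sqint lborel f" "sqint lborel (\<lambda>x. indicator (gridcube r z) x :: real)"
      unfolding sqint_def using fi(2) gridcube_measure[OF r, of z]
      by (auto simp: power2_eq_square indicator_inter_arith[symmetric] intro!: integrable_real_indicator)
    have S': "sqint lborel (\<lambda>x. indicator (gridcube r z) x * f x)"
      unfolding sqint_def
    proof
      have "(\<lambda>x. (norm (indicator (gridcube r z) x * f x))\<^sup>2) = (\<lambda>x. indicator (gridcube r z) x *\<^sub>R (f x)\<^sup>2)"
        by (auto simp: indicator_def)
      then show "integrable lborel (\<lambda>x. (norm (indicator (gridcube r z) x * f x))\<^sup>2)"
        using integrable_mult_indicator[OF _ fi(2), of "gridcube r z"] by simp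
    qed measurable
    have e: "(\<lambda>x. (norm (indicator (gridcube r z) x * f x))\<^sup>2) = (\<lambda>x. indicator (gridcube r z) x * (f x)\<^sup>2)"
      "(\<lambda>x::real^'n. (norm (indicator (gridcube r z) x :: real))\<^sup>2) = indicator (gridcube r z)"
      "(\<lambda>x. (indicator (gridcube r z) x * f x) \<bullet> indicator (gridcube r z) x) = (\<lambda>x. indicator (gridcube r z) x * f x)"
      by (auto simp: indicator_def)
    have m: "(\<integral>x. indicator (gridcube r z) x \<partial>lborel) = V"
      using gridcube_measure[OF r, of z] r by (simp add: measure_def V_def)
    show ?thesis using L2_cauchy_schwarz[OF S' S(2)] unfolding e m a_def b_def by (simp add: mult.commute)
  qed
  \<comment> \<open>At most one cube of the family contains both points, so no increment is counted
    twice; if one does, their difference lies in \<open>K\<close>.\<close>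
  have ptw: "(\<Sum>z\<in>Z. ennreal (indicator (gridcube r z) x * indicator (gridcube r z) y * (f y - f x)\<^sup>2))
     \<le> indicator K (- x + y) * ennreal ((f y - f x)\<^sup>2)" for x y
  proof (cases "\<exists>z\<in>Z. x \<in> gridcube r z \<and> y \<in> gridcube r z")
    case True
    then obtain z where z: "z \<in> Z" "x \<in> gridcube r z" "y \<in> gridcube r z" by blast
    have bd: "\<bar>y \<bullet> b - x \<bullet> b\<bar> \<le> r" if "b \<in> Basis" for b
    proof -
      have "\<lfloor>x \<bullet> b / r\<rfloor> = \<lfloor>y \<bullet> b / r\<rfloor>" using z that by (simp add: gridcube_def)
      then have "\<bar>y \<bullet> b / r - x \<bullet> b / r\<bar> \<le> 1" by linarith
      then have "\<bar>(y \<bullet> b - x \<bullet> b) / r\<bar> \<le> 1" by (simp add: diff_divide_distrib)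
      then show ?thesis using r by (simp add: abs_divide)
    qed
    have "(- One') \<bullet> b \<le> (- x + y) \<bullet> b \<and> (- x + y) \<bullet> b \<le> One' \<bullet> b" if "b \<in> Basis" for b
      unfolding inner_add_left inner_minus_left One'[OF that] using bd[OF that] by linarith
    then have K: "- x + y \<in> K" unfolding K_def mem_box by blast
    have "x \<notin> gridcube r z'" if "z' \<in> Z" "z' \<noteq> z" for z'
    proof
      assume "x \<in> gridcube r z'"
      then have "z' b = z b" if "b \<in> Basis" for b using z that by (auto simp: gridcube_def)
      then have "z' = z" using Z(2) z(1) \<open>z' \<in> Z\<close> by (intro extensionalityI[of _ Basis]) auto
      then show False using that by simp
    qed
    then have "(\<Sum>z'\<in>Z. ennreal (indicator (gridcube r z') x * indicator (gridcube r z') y * (f y - f x)\<^sup>2))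
       = (\<Sum>z'\<in>Z. if z' = z then ennreal ((f y - f x)\<^sup>2) else 0)"
      using z by (intro sum.cong) auto
    then show ?thesis using K z Z by simp
  next
    case False
    then have "(\<Sum>z\<in>Z. ennreal (indicator (gridcube r z) x * indicator (gridcube r z) y * (f y - f x)\<^sup>2)) = 0"
      by (intro sum.neutral) (auto simp: indicator_def)
    then show ?thesis by simp
  qed
  have "ennreal (\<Sum>z\<in>Z. 2 * V * b z - 2 * (a z)\<^sup>2) = (\<Sum>z\<in>Z. ennreal (2 * V * b z - 2 * (a z)\<^sup>2))"
    using var0 by (simp add: sum_ennreal)
  also have "\<dots> = (\<integral>\<^sup>+x. (\<integral>\<^sup>+y. (\<Sum>z\<in>Z. ennreal (indicator (gridcube r z) x * indicator (gridcube r z) y * (f y - f x)\<^sup>2)) \<partial>lborel) \<partial>lborel)"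
  proof -
    have "(\<Sum>z\<in>Z. ennreal (2 * V * b z - 2 * (a z)\<^sup>2))
      = (\<integral>\<^sup>+x. (\<Sum>z\<in>Z. \<integral>\<^sup>+y. ennreal (indicator (gridcube r z) x * indicator (gridcube r z) y * (f y - f x)\<^sup>2) \<partial>lborel) \<partial>lborel)"
      unfolding var by (rule nn_integral_sum[symmetric]) measurable
    also have "\<dots> = (\<integral>\<^sup>+x. (\<integral>\<^sup>+y. (\<Sum>z\<in>Z. ennreal (indicator (gridcube r z) x * indicator (gridcube r z) y * (f y - f x)\<^sup>2)) \<partial>lborel) \<partial>lborel)"
      by (intro nn_integral_cong nn_integral_sum[symmetric]) measurable
    finally show ?thesis .
  qed
  also have "\<dots> \<le> (\<integral>\<^sup>+x. (\<integral>\<^sup>+y. indicator K (- x + y) * ennreal ((f y - f x)\<^sup>2) \<partial>lborel) \<partial>lborel)"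
    by (intro nn_integral_mono ptw)
  also have "\<dots> = (\<integral>\<^sup>+x. (\<integral>\<^sup>+h. indicator K h * ennreal ((f (x + h) - f x)\<^sup>2) \<partial>lborel) \<partial>lborel)"
  proof (rule nn_integral_cong)
    fix x
    have [measurable]: "K \<in> sets borel" by (simp add: K_def)
    have "(\<integral>\<^sup>+h. indicator K (- x + (x + h)) * ennreal ((f (x + h) - f x)\<^sup>2) \<partial>lborel)
       = (\<integral>\<^sup>+y. indicator K (- x + y) * ennreal ((f y - f x)\<^sup>2) \<partial>lborel)"
      by (rule nn_integral_lborel_shift[of "\<lambda>y. indicator K (- x + y) * ennreal ((f y - f x)\<^sup>2)"]) measurable
    then show "(\<integral>\<^sup>+y. indicator K (- x + y) * ennreal ((f y - f x)\<^sup>2) \<partial>lborel)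
       = (\<integral>\<^sup>+h. indicator K h * ennreal ((f (x + h) - f x)\<^sup>2) \<partial>lborel)" by simp
  qed
  also have "\<dots> = (\<integral>\<^sup>+h. (\<integral>\<^sup>+x. indicator K h * ennreal ((f (x + h) - f x)\<^sup>2) \<partial>lborel) \<partial>lborel)"
  proof -
    have [measurable]: "K \<in> sets borel" by (simp add: K_def)
    show ?thesis by (rule lborel_pair.Fubini') measurable
  qed
  also have "\<dots> \<le> (\<integral>\<^sup>+h. indicator K h * ennreal (?N * r\<^sup>2 * enL f f) \<partial>lborel)"
  proof (rule nn_integral_mono)
    fix h :: "real^'n"
    have "(\<integral>\<^sup>+x. indicator K h * ennreal ((f (x + h) - f x)\<^sup>2) \<partial>lborel) = indicator K h * (\<integral>\<^sup>+x. ennreal ((f (x + h) - f x)\<^sup>2) \<partial>lborel)"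
      by (rule nn_integral_cmult) measurable
    also have "\<dots> \<le> indicator K h * ennreal ((norm h)\<^sup>2 * enL f f)"
      by (intro mult_left_mono translation_estimate[OF f]) simp
    also have "\<dots> \<le> indicator K h * ennreal (?N * r\<^sup>2 * enL f f)"
    proof (cases "h \<in> K")
      case True
      have "(norm h)\<^sup>2 = (\<Sum>b\<in>Basis. (h \<bullet> b)\<^sup>2)"
        unfolding power2_norm_eq_inner by (subst euclidean_inner) (simp add: power2_eq_square)
      also have "\<dots> \<le> (\<Sum>b\<in>(Basis :: (real^'n) set). r\<^sup>2)"
      proof (rule sum_mono)
        fix b :: "real^'n" assume "b \<in> Basis"
        then have "\<bar>h \<bullet> b\<bar> \<le> r" using True One' by (auto simp: K_def mem_box abs_le_iff)
        then have "\<bar>h \<bullet> b\<bar>\<^sup>2 \<le> r\<^sup>2" by (rule power_mono) simp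
        then show "(h \<bullet> b)\<^sup>2 \<le> r\<^sup>2" by simp
      qed
      finally have "(norm h)\<^sup>2 * enL f f \<le> ?N * r\<^sup>2 * enL f f" using e0 by (intro mult_right_mono) simp_all
      then show ?thesis by (intro mult_left_mono ennreal_leI) simp_all
    qed simp
    finally show "(\<integral>\<^sup>+x. indicator K h * ennreal ((f (x + h) - f x)\<^sup>2) \<partial>lborel) \<le> indicator K h * ennreal (?N * r\<^sup>2 * enL f f)" .
  qed
  also have "\<dots> = emeasure lborel K * ennreal (?N * r\<^sup>2 * enL f f)"
    by (subst nn_integral_multc) (simp_all add: K_def)
  also have "emeasure lborel K = ennreal ((2 * r) ^ ?N)"
  proof -
    have "(One' - - One') \<bullet> b = 2 * r" if "b \<in> Basis" for b
      unfolding inner_diff_left inner_minus_left One'[OF that] by simp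
    then have "(\<Prod>b\<in>Basis. (One' - - One') \<bullet> b) = (\<Prod>b\<in>(Basis :: (real^'n) set). 2 * r)"
      by (intro prod.cong[OF refl])
    also have "\<dots> = (2 * r) ^ ?N" by (rule prod_constant)
    finally have 1: "(\<Prod>b\<in>Basis. (One' - - One') \<bullet> b) = (2 * r) ^ ?N" .
    have 2: "\<forall>b\<in>Basis. - One' \<bullet> b \<le> One' \<bullet> b" using One' r by simp
    show ?thesis unfolding K_def emeasure_lborel_cbox_eq if_P[OF 2] by (rule arg_cong[OF 1])
  qed
  also have "ennreal ((2 * r) ^ ?N) * ennreal (?N * r\<^sup>2 * enL f f) = ennreal ((2 * r) ^ ?N * (?N * r\<^sup>2 * enL f f))"
    using r e0 by (simp add: ennreal_mult)
  finally have "(\<Sum>z\<in>Z. 2 * V * b z - 2 * (a z)\<^sup>2) \<le> (2 * r) ^ ?N * (?N * r\<^sup>2 * enL f f)"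
    using e0 r by (subst (asm) ennreal_le_iff) simp_all
  also have "(2 * r) ^ ?N = 2 ^ ?N * V" by (simp add: V_def power_mult_distrib)
  finally have "2 * V * (\<Sum>z\<in>Z. b z) - 2 * (\<Sum>z\<in>Z. (a z)\<^sup>2) \<le> 2 ^ ?N * V * (?N * r\<^sup>2 * enL f f)"
    by (simp add: sum_subtractf sum_distrib_left)
  then have "2 * V * (\<Sum>z\<in>Z. b z) \<le> 2 * V * (r\<^sup>2 * ?N * 2 ^ ?N * enL f f + (\<Sum>z\<in>Z. (a z)\<^sup>2) / V)"
  proof -
    assume *: "2 * V * (\<Sum>z\<in>Z. b z) - 2 * (\<Sum>z\<in>Z. (a z)\<^sup>2) \<le> 2 ^ ?N * V * (?N * r\<^sup>2 * enL f f)"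
    have "0 \<le> V * (r\<^sup>2 * ?N * 2 ^ ?N * enL f f)" using V e0 by simp
    moreover have "2 ^ ?N * V * (?N * r\<^sup>2 * enL f f) = V * (r\<^sup>2 * ?N * 2 ^ ?N * enL f f)" by (simp add: mult_ac)
    moreover have "2 * V * (r\<^sup>2 * ?N * 2 ^ ?N * enL f f + (\<Sum>z\<in>Z. (a z)\<^sup>2) / V)
       = 2 * (V * (r\<^sup>2 * ?N * 2 ^ ?N * enL f f)) + 2 * (\<Sum>z\<in>Z. (a z)\<^sup>2)"
      using V by (simp add: field_simps)
    ultimately show ?thesis using * by linarith
  qed
  then have "(\<Sum>z\<in>Z. b z) \<le> r\<^sup>2 * ?N * 2 ^ ?N * enL f f + (\<Sum>z\<in>Z. (a z)\<^sup>2) / V" using V by simp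
  then show ?thesis unfolding a_def b_def V_def .
qed

lemma gridcube_lmeasurable: "r > 0 \<Longrightarrow> gridcube r z \<in> lmeasurable"
  for z :: "'a::euclidean_space \<Rightarrow> int"
  using gridcube_measure[of r z] by (intro fmeasurableI) auto

lemma bounded_gridcover:
  fixes B :: "'a::euclidean_space set"
  assumes B: "bounded B" and r: "r > 0"
  shows "\<exists>Z. finite Z \<and> Z \<subseteq> extensional Basis \<and> B \<subseteq> (\<Union>z\<in>Z. gridcube r z)"
proof -
  obtain R where R: "\<And>x. x \<in> B \<Longrightarrow> norm x \<le> R" using B unfolding bounded_iff by blast
  define L where "L = \<lceil>R / r\<rceil> + 1"
  define Z where "Z = (PiE Basis (\<lambda>_. {- L..L}) :: ('a \<Rightarrow> int) set)"
  have "x \<in> (\<Union>z\<in>Z. gridcube r z)" if x: "x \<in> B" for x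
  proof -
    let ?z = "restrict (\<lambda>b. \<lfloor>x \<bullet> b / r\<rfloor>) Basis"
    have "\<lfloor>x \<bullet> b / r\<rfloor> \<in> {- L..L}" if b: "b \<in> Basis" for b
    proof -
      have "\<bar>x \<bullet> b\<bar> \<le> R" using Basis_le_norm[OF b, of x] R[OF x] by simp
      then have "\<bar>x \<bullet> b / r\<bar> \<le> R / r" using r by (simp add: abs_divide divide_right_mono)
      then have "- (R / r) \<le> x \<bullet> b / r" "x \<bullet> b / r \<le> R / r" by linarith+
      then show ?thesis unfolding L_def by (simp; linarith)
    qed
    then have "?z \<in> Z" unfolding Z_def by auto
    moreover have "x \<in> gridcube r ?z" by (simp add: gridcube_def)
    ultimately show ?thesis by blast
  qed
  moreover have "finite Z" unfolding Z_def by (intro finite_PiE) auto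
  moreover have "Z \<subseteq> extensional Basis" unfolding Z_def by (auto simp: PiE_def)
  ultimately show ?thesis by blast
qed

text \<open>Rellich's theorem as an inequality with an arbitrarily small multiple of the energy. The
  test functions live on the whole space: \<open>B\<close> will be a bounded piece of a domain, on
  whose boundary they need not vanish.\<close>

lemma local_rellich:
  fixes B :: "(real^'n::finite) set"
  assumes B: "bounded B" "B \<in> sets lebesgue" and \<epsilon>: "\<epsilon> > 0"
  shows "\<exists>M g C. (\<forall>i<M. sob.functional (g i)) \<and> C \<ge> 0 \<and>
    (\<forall>u\<in>Cc_inf (UNIV :: (real^'n) set). (\<integral>x. indicator B x * (u x)\<^sup>2 \<partial>lebesgue) \<le> \<epsilon> * enL u u + C * (\<Sum>i<(M::nat). (g i u)\<^sup>2))"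
proof -
  let ?N = "DIM(real^'n)"
  \<comment> \<open>The edge for which the Poincare constant \<open>r\<^sup>2 * N * 2 ^ N\<close> of
    the grid equals \<open>\<epsilon>\<close>.\<close>
  define r where "r = sqrt (\<epsilon> / (real ?N * 2 ^ ?N))"
  have D: "real ?N * 2 ^ ?N > 0" by simp
  then have r: "r > 0" using \<epsilon> unfolding r_def by (intro real_sqrt_gt_zero divide_pos_pos)
  have "r\<^sup>2 = \<epsilon> / (real ?N * 2 ^ ?N)" using \<epsilon> unfolding r_def by simp
  then have r2: "r\<^sup>2 * ?N * 2 ^ ?N = \<epsilon>" using D by (simp add: field_simps)
  obtain Z where Z: "finite Z" "Z \<subseteq> extensional Basis" "B \<subseteq> (\<Union>z\<in>Z. gridcube r z)"
    using bounded_gridcover[OF B(1) r] by blast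
  obtain e where e: "bij_betw e {0..<card Z} Z" using ex_bij_betw_nat_finite[OF Z(1)] by blast
  define g where "g i u = (\<integral>x. indicator (gridcube r (e i)) x * u x \<partial>lebesgue)" for i and u :: "real^'n \<Rightarrow> real"
  show ?thesis
  proof (intro exI[of _ "card Z"] exI[of _ g] exI[of _ "1 / r ^ ?N"] conjI allI impI ballI)
    show "sob.functional (g i)" for i
      unfolding g_def by (rule functional_set_integral[OF gridcube_lmeasurable[OF r]])
    show "0 \<le> 1 / r ^ ?N" using r by simp
    fix u :: "real^'n \<Rightarrow> real" assume u: "u \<in> Cc_inf UNIV"
    note [measurable] = Cc_inf_borel(1)[OF u] gridcube_measure(1)[OF r]
    have i: "integrable lebesgue (\<lambda>x. (u x)\<^sup>2)" using sqintD(2)[OF Cc_inf_sqint(1)[OF u]] by simp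
    have iQ: "integrable lebesgue (\<lambda>x. indicator (gridcube r z) x * (u x)\<^sup>2)" for z
      using integrable_mult_indicator[OF _ i, of "gridcube r z"] gridcube_lmeasurable[OF r, of z] by auto
    have "(\<integral>x. indicator B x * (u x)\<^sup>2 \<partial>lebesgue) \<le> (\<integral>x. (\<Sum>z\<in>Z. indicator (gridcube r z) x * (u x)\<^sup>2) \<partial>lebesgue)"
    proof (rule integral_mono)
      show "integrable lebesgue (\<lambda>x. indicator B x * (u x)\<^sup>2)"
        using integrable_mult_indicator[OF B(2) i] by simp
      show "integrable lebesgue (\<lambda>x. \<Sum>z\<in>Z. indicator (gridcube r z) x * (u x)\<^sup>2)" using iQ by auto
      fix x
      show "indicator B x * (u x)\<^sup>2 \<le> (\<Sum>z\<in>Z. indicator (gridcube r z) x * (u x)\<^sup>2)"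
      proof (cases "x \<in> B")
        case True
        then obtain z where "z \<in> Z" "x \<in> gridcube r z" using Z(3) by blast
        then show ?thesis
          using True member_le_sum[of z Z "\<lambda>z. indicator (gridcube r z) x * (u x)\<^sup>2"] Z(1) by simp
      qed (simp add: sum_nonneg)
    qed
    also have "\<dots> = (\<Sum>z\<in>Z. \<integral>x. indicator (gridcube r z) x * (u x)\<^sup>2 \<partial>lebesgue)"
      using iQ by (intro Bochner_Integration.integral_sum) auto
    also have "\<dots> = (\<Sum>z\<in>Z. \<integral>x. indicator (gridcube r z) x * (u x)\<^sup>2 \<partial>lborel)"
      by (intro sum.cong refl integral_lebesgue_lborel) measurable
    also have "\<dots> \<le> \<epsilon> * enL u u + (\<Sum>z\<in>Z. (\<integral>x. indicator (gridcube r z) x * u x \<partial>lborel)\<^sup>2) / r ^ ?N"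
      using gridcube_poincare[OF u r Z(1,2)] unfolding r2 .
    also have "(\<Sum>z\<in>Z. (\<integral>x. indicator (gridcube r z) x * u x \<partial>lborel)\<^sup>2) = (\<Sum>z\<in>Z. (\<integral>x. indicator (gridcube r z) x * u x \<partial>lebesgue)\<^sup>2)"
      by (intro sum.cong refl arg_cong[where f = "\<lambda>x. x\<^sup>2"] integral_lebesgue_lborel[symmetric]) measurable
    also have "\<dots> = (\<Sum>i<card Z. (g i u)\<^sup>2)"
      unfolding g_def lessThan_atLeast0
      by (rule sum.reindex_bij_betw[OF e, symmetric])
    finally show "(\<integral>x. indicator B x * (u x)\<^sup>2 \<partial>lebesgue) \<le> \<epsilon> * enL u u + 1 / r ^ ?N * (\<Sum>i<card Z. (g i u)\<^sup>2)"
      by simp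
  qed
qed

text \<open>The energy is divided: the share \<open>1 - \<delta>\<close> pays for the mass off
  \<open>B\<close> through the tail bound, the share \<open>\<delta>\<close> for the mass in
  \<open>B\<close> through the local estimate, which also supplies the functionals.\<close>

lemma coercive_of_tail:
  fixes A B :: "(real^'n::finite) set"
  assumes B: "bounded B" "B \<in> sets lebesgue" and A: "A \<in> sets lebesgue" and "\<mu> < \<E>" "\<E> \<ge> 0"
    and tail: "\<And>u. u \<in> Cc_inf A \<Longrightarrow> \<E> * (\<integral>x. indicator (A - B) x * (u x)\<^sup>2 \<partial>lebesgue) \<le> enL u u"
  shows "sob.coercive (W0 A) \<mu>"
proof -
  \<comment> \<open>Chosen with \<open>\<mu> \<le> (1 - \<delta>) * \<E>\<close>. If
    \<open>\<E> = 0\<close> then \<open>\<mu>\<close> is negative and any share strictly between 0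
    and 1 does.\<close>
  define \<delta> where "\<delta> = (if \<E> = 0 then 1/2 else min (1/2) ((\<E> - \<mu>) / \<E>))"
  have \<delta>: "0 < \<delta>" "\<delta> < 1" "\<mu> \<le> (1 - \<delta>) * \<E>"
    using assms(4,5) by (auto simp: \<delta>_def min_def field_simps)
  \<comment> \<open>Makes \<open>\<bar>\<mu>\<bar> * \<epsilon> \<le> \<delta>\<close>; the summand
    1 avoids dividing by 0 when \<open>\<mu> = 0\<close>.\<close>
  define \<epsilon> where "\<epsilon> = \<delta> / (\<bar>\<mu>\<bar> + 1)"
  have \<epsilon>: "\<epsilon> > 0" "\<bar>\<mu>\<bar> * \<epsilon> \<le> \<delta>"
    using \<delta>(1) by (auto simp: \<epsilon>_def field_simps)
  obtain M g C where g: "\<And>i. i < M \<Longrightarrow> sob.functional (g i)" and C: "C \<ge> 0" and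
    R: "\<And>u. u \<in> Cc_inf (UNIV :: (real^'n) set) \<Longrightarrow> (\<integral>x. indicator B x * (u x)\<^sup>2 \<partial>lebesgue) \<le> \<epsilon> * enL u u + C * (\<Sum>i<(M::nat). (g i u)\<^sup>2)"
    using local_rellich[OF B \<epsilon>(1)] by blast
  show ?thesis
  proof (rule sob.coercive_dense[where D = "Cc_inf A" and f = g and C = "\<bar>\<mu>\<bar> * C" and M = M])
    show "W0 A \<subseteq> W0 UNIV" by (rule W0_mono) simp
    then show "Cc_inf A \<subseteq> W0 UNIV" using Cc_inf_subset_W0 by blast
    show "\<exists>\<phi>. (\<forall>k. \<phi> k \<in> Cc_inf A) \<and> sob.conv \<phi> u" if "u \<in> W0 A" for u by (rule W0_dense[OF that])
    show "sob.functional (g i)" if "i < M" for i by (rule g[OF that])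
    show "0 \<le> \<bar>\<mu>\<bar> * C" using C by simp
    fix u assume u: "u \<in> Cc_inf A"
    have uU: "u \<in> Cc_inf UNIV" using u Cc_inf_mono[of A UNIV] by auto
    have e0: "enL u u \<ge> 0" by (simp add: enL_Cc_inf[OF u])
    have i: "integrable lebesgue (\<lambda>x. (u x)\<^sup>2)" using sqintD(2)[OF Cc_inf_sqint(1)[OF u]] by simp
    define t where "t = (\<integral>x. indicator (A - B) x * (u x)\<^sup>2 \<partial>lebesgue)"
    define l where "l = (\<integral>x. indicator B x * (u x)\<^sup>2 \<partial>lebesgue)"
    have t0: "t \<ge> 0" by (simp add: t_def)
    have iB: "integrable lebesgue (\<lambda>x. indicator B x * (u x)\<^sup>2)" using integrable_mult_indicator[OF B(2) i] by simp
    have iT: "integrable lebesgue (\<lambda>x. indicator (A - B) x * (u x)\<^sup>2)"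
      using integrable_mult_indicator[OF sets.Diff[OF A B(2)] i] by simp
    have "ipL u u = (\<integral>x. indicator (A - B) x * (u x)\<^sup>2 + indicator B x * (u x)\<^sup>2 \<partial>lebesgue)"
      unfolding ipL_def using Cc_infD(5)[OF u]
      by (intro Bochner_Integration.integral_cong) (auto simp: indicator_def power2_eq_square)
    also have "\<dots> = t + l" unfolding t_def l_def using iT iB by simp
    finally have N: "ipL u u = t + l" .
    have "\<mu> * t \<le> (1 - \<delta>) * \<E> * t" using \<delta>(3) t0 by (rule mult_right_mono)
    also have "\<dots> \<le> (1 - \<delta>) * enL u u"
      using mult_left_mono[OF tail[OF u], of "1 - \<delta>"] \<delta> by (simp add: t_def mult.assoc)
    finally have 1: "\<mu> * t \<le> (1 - \<delta>) * enL u u" .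
    have l0: "l \<ge> 0" by (simp add: l_def)
    have "\<mu> * l \<le> \<bar>\<mu>\<bar> * l" using l0 by (intro mult_right_mono) auto
    also have "\<dots> \<le> \<bar>\<mu>\<bar> * (\<epsilon> * enL u u + C * (\<Sum>i<M. (g i u)\<^sup>2))"
      using R[OF uU] by (intro mult_left_mono) (auto simp: l_def)
    also have "\<dots> = \<bar>\<mu>\<bar> * \<epsilon> * enL u u + \<bar>\<mu>\<bar> * C * (\<Sum>i<M. (g i u)\<^sup>2)" by (simp add: distrib_left mult.assoc)
    also have "\<bar>\<mu>\<bar> * \<epsilon> * enL u u \<le> \<delta> * enL u u" using \<epsilon>(2) e0 by (rule mult_right_mono)
    finally have 2: "\<mu> * l \<le> \<delta> * enL u u + \<bar>\<mu>\<bar> * C * (\<Sum>i<M. (g i u)\<^sup>2)" by simp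
    show "\<mu> * ipL u u \<le> enL u u + \<bar>\<mu>\<bar> * C * (\<Sum>i<M. (g i u)\<^sup>2)"
      using 1 2 unfolding N by (simp add: algebra_simps)
  qed
qed

section \<open>Cylindrical coordinates\<close>

text \<open>Uniqueness of translation invariant measures, in the form of Weil's convolution trick with the indicator
  of the unit ball, which an isometry fixing the origin leaves invariant.\<close>
lemma nn_integral_linear_isometry:
  fixes f :: "'a::euclidean_space \<Rightarrow> ennreal" and R :: "'a \<Rightarrow> 'a"
  assumes lin: "linear R" and iso: "\<And>x. norm (R x) = norm x" and onto: "\<And>y. \<exists>x. R x = y"
    and [measurable]: "f \<in> borel_measurable borel"
  shows "(\<integral>\<^sup>+x. f (R x) \<partial>lborel) = (\<integral>\<^sup>+x. f x \<partial>lborel)"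
proof -
  have [measurable]: "R \<in> borel_measurable borel"
    using linear_continuous_on[OF linear_conv_bounded_linear[THEN iffD1, OF lin]] by (intro borel_measurable_continuous_onI)
  define g where "g = (indicator (ball 0 1) :: 'a \<Rightarrow> ennreal)"
  have [measurable]: "g \<in> borel_measurable borel" unfolding g_def by (rule borel_measurable_indicator) simp
  have gR: "g (- R x) = g x" for x by (simp add: g_def indicator_def iso)
  have gi: "(\<integral>\<^sup>+x. g x \<partial>lborel) = emeasure lborel (ball 0 1 :: 'a set)" by (simp add: g_def)
  \<comment> \<open>The mass of the ball is neither 0 nor infinite, so it can be cancelled at the
    end.\<close>
  have g: "(\<integral>\<^sup>+x. g x \<partial>lborel) \<noteq> 0" "(\<integral>\<^sup>+x. g x \<partial>lborel) \<noteq> \<infinity>"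
  proof -
    have "\<not> negligible (ball 0 1 :: 'a set)" by (intro open_not_negligible) auto
    then show "(\<integral>\<^sup>+x. g x \<partial>lborel) \<noteq> 0"
      unfolding gi negligible_iff_null_sets by (auto simp: null_sets_def)
    show "(\<integral>\<^sup>+x. g x \<partial>lborel) \<noteq> \<infinity>"
      unfolding gi using emeasure_bounded_finite[of "ball 0 1 :: 'a set"] by simp
  qed
  have a1: "(\<integral>\<^sup>+y. f (R x) * g (- R x + y) \<partial>lborel) = f (R x) * (\<integral>\<^sup>+y. g y \<partial>lborel)" for x
    by (subst nn_integral_cmult, measurable) (subst nn_integral_lborel_shift[of g], simp_all)
  have a2: "(\<integral>\<^sup>+y. f (R x + y) * g x \<partial>lborel) = (\<integral>\<^sup>+y. f y \<partial>lborel) * g x" for x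
    by (subst nn_integral_multc, measurable) (subst nn_integral_lborel_shift[of f], simp_all)
  have "(\<integral>\<^sup>+x. f (R x) \<partial>lborel) * (\<integral>\<^sup>+x. g x \<partial>lborel) = (\<integral>\<^sup>+x. (\<integral>\<^sup>+y. f (R x) * g (- R x + y) \<partial>lborel) \<partial>lborel)"
    unfolding a1 by (rule nn_integral_multc[symmetric]) measurable
  also have "\<dots> = (\<integral>\<^sup>+y. (\<integral>\<^sup>+x. f (R x) * g (- R x + y) \<partial>lborel) \<partial>lborel)"
    by (rule lborel_pair.Fubini'[symmetric]) measurable
  also have "\<dots> = (\<integral>\<^sup>+y. (\<integral>\<^sup>+x. f (R x + y) * g x \<partial>lborel) \<partial>lborel)"
  proof (rule nn_integral_cong)
    fix y
    \<comment> \<open>Translating \<open>x\<close> by the preimage \<open>z\<close> of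
      \<open>y\<close> moves \<open>y\<close> from the argument of \<open>g\<close> to that of
      \<open>f\<close>, and then \<open>g (- R x) = g x\<close>.\<close>
    obtain z where z: "R z = y" using onto by blast
    have "(\<integral>\<^sup>+x. f (R x) * g (- R x + y) \<partial>lborel) = (\<integral>\<^sup>+x. f (R (z + x)) * g (- R (z + x) + y) \<partial>lborel)"
      by (rule nn_integral_lborel_shift[of "\<lambda>x. f (R x) * g (- R x + y)", symmetric]) measurable
    then show "(\<integral>\<^sup>+x. f (R x) * g (- R x + y) \<partial>lborel) = (\<integral>\<^sup>+x. f (R x + y) * g x \<partial>lborel)"
      by (simp add: linear_add[OF lin] z gR add.commute)
  qed
  also have "\<dots> = (\<integral>\<^sup>+x. (\<integral>\<^sup>+y. f (R x + y) * g x \<partial>lborel) \<partial>lborel)"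
    by (rule lborel_pair.Fubini') measurable
  also have "\<dots> = (\<integral>\<^sup>+x. f x \<partial>lborel) * (\<integral>\<^sup>+x. g x \<partial>lborel)"
    unfolding a2 by (rule nn_integral_cmult) measurable
  finally have "(\<integral>\<^sup>+x. g x \<partial>lborel) * (\<integral>\<^sup>+x. f (R x) \<partial>lborel) = (\<integral>\<^sup>+x. g x \<partial>lborel) * (\<integral>\<^sup>+x. f x \<partial>lborel)"
    by (simp only: mult.commute)
  then show ?thesis using g unfolding ennreal_mult_cancel_left infinity_ennreal_def by blast
qed

lemma prod_Basis_vec: "(\<Prod>b\<in>Basis. f b) = (\<Prod>i\<in>UNIV. f (axis i 1))"
  for f :: "real^'n::finite \<Rightarrow> real"
proof -
  have B: "(Basis :: (real^'n) set) = range (\<lambda>i. axis i 1)" by (auto simp: Basis_vec_def)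
  have "inj (\<lambda>i::'n. axis i (1::real))" by (simp add: inj_on_def axis_eq_axis)
  then show ?thesis unfolding B by (subst prod.reindex) simp_all
qed

lemma mem_box_vec: "x \<in> box l u \<longleftrightarrow> (\<forall>i. l $ i < x $ i \<and> x $ i < u $ i)"
  for x :: "real^'n::finite"
  by (simp add: mem_box_cart)

section \<open>Separating the axis coordinate\<close>

lemma emb_nth [simp]: "emb y s $ None = s" "emb y s $ Some b = y $ b"
  by (simp_all add: emb_def)

lemma inner_option: "x \<bullet> y = (x $ None) * (y $ None) + (\<Sum>b\<in>UNIV. x $ Some b * y $ Some b)"
  for x y :: "real^('m::finite option)"
  by (simp add: inner_vec_def UNIV_option_conv sum.reindex)

definition cross :: "real^('m::finite option) \<Rightarrow> real^'m" where
  "cross x = (\<chi> b. x $ Some b)"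

lemma cross_nth [simp]: "cross x $ b = x $ Some b" by (simp add: cross_def)

lemma emb_cross: "emb (cross x) (x $ None) = x"
  by (simp add: vec_eq_iff emb_def split: option.split)

lemma cross_emb [simp]: "cross (emb y s) = y" by (simp add: vec_eq_iff)

lemma norm_cross_le: "norm (cross x) \<le> norm x"
proof -
  have "(norm (cross x))\<^sup>2 \<le> (norm x)\<^sup>2"
    unfolding power2_norm_eq_inner inner_option[of x] by (simp add: inner_vec_def)
  then show ?thesis by (simp add: power2_le_iff_abs_le)
qed

lemma continuous_on_cross: "continuous_on S cross"
  unfolding cross_def[abs_def] by (intro continuous_intros)

lemma continuous_on_emb: 
  assumes "continuous_on S f" "continuous_on S g" shows "continuous_on S (\<lambda>x. emb (f x) (g x))"
  unfolding emb_def[abs_def]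
proof (rule continuous_on_vec_lambda)
  show "continuous_on S (\<lambda>x. case a of None \<Rightarrow> g x | Some b \<Rightarrow> f x $ b)" for a
    using assms by (cases a) (auto intro: continuous_intros)
qed

lemma borel_measurable_emb [measurable]: "(\<lambda>(y, s). emb y s) \<in> borel_measurable borel"
proof -
  have "continuous_on UNIV (\<lambda>p. emb (fst p) (snd p))" by (intro continuous_on_emb continuous_intros)
  then show ?thesis unfolding case_prod_beta' by (rule borel_measurable_continuous_onI)
qed

lemma lborel_emb: "distr (lborel \<Otimes>\<^sub>M lborel) borel (\<lambda>(y, s). emb y s) = (lborel :: (real^('m::finite option)) measure)"
proof (rule lborel_eqI[symmetric])
  fix l u :: "real^('m option)"
  assume lu: "\<And>b. b \<in> Basis \<Longrightarrow> l \<bullet> b \<le> u \<bullet> b"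
  have le: "l $ i \<le> u $ i" for i using lu[of "axis i 1"] by (simp add: inner_axis)
  have pre: "(\<lambda>(y, s). emb y s) -` box l u = box (cross l) (cross u) \<times> box (l $ None) (u $ None)"
    by (auto simp: mem_box_vec split_option_all mem_box)
  have "emeasure (distr (lborel \<Otimes>\<^sub>M lborel) borel (\<lambda>(y, s). emb y s)) (box l u)
     = emeasure (lborel \<Otimes>\<^sub>M lborel) (box (cross l) (cross u) \<times> box (l $ None) (u $ None))"
    by (subst emeasure_distr) (simp_all add: lborel_prod pre space_pair_measure)
  also have "\<dots> = emeasure lborel (box (cross l) (cross u)) * emeasure lborel (box (l $ None) (u $ None))"
    by (rule lborel.emeasure_pair_measure_Times) auto
  also have "emeasure lborel (box (l $ None) (u $ None)) = ennreal (u $ None - l $ None)"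
    using le by (simp add: box_real)
  also have "emeasure lborel (box (cross l) (cross u)) = ennreal (\<Prod>b\<in>UNIV. u $ Some b - l $ Some b)"
  proof -
    have c: "(\<Prod>b\<in>Basis. (cross u - cross l) \<bullet> b) = (\<Prod>b\<in>UNIV. u $ Some b - l $ Some b)"
      unfolding prod_Basis_vec by (simp add: inner_axis)
    have leB: "cross l \<bullet> b \<le> cross u \<bullet> b" if "b \<in> Basis" for b
      using le that by (auto simp: Basis_vec_def inner_axis)
    have "emeasure lborel (box (cross l) (cross u)) = ennreal (\<Prod>b\<in>Basis. (cross u - cross l) \<bullet> b)"
      by (rule emeasure_lborel_box[OF leB])
    then show ?thesis unfolding c .
  qed
  also have "ennreal (\<Prod>b\<in>UNIV. u $ Some b - l $ Some b) * ennreal (u $ None - l $ None) = ennreal (\<Prod>i\<in>UNIV. u $ i - l $ i)"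
    using le by (simp add: UNIV_option_conv prod.reindex ennreal_mult[symmetric] prod_nonneg mult.commute)
  also have "(\<Prod>i\<in>UNIV. u $ i - l $ i) = (\<Prod>b\<in>Basis. (u - l) \<bullet> b)" by (simp add: prod_Basis_vec inner_axis)
  finally show "emeasure (distr (lborel \<Otimes>\<^sub>M lborel) borel (\<lambda>(y, s). emb y s)) (box l u) = ennreal (\<Prod>b\<in>Basis. (u - l) \<bullet> b)" .
qed simp

lemma orthogonal_matrix_vector:
  fixes R :: "real^'n::finite^'n"
  assumes "orthogonal_matrix R"
  shows "transpose R *v (R *v x) = x" "R *v (transpose R *v x) = x" "norm (R *v x) = norm x"
    "(R *v x) \<bullet> y = x \<bullet> (transpose R *v y)" "norm (transpose R *v x) = norm x"
proof -
  show 1: "transpose R *v (R *v x) = x" and 2: "R *v (transpose R *v x) = x" for x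
    using assms unfolding orthogonal_matrix_def by (simp_all only: matrix_vector_mul_assoc matrix_vector_mul_lid)
  show adj: "(R *v x) \<bullet> y = x \<bullet> (transpose R *v y)" for x y
    by (metis dot_lmul_matrix inner_commute transpose_matrix_vector vector_transpose_matrix)
  show n: "norm (R *v x) = norm x" for x
    by (simp only: norm_eq_sqrt_inner adj 1)
  show "norm (transpose R *v x) = norm x" using n[of "transpose R *v x"] by (simp only: 2)
qed

text \<open>Translation, isometry and product structure, with the axis variable outermost: the inner
  integrals are those of the slices, to which the cross-sectional eigenvalue applies.\<close>

lemma nn_integral_cylinder_coordinates:
  fixes g :: "real^('m::finite option) \<Rightarrow> ennreal"
  assumes R: "orthogonal_matrix R" and [measurable]: "g \<in> borel_measurable borel"
  shows "(\<integral>\<^sup>+x. g x \<partial>lborel) = (\<integral>\<^sup>+s. (\<integral>\<^sup>+y. g (R *v emb y s + t) \<partial>lborel) \<partial>lborel)"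
proof -
  have mR[measurable]: "(\<lambda>x. R *v x) \<in> borel_measurable borel"
    by (intro borel_measurable_continuous_onI linear_continuous_on matrix_vector_mul_bounded_linear)
  have "(\<integral>\<^sup>+x. g x \<partial>lborel) = (\<integral>\<^sup>+x. g (t + x) \<partial>lborel)"
    by (rule nn_integral_lborel_shift[symmetric]) measurable
  also have "\<dots> = (\<integral>\<^sup>+x. g (t + R *v x) \<partial>lborel)"
    by (rule nn_integral_linear_isometry[where R = "\<lambda>x. R *v x" and f = "\<lambda>x. g (t + x)", symmetric])
       (use orthogonal_matrix_vector[OF R] in \<open>auto intro: matrix_vector_mul_linear\<close>)
  also have "\<dots> = (\<integral>\<^sup>+x. g (t + R *v x) \<partial>(distr (lborel \<Otimes>\<^sub>M lborel) borel (\<lambda>(y, s). emb y s)))"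
    by (simp add: lborel_emb)
  also have "\<dots> = (\<integral>\<^sup>+p. g (t + R *v (case p of (y, s) \<Rightarrow> emb y s)) \<partial>(lborel \<Otimes>\<^sub>M lborel))"
    by (rule nn_integral_distr) (simp_all add: lborel_prod)
  also have "\<dots> = (\<integral>\<^sup>+s. (\<integral>\<^sup>+y. g (t + R *v (case (y, s) of (y, s) \<Rightarrow> emb y s)) \<partial>lborel) \<partial>lborel)"
    by (rule lborel_pair.nn_integral_snd[symmetric]) (simp add: lborel_prod)
  finally show ?thesis by (simp add: add.commute)
qed

section \<open>Rayleigh quotients on cylindrical ends\<close>

lemma Cc_inf_nn_integral_square:
  assumes "f \<in> Cc_inf A"
  shows "(\<integral>\<^sup>+x. ennreal ((f x)\<^sup>2) \<partial>lborel) = ennreal (ipL f f)"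
proof -
  have i: "integrable lebesgue (\<lambda>x. (f x)\<^sup>2)" using sqintD(2)[OF Cc_inf_sqint(1)[OF assms]] by simp
  have "(\<integral>\<^sup>+x. ennreal ((f x)\<^sup>2) \<partial>lborel) = (\<integral>\<^sup>+x. ennreal ((f x)\<^sup>2) \<partial>lebesgue)"
    by (simp add: nn_integral_completion)
  also have "\<dots> = ennreal (\<integral>x. (f x)\<^sup>2 \<partial>lebesgue)" using i by (intro nn_integral_eq_integral) auto
  finally show ?thesis by (simp add: ipL_def power2_eq_square)
qed

text \<open>The line spanned by \<open>v\<close> competes in the min-max; a function of mass 0 spans
  nothing and is treated apart.\<close>

lemma lam_1_rayleigh:
  assumes A: "A \<in> sets lebesgue" and v: "v \<in> W0 A"
  shows "lam 1 A * ipL v v \<le> enL v v"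
proof -
  have vU: "v \<in> W0 UNIV" using v W0_mono[of A UNIV] by auto
  have nn: "ipL v v \<ge> 0" "enL v v \<ge> 0" by (rule sob.ip.nonneg[OF vU], rule sob.en.nonneg[OF vU])
  show ?thesis
  proof (cases "ipL v v = 0")
    case True
    then show ?thesis using nn by simp
  next
    case False
    then have pos: "ipL v v > 0" using nn by simp
    have c1: "(\<lambda>x. \<Sum>i<1::nat. c i * v x) = (\<lambda>x. c 0 * v x)" for c by simp
    have "sob.minmax 1 (W0 A) \<le> enL v v / ipL v v"
    proof (rule sob.minmax_le[OF W0_subsp, where \<phi> = "\<lambda>_. v"])
      show "sob.indep 1 (\<lambda>_. v)"
        unfolding sob.indep_def c1 sob.ip.square_scale[OF vU] using pos by auto
      show "enL (\<lambda>x. \<Sum>i<1. c i * v x) (\<lambda>x. \<Sum>i<1. c i * v x)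
        \<le> enL v v / ipL v v * ipL (\<lambda>x. \<Sum>i<1. c i * v x) (\<lambda>x. \<Sum>i<1. c i * v x)" for c :: "nat \<Rightarrow> real"
        unfolding c1 sob.ip.square_scale[OF vU] sob.en.square_scale[OF vU] using pos by simp
    qed (use v in simp_all)
    then show ?thesis using pos unfolding lam_eq[OF A] by (simp add: field_simps)
  qed
qed

section \<open>Slices of test functions across a cylinder\<close>

definition coord :: "real^'n^'n \<Rightarrow> real^'n \<Rightarrow> real^'n \<Rightarrow> real^'n" where
  "coord R t x = transpose R *v (x - t)"

lemma coord_inverse:
  fixes R :: "real^'n::finite^'n"
  assumes "orthogonal_matrix R"
  shows "coord R t (R *v z + t) = z" "R *v coord R t x + t = x" "norm (coord R t x) = norm (x - t)"
proof -
  show "coord R t (R *v z + t) = z"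
    unfolding coord_def add_diff_cancel_right' by (rule orthogonal_matrix_vector(1)[OF assms])
  show "R *v coord R t x + t = x"
    unfolding coord_def orthogonal_matrix_vector(2)[OF assms] by (rule diff_add_cancel)
  show "norm (coord R t x) = norm (x - t)"
    unfolding coord_def by (rule orthogonal_matrix_vector(5)[OF assms])
qed

lemma continuous_on_coord: "continuous_on S (coord R t)"
  for R :: "real^'n::finite^'n"
  unfolding coord_def[abs_def]
  by (intro bounded_linear.continuous_on[OF matrix_vector_mul_bounded_linear] continuous_intros)

lemma continuous_on_chart: "continuous_on S f \<Longrightarrow> continuous_on S (\<lambda>y. R *v f y + t)"
  for R :: "real^'n::finite^'n"
  by (intro continuous_on_add bounded_linear.continuous_on[OF matrix_vector_mul_bounded_linear] continuous_on_const)

lemma Cc_inf_sum: "finite I \<Longrightarrow> (\<And>i. i \<in> I \<Longrightarrow> f i \<in> Cc_inf A) \<Longrightarrow> (\<lambda>x. \<Sum>i\<in>I. f i x) \<in> Cc_inf A"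
proof (induction I rule: finite_induct)
  case (insert i I)
  then show ?case using Cc_inf_lin[of "f i" A "\<lambda>x. \<Sum>i\<in>I. f i x" 1 1] by simp
qed (simp add: zero_in_Cc_inf)

lemma Cc_inf_directional: assumes "f \<in> Cc_inf A" shows "(\<lambda>x. cgrad f x \<bullet> c) \<in> Cc_inf A"
proof -
  have "(\<lambda>x. c $ i * pd i f x + 0 * pd i f x) \<in> Cc_inf A" for i
    by (intro Cc_inf_lin Cc_inf_pd assms)
  then have "(\<lambda>x. c $ i * pd i f x) \<in> Cc_inf A" for i by simp
  then have "(\<lambda>x. \<Sum>i\<in>UNIV. c $ i * pd i f x) \<in> Cc_inf A" by (intro Cc_inf_sum) auto
  then show ?thesis by (simp add: inner_vec_def cgrad_pd mult.commute)
qed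

text \<open>Cut off outside \<open>E\<close>, because \<open>w\<close> may be nonzero at points of
  the hyperplane at height \<open>s\<close> that lie outside the cylinder.\<close>

definition slice :: "(real^'m::finite) set \<Rightarrow> real^('m option)^('m option) \<Rightarrow> real^('m option) \<Rightarrow> real
    \<Rightarrow> (real^('m option) \<Rightarrow> real) \<Rightarrow> real^'m \<Rightarrow> real" where
  "slice E R t s w y = (if y \<in> E then w (R *v emb y s + t) else 0)"

context
  fixes E :: "(real^'m::finite) set" and R :: "real^('m option)^('m option)" and t :: "real^('m option)"
    and s :: real and A :: "(real^('m option)) set"
  assumes E: "open E" "bounded E" and R: "orthogonal_matrix R"
    and bdry: "\<And>y. y \<in> closure E \<Longrightarrow> R *v emb y s + t \<in> A \<Longrightarrow> y \<in> E"
begin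

text \<open>The assumption \<open>bdry\<close> forces this set into \<open>E\<close>: a point of
  \<open>closure E\<close> whose image lies in the support of a test function, hence in
  \<open>A\<close>, belongs to \<open>E\<close>. The cut-off in \<open>slice\<close> therefore
  creates no jump at the boundary of \<open>E\<close>.\<close>

definition "slice_supp w = {y \<in> closure E. R *v emb y s + t \<in> closure {x. w x \<noteq> (0::real)}}"

lemma slice_supp:
  assumes w: "w \<in> Cc_inf A"
  shows "compact (slice_supp w)" "slice_supp w \<subseteq> E" "y \<notin> slice_supp w \<Longrightarrow> slice E R t s w y = 0"
proof -
  have c: "continuous_on UNIV (\<lambda>y. R *v emb y s + t)"
    by (intro continuous_on_chart continuous_on_emb continuous_intros)
  have "slice_supp w = closure E \<inter> (\<lambda>y. R *v emb y s + t) -` closure {x. w x \<noteq> 0}"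
    by (auto simp: slice_supp_def)
  moreover have "closed ((\<lambda>y. R *v emb y s + t) -` closure {x. w x \<noteq> 0})"
    by (rule continuous_closed_vimage) (use c in \<open>auto simp: continuous_on_eq_continuous_at\<close>)
  ultimately show "compact (slice_supp w)" using E(2) by (simp add: compact_Int_closed compact_closure)
  show "slice_supp w \<subseteq> E" unfolding slice_supp_def using bdry Cc_infD(3)[OF w] by blast
  show "slice E R t s w y = 0" if "y \<notin> slice_supp w"
  proof (cases "y \<in> E")
    case True
    then have "R *v emb y s + t \<notin> closure {x. w x \<noteq> 0}"
      using that closure_subset[of E] unfolding slice_supp_def by blast
    then have "w (R *v emb y s + t) = 0" by (rule Cc_infD(4)[OF w])
    then show ?thesis by (simp add: slice_def)
  qed (simp add: slice_def)
qed

text \<open>The derivative is again a slice, of a directional derivative of \<open>w\<close>, which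
  is itself a test function; this lets smoothness go by induction. At points off \<open>E\<close>
  the slice vanishes on an open neighbourhood, the complement of the compact
  \<open>slice_supp w\<close>.\<close>

lemma slice_has_derivative:
  assumes w: "w \<in> Cc_inf A"
  shows "(slice E R t s w has_derivative (\<lambda>h. slice E R t s (\<lambda>x. cgrad w x \<bullet> (R *v emb h 0)) y)) (at y)"
proof (cases "y \<in> E")
  case True
  have "((\<lambda>y. emb y s) has_derivative (\<lambda>h. emb h 0)) (at y)"
  proof (rule has_derivative_componentwise_within[THEN iffD2], rule ballI)
    fix b :: "real^('m option)" assume "b \<in> Basis"
    then obtain a where b: "b = axis a 1" by (auto simp: Basis_vec_def)
    show "((\<lambda>y. emb y s \<bullet> b) has_derivative (\<lambda>h. emb h 0 \<bullet> b)) (at y)"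
      unfolding b by (cases a) (auto simp: inner_axis intro!: derivative_eq_intros bounded_linear.has_derivative[OF bounded_linear_vec_nth])
  qed
  then have "((\<lambda>y. R *v emb y s) has_derivative (\<lambda>h. R *v emb h 0)) (at y)"
    by (rule bounded_linear.has_derivative[OF matrix_vector_mul_bounded_linear])
  then have "((\<lambda>y. R *v emb y s + t) has_derivative (\<lambda>h. R *v emb h 0)) (at y)"
    by (rule has_derivative_add_const)
  from has_derivative_compose[OF this Cc_inf_has_derivative[OF w]]
  have "((\<lambda>y. w (R *v emb y s + t)) has_derivative (\<lambda>h. cgrad w (R *v emb y s + t) \<bullet> (R *v emb h 0))) (at y)" .
  then have "(slice E R t s w has_derivative (\<lambda>h. cgrad w (R *v emb y s + t) \<bullet> (R *v emb h 0))) (at y)"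
    by (rule has_derivative_transform_within_open[OF _ E(1) True]) (simp add: slice_def)
  then show ?thesis using True by (simp add: slice_def)
next
  case False
  have "((\<lambda>_. 0) has_derivative (\<lambda>h. 0)) (at y)" by simp
  then have "(slice E R t s w has_derivative (\<lambda>h. 0)) (at y)"
  proof (rule has_derivative_transform_within_open)
    show "open (- slice_supp w)" using compact_imp_closed[OF slice_supp(1)[OF w]] by (simp add: open_Compl)
    show "y \<in> - slice_supp w" using slice_supp(2)[OF w] False by blast
    show "0 = slice E R t s w x" if "x \<in> - slice_supp w" for x using slice_supp(3)[OF w, of x] that by simp
  qed
  then show ?thesis using False by (simp add: slice_def)
qed

lemma slice_Ck: "w \<in> Cc_inf A \<Longrightarrow> Ck k (slice E R t s w)"
proof (induction k arbitrary: w)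
  case 0
  then show ?case using has_derivative_continuous[OF slice_has_derivative] by (simp add: continuous_on_eq_continuous_at)
next
  case (Suc k)
  show ?case
    by (rule Ck_SucI[OF slice_has_derivative[OF Suc.prems]]) (intro Suc.IH Cc_inf_directional Suc.prems)
qed

lemma slice_Cc_inf: "w \<in> Cc_inf A \<Longrightarrow> slice E R t s w \<in> Cc_inf E"
  by (rule Cc_infI[OF slice_Ck slice_supp])

lemma cgrad_slice:
  assumes w: "w \<in> Cc_inf A"
  shows "cgrad (slice E R t s w) y = (if y \<in> E then cross (transpose R *v cgrad w (R *v emb y s + t)) else 0)"
proof (rule cgrad_eqI)
  have "cgrad w x \<bullet> (R *v emb h 0) = cross (transpose R *v cgrad w x) \<bullet> h" for x h
  proof -
    have "cgrad w x \<bullet> (R *v emb h 0) = emb h 0 \<bullet> (transpose R *v cgrad w x)"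
      using orthogonal_matrix_vector(4)[OF R] by (simp only: inner_commute[of "cgrad w x"])
    also have "\<dots> = h \<bullet> cross (transpose R *v cgrad w x)"
      by (simp only: inner_option[of "emb h 0"] emb_nth) (simp add: inner_vec_def)
    finally show ?thesis by (simp only: inner_commute)
  qed
  then have "(\<lambda>h. slice E R t s (\<lambda>x. cgrad w x \<bullet> (R *v emb h 0)) y)
     = (\<lambda>h. (if y \<in> E then cross (transpose R *v cgrad w (R *v emb y s + t)) else 0) \<bullet> h)"
    by (auto simp only: slice_def fun_eq_iff inner_zero_left split: if_splits)
  then show "(slice E R t s w has_derivative (\<lambda>h. (if y \<in> E then cross (transpose R *v cgrad w (R *v emb y s + t)) else 0) \<bullet> h)) (at y)"
    using slice_has_derivative[OF w, of y] by (simp only:)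
qed

text \<open>The slice is a test function on \<open>E\<close>, and its gradient is the projection of
  the rotated full gradient to the cross-sectional directions, hence not longer.\<close>

lemma slice_rayleigh:
  assumes w: "w \<in> Cc_inf A" and "lam 1 E \<ge> 0"
  shows "ennreal (lam 1 E) * (\<integral>\<^sup>+y. indicator E y * ennreal ((w (R *v emb y s + t))\<^sup>2) \<partial>lborel)
     \<le> (\<integral>\<^sup>+y. indicator E y * ennreal ((norm (cgrad w (R *v emb y s + t)))\<^sup>2) \<partial>lborel)"
proof -
  note v = slice_Cc_inf[OF w]
  let ?v = "slice E R t s w"
  have "E \<in> sets lebesgue" using E(1) by (simp add: borel_open)
  then have "lam 1 E * ipL ?v ?v \<le> enL ?v ?v"
    by (rule lam_1_rayleigh) (use v Cc_inf_subset_W0 in blast)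
  moreover have "ipL ?v ?v \<ge> 0" unfolding ipL_square by simp
  ultimately have "ennreal (lam 1 E) * ennreal (ipL ?v ?v) \<le> ennreal (enL ?v ?v)"
    using assms(2) by (simp add: ennreal_mult[symmetric] ennreal_leI)
  then have "ennreal (lam 1 E) * (\<integral>\<^sup>+y. ennreal ((?v y)\<^sup>2) \<partial>lborel) \<le> (\<integral>\<^sup>+y. ennreal ((norm (cgrad ?v y))\<^sup>2) \<partial>lborel)"
    by (simp only: Cc_inf_nn_integral_square[OF v] Cc_inf_nn_integral_grad[OF v])
  also have "(\<integral>\<^sup>+y. ennreal ((?v y)\<^sup>2) \<partial>lborel) = (\<integral>\<^sup>+y. indicator E y * ennreal ((w (R *v emb y s + t))\<^sup>2) \<partial>lborel)"
    by (intro nn_integral_cong) (simp add: slice_def)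
  also have "(\<integral>\<^sup>+y. ennreal ((norm (cgrad ?v y))\<^sup>2) \<partial>lborel)
     \<le> (\<integral>\<^sup>+y. indicator E y * ennreal ((norm (cgrad w (R *v emb y s + t)))\<^sup>2) \<partial>lborel)"
  proof (rule nn_integral_mono)
    fix y
    have "norm (cross (transpose R *v cgrad w (R *v emb y s + t))) \<le> norm (cgrad w (R *v emb y s + t))"
      using norm_cross_le[of "transpose R *v cgrad w (R *v emb y s + t)"] orthogonal_matrix_vector(5)[OF R] by (simp only:)
    then have "(norm (cross (transpose R *v cgrad w (R *v emb y s + t))))\<^sup>2 \<le> (norm (cgrad w (R *v emb y s + t)))\<^sup>2"
      by (rule power_mono) simp
    then show "ennreal ((norm (cgrad ?v y))\<^sup>2) \<le> indicator E y * ennreal ((norm (cgrad w (R *v emb y s + t)))\<^sup>2)"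
      unfolding cgrad_slice[OF w] by (cases "y \<in> E") (simp_all add: ennreal_leI del: transpose_matrix_vector)
  qed
  finally show ?thesis .
qed

end

text \<open>The cylinder with heights restricted to \<open>S\<close>: \<open>{0<..}\<close> gives
  the whole half-cylinder, \<open>{r0..}\<close> its far end.\<close>

definition endset :: "(real^('m::finite)) set \<Rightarrow> real set \<Rightarrow> real^('m option)^('m option) \<Rightarrow> real^('m option) \<Rightarrow> (real^('m option)) set" where
  "endset E S R t = {R *v emb y s + t | y s. y \<in> E \<and> s \<in> S}"

lemma mem_endset:
  assumes "orthogonal_matrix R"
  shows "x \<in> endset E S R t \<longleftrightarrow> cross (coord R t x) \<in> E \<and> coord R t x $ None \<in> S"
proof
  assume "x \<in> endset E S R t"
  then obtain y s where "x = R *v emb y s + t" "y \<in> E" "s \<in> S" unfolding endset_def by blast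
  then show "cross (coord R t x) \<in> E \<and> coord R t x $ None \<in> S" by (simp add: coord_inverse(1)[OF assms])
next
  assume *: "cross (coord R t x) \<in> E \<and> coord R t x $ None \<in> S"
  have "x = R *v emb (cross (coord R t x)) (coord R t x $ None) + t"
    by (simp only: emb_cross coord_inverse(2)[OF assms])
  then show "x \<in> endset E S R t" using * unfolding endset_def by blast
qed

lemma cyl_eq_endset: "cyl E R t = endset E {0<..} R t"
  unfolding cyl_def endset_def by auto

lemma open_endset:
  assumes "orthogonal_matrix R" "open E" "open S" shows "open (endset E S R t)"
proof -
  have "endset E S R t = (\<lambda>x. cross (coord R t x)) -` E \<inter> (\<lambda>x. coord R t x $ None) -` S"
    using mem_endset[OF assms(1)] by blast
  moreover have "continuous_on UNIV (\<lambda>x. cross (coord R t x))"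
    by (rule continuous_on_compose2[OF continuous_on_cross[of UNIV] continuous_on_coord]) simp
  moreover have "continuous_on UNIV (\<lambda>x. coord R t x $ None)" by (intro continuous_intros continuous_on_coord)
  ultimately show ?thesis using assms(2,3) by (auto intro!: open_Int open_vimage)
qed

lemma borel_endset:
  assumes "orthogonal_matrix R" "open E" "S \<in> sets borel" shows "endset E S R t \<in> sets borel"
proof -
  have m: "(\<lambda>x. cross (coord R t x)) \<in> borel_measurable borel" "(\<lambda>x. coord R t x $ None) \<in> borel_measurable borel"
    by (rule borel_measurable_continuous_onI, rule continuous_on_compose2[OF continuous_on_cross[of UNIV] continuous_on_coord], simp,
        rule borel_measurable_continuous_onI, intro continuous_intros continuous_on_coord)
  have "endset E S R t = ((\<lambda>x. cross (coord R t x)) -` E \<inter> space borel) \<inter> ((\<lambda>x. coord R t x $ None) -` S \<inter> space borel)"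
    using mem_endset[OF assms(1)] by auto
  then show ?thesis using measurable_sets[OF m(1), of E] measurable_sets[OF m(2) assms(3)] assms(2)
    by (metis borel_open sets.Int)
qed

text \<open>The slice inequality is integrated over the heights in \<open>S\<close>. Integrals in
  \<open>ennreal\<close> allow iteration without integrability conditions; \<open>lam0\<close> keeps
  \<open>ennreal\<close> from truncating the eigenvalue.\<close>

lemma end_rayleigh:
  fixes E :: "(real^'m::finite) set"
  assumes E: "open E" "bounded E" and R: "orthogonal_matrix R" and S: "S \<in> sets borel"
    and bdry: "\<And>y s. s \<in> S \<Longrightarrow> y \<in> closure E \<Longrightarrow> R *v emb y s + t \<in> A \<Longrightarrow> y \<in> E"
    and w: "w \<in> Cc_inf A" and lam0: "lam 1 E \<ge> 0"
  shows "ennreal (lam 1 E) * (\<integral>\<^sup>+x. indicator (endset E S R t) x * ennreal ((w x)\<^sup>2) \<partial>lborel)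
     \<le> (\<integral>\<^sup>+x. indicator (endset E S R t) x * ennreal ((norm (cgrad w x))\<^sup>2) \<partial>lborel)"
proof -
  note [measurable] = Cc_inf_borel[OF w] borel_endset[OF R E(1) S, of t] S
  have [measurable]: "E \<in> sets borel" using E(1) by (rule borel_open)
  have mR[measurable]: "(\<lambda>x. R *v x) \<in> borel_measurable borel"
    by (intro borel_measurable_continuous_onI linear_continuous_on matrix_vector_mul_bounded_linear)
  have me: "(\<lambda>p. emb (snd p) (fst p)) \<in> borel_measurable (lborel \<Otimes>\<^sub>M lborel)"
  proof -
    have "continuous_on UNIV (\<lambda>p. emb (snd p) (fst p))" by (intro continuous_on_emb continuous_intros)
    then show ?thesis unfolding lborel_prod measurable_lborel2 by (rule borel_measurable_continuous_onI)
  qed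
  have ind: "indicator (endset E S R t) (R *v emb y s + t) = (indicator S s * indicator E y :: ennreal)" for y s
    by (auto simp: indicator_def mem_endset[OF R] coord_inverse(1)[OF R])
  have key: "(\<integral>\<^sup>+x. indicator (endset E S R t) x * f x \<partial>lborel)
    = (\<integral>\<^sup>+s. indicator S s * (\<integral>\<^sup>+y. indicator E y * f (R *v emb y s + t) \<partial>lborel) \<partial>lborel)"
    if [measurable]: "f \<in> borel_measurable borel" for f :: "real^('m option) \<Rightarrow> ennreal"
  proof -
    have "(\<integral>\<^sup>+x. indicator (endset E S R t) x * f x \<partial>lborel)
       = (\<integral>\<^sup>+s. (\<integral>\<^sup>+y. indicator (endset E S R t) (R *v emb y s + t) * f (R *v emb y s + t) \<partial>lborel) \<partial>lborel)"
      by (rule nn_integral_cylinder_coordinates[OF R]) measurable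
    also have "\<dots> = (\<integral>\<^sup>+s. indicator S s * (\<integral>\<^sup>+y. indicator E y * f (R *v emb y s + t) \<partial>lborel) \<partial>lborel)"
    proof (rule nn_integral_cong)
      fix s :: real
      have c: "(\<lambda>y. emb y s) \<in> borel_measurable borel"
        by (intro borel_measurable_continuous_onI continuous_on_emb continuous_intros)
      have [measurable]: "(\<lambda>y. f (R *v emb y s + t)) \<in> borel_measurable borel"
        using c by measurable
      show "(\<integral>\<^sup>+y. indicator (endset E S R t) (R *v emb y s + t) * f (R *v emb y s + t) \<partial>lborel)
        = indicator S s * (\<integral>\<^sup>+y. indicator E y * f (R *v emb y s + t) \<partial>lborel)"
        unfolding ind mult.assoc by (rule nn_integral_cmult) measurable
    qed
    finally show ?thesis .
  qed
  have meas: "(\<lambda>s. indicator S s * (\<integral>\<^sup>+y. indicator E y * ennreal ((w (R *v emb y s + t))\<^sup>2) \<partial>lborel)) \<in> borel_measurable lborel"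
  proof -
    have "(\<lambda>p. w (R *v emb (snd p) (fst p) + t)) \<in> borel_measurable (lborel \<Otimes>\<^sub>M lborel)"
      using me by measurable
    then show ?thesis by measurable
  qed
  have "ennreal (lam 1 E) * (\<integral>\<^sup>+x. indicator (endset E S R t) x * ennreal ((w x)\<^sup>2) \<partial>lborel)
    = (\<integral>\<^sup>+s. ennreal (lam 1 E) * (indicator S s * (\<integral>\<^sup>+y. indicator E y * ennreal ((w (R *v emb y s + t))\<^sup>2) \<partial>lborel)) \<partial>lborel)"
    by (subst key, measurable) (rule nn_integral_cmult[OF meas, symmetric])
  also have "\<dots> \<le> (\<integral>\<^sup>+s. indicator S s * (\<integral>\<^sup>+y. indicator E y * ennreal ((norm (cgrad w (R *v emb y s + t)))\<^sup>2) \<partial>lborel) \<partial>lborel)"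
  proof (rule nn_integral_mono)
    fix s
    show "ennreal (lam 1 E) * (indicator S s * (\<integral>\<^sup>+y. indicator E y * ennreal ((w (R *v emb y s + t))\<^sup>2) \<partial>lborel))
      \<le> indicator S s * (\<integral>\<^sup>+y. indicator E y * ennreal ((norm (cgrad w (R *v emb y s + t)))\<^sup>2) \<partial>lborel)"
      using slice_rayleigh[OF E R bdry w lam0] by (cases "s \<in> S") simp_all
  qed
  also have "\<dots> = (\<integral>\<^sup>+x. indicator (endset E S R t) x * ennreal ((norm (cgrad w x))\<^sup>2) \<partial>lborel)"
    by (rule key[symmetric]) measurable
  finally show ?thesis .
qed

text \<open>Bumps on disjoint balls around \<open>l\<close> distinct points. It makes the sets under
  \<open>Inf\<close> in the min-max levels nonempty.\<close>

lemma W0_infinite_dim: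
  fixes A :: "(real^'n::finite) set"
  assumes A: "open A" "A \<noteq> {}"
  shows "\<exists>\<phi>. (\<forall>i<l. \<phi> i \<in> W0 A) \<and> sob.indep l \<phi>"
proof -
  have "infinite A" using finite_imp_not_open A by blast
  then obtain B where B: "finite B" "card B = l" "B \<subseteq> A" using infinite_arbitrarily_large by blast
  obtain p where p: "bij_betw p {0..<l} B" using ex_bij_betw_nat_finite[OF B(1)] B(2) by blast
  have pA: "p k \<in> A" and pB: "p k \<in> B" if "k < l" for k using bij_betwE[OF p] that B(3) by auto
  have pinj: "p i \<noteq> p k" if "i < l" "k < l" "i \<noteq> k" for i k
    using bij_betw_imp_inj_on[OF p] that by (auto simp: inj_on_def)
  define P where "P k f r \<longleftrightarrow> f \<in> Cc_inf A \<and> 0 < r \<and> (\<forall>x\<in>ball (p k) r. f x > 0) \<and>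
      (\<forall>x. x \<notin> ball (p k) r \<longrightarrow> f x = 0) \<and> (\<forall>q\<in>B. q \<noteq> p k \<longrightarrow> 2 * r \<le> dist (p k) q)" for k f r
  have "\<exists>f r. P k f r" if k: "k < l" for k
  proof -
    obtain d where d: "d > 0" "\<forall>q\<in>B. q \<noteq> p k \<longrightarrow> d \<le> dist (p k) q" using finite_set_avoid[OF B(1)] by blast
    obtain e where e: "e > 0" "cball (p k) e \<subseteq> A" using A(1) pA[OF k] open_contains_cball by blast
    \<comment> \<open>At most half the distance to every other chosen point, so that the balls of
      different indices are disjoint.\<close>
    define r where "r = min (d / 2) e"
    have r: "r > 0" "2 * r \<le> d" "r \<le> e" using d e by (auto simp: r_def)
    then have "cball (p k) r \<subseteq> A" using e(2) subset_cball[of r e] by blast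
    from bump_exists[OF r(1) this] obtain f where
      "f \<in> Cc_inf A" "\<forall>x\<in>ball (p k) r. f x > 0" "\<forall>x. x \<notin> ball (p k) r \<longrightarrow> f x = 0" by blast
    then have "P k f r" using r(1,2) d(2) unfolding P_def by force
    then show ?thesis by blast
  qed
  then obtain f r where "\<And>k. k < l \<Longrightarrow> P k (f k) (r k)" by metis
  then have f: "\<And>k. k < l \<Longrightarrow> f k \<in> Cc_inf A" "\<And>k. k < l \<Longrightarrow> 0 < r k"
    "\<And>k x. k < l \<Longrightarrow> x \<in> ball (p k) (r k) \<Longrightarrow> f k x > 0"
    "\<And>k x. k < l \<Longrightarrow> x \<notin> ball (p k) (r k) \<Longrightarrow> f k x = 0"
    "\<And>k q. k < l \<Longrightarrow> q \<in> B \<Longrightarrow> q \<noteq> p k \<Longrightarrow> 2 * r k \<le> dist (p k) q"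
    unfolding P_def by blast+
  have fW: "f i \<in> W0 A" if "i < l" for i using f(1)[OF that] Cc_inf_subset_W0 by blast
  have "sob.indep l f"
    unfolding sob.indep_def
  proof (intro allI impI)
    fix c k
    assume zero: "ipL (lincomb l c f) (lincomb l c f) = 0" and k: "k < l"
    let ?w = "\<lambda>x. \<Sum>i<l. c i * f i x"
    have "?w \<in> W0 A" by (rule sob.subsp_sum[OF W0_subsp fW])
    then have "AE x in lebesgue. ?w x = 0"
      using L2_zero_AE[OF W0pairD(1)[OF W0pair_grad], of ?w A] zero unfolding ipL_square by blast
    show "c k = 0"
    proof (rule ccontr)
      assume ck: "c k \<noteq> 0"
      have w: "?w x = c k * f k x" if x: "x \<in> ball (p k) (r k)" for x
      proof -
        have "f i x = 0" if i: "i < l" "i \<noteq> k" for i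
        proof (rule f(4)[OF i(1)])
          have "2 * r k \<le> dist (p k) (p i)" "2 * r i \<le> dist (p i) (p k)"
            using f(5)[OF k pB[OF i(1)]] f(5)[OF i(1) pB[OF k]] pinj[OF i(1) k i(2)] by auto
          then have "r i + r k \<le> dist (p k) (p i)" by (simp add: dist_commute)
          moreover have "dist (p k) (p i) \<le> dist (p k) x + dist (p i) x" using dist_triangle2 .
          ultimately show "x \<notin> ball (p i) (r i)" using x by simp
        qed
        then have "?w x = (\<Sum>i<l. if i = k then c k * f k x else 0)" by (intro sum.cong) auto
        then show ?thesis using k by simp
      qed
      have "AE x in lebesgue. x \<notin> ball (p k) (r k)"
        using \<open>AE x in lebesgue. ?w x = 0\<close>
      proof eventually_elim
        fix x assume "?w x = 0"
        then show "x \<notin> ball (p k) (r k)" using w[of x] f(3)[OF k, of x] ck by auto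
      qed
      then have "negligible (ball (p k) (r k))"
        unfolding negligible_iff_null_sets by (subst AE_iff_null_sets) auto
      then show False using open_not_negligible[of "ball (p k) (r k)"] f(2)[OF k] by auto
    qed
  qed
  then show ?thesis using fW by blast
qed

lemma lam_nonneg:
  fixes A :: "(real^'n::finite) set"
  assumes "open A" "A \<noteq> {}" "j \<ge> 1" shows "lam j A \<ge> 0"
proof -
  have "0 \<le> sob.minmax j (W0 A)"
    by (rule sob.minmax_ge[OF W0_subsp W0_infinite_dim[OF assms(1,2)], where m = 0 and e = "\<lambda>_ _. 0"])
       (use assms(3) sob.subspD(6)[OF W0_subsp] in \<open>auto intro: sob.en.nonneg\<close>)
  then show ?thesis using assms(1) by (simp add: lam_eq borel_open)
qed

text \<open>Disjointness lets the masses of the ends add up while their energies together stay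
  within the total.\<close>

lemma ends_tail:
  fixes E :: "nat \<Rightarrow> (real^'m::finite) set"
  assumes I: "finite I" and E: "\<And>i. i \<in> I \<Longrightarrow> open (E i)" "\<And>i. i \<in> I \<Longrightarrow> bounded (E i)"
    and R: "\<And>i. i \<in> I \<Longrightarrow> orthogonal_matrix (R i)" and S: "\<And>i. i \<in> I \<Longrightarrow> S i \<in> sets borel"
    and bdry: "\<And>i y s. i \<in> I \<Longrightarrow> s \<in> S i \<Longrightarrow> y \<in> closure (E i) \<Longrightarrow> R i *v emb y s + t i \<in> A \<Longrightarrow> y \<in> E i"
    and disj: "disjoint_family_on (\<lambda>i. endset (E i) (S i) (R i) (t i)) I"
    and \<E>: "0 \<le> \<E>" "\<And>i. i \<in> I \<Longrightarrow> \<E> \<le> lam 1 (E i)"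
    and u: "u \<in> Cc_inf A"
  shows "\<E> * (\<integral>x. indicator (\<Union>i\<in>I. endset (E i) (S i) (R i) (t i)) x * (u x)\<^sup>2 \<partial>lebesgue) \<le> enL u u"
proof -
  define T where "T i = endset (E i) (S i) (R i) (t i)" for i
  have T[measurable]: "T i \<in> sets borel" if "i \<in> I" for i
    unfolding T_def by (rule borel_endset[OF R[OF that] E(1)[OF that] S[OF that]])
  note [measurable] = Cc_inf_borel[OF u]
  have UT[measurable]: "(\<Union>i\<in>I. T i) \<in> sets borel" using T I by auto
  have ind: "indicator (\<Union>i\<in>I. T i) x = (\<Sum>i\<in>I. indicator (T i) x :: ennreal)" for x
    unfolding T_def by (rule indicator_UN_disjoint[OF I disj])
  have i: "integrable lebesgue (\<lambda>x. indicator (\<Union>i\<in>I. T i) x * (u x)\<^sup>2)"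
    using integrable_mult_indicator[of "\<Union>i\<in>I. T i" lebesgue "\<lambda>x. (u x)\<^sup>2"] sqintD(2)[OF Cc_inf_sqint(1)[OF u]] UT by simp
  have e0: "enL u u \<ge> 0" by (simp add: enL_Cc_inf[OF u])
  have "ennreal (\<E> * (\<integral>x. indicator (\<Union>i\<in>I. T i) x * (u x)\<^sup>2 \<partial>lebesgue))
     = ennreal \<E> * ennreal (\<integral>x. indicator (\<Union>i\<in>I. T i) x * (u x)\<^sup>2 \<partial>lebesgue)"
    using \<E>(1) by (simp add: ennreal_mult)
  also have "ennreal (\<integral>x. indicator (\<Union>i\<in>I. T i) x * (u x)\<^sup>2 \<partial>lebesgue) = (\<integral>\<^sup>+x. ennreal (indicator (\<Union>i\<in>I. T i) x * (u x)\<^sup>2) \<partial>lebesgue)"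
    using i by (intro nn_integral_eq_integral[symmetric]) auto
  also have "\<dots> = (\<integral>\<^sup>+x. ennreal (indicator (\<Union>i\<in>I. T i) x * (u x)\<^sup>2) \<partial>lborel)"
    by (rule nn_integral_completion)
  also have "\<dots> = (\<integral>\<^sup>+x. (\<Sum>i\<in>I. indicator (T i) x * ennreal ((u x)\<^sup>2)) \<partial>lborel)"
  proof (rule nn_integral_cong)
    fix x
    have "ennreal (indicator (\<Union>i\<in>I. T i) x * (u x)\<^sup>2) = indicator (\<Union>i\<in>I. T i) x * ennreal ((u x)\<^sup>2)"
      by (simp add: indicator_def)
    then show "ennreal (indicator (\<Union>i\<in>I. T i) x * (u x)\<^sup>2) = (\<Sum>i\<in>I. indicator (T i) x * ennreal ((u x)\<^sup>2))"
      by (simp only: ind sum_distrib_right)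
  qed
  also have "\<dots> = (\<Sum>i\<in>I. \<integral>\<^sup>+x. indicator (T i) x * ennreal ((u x)\<^sup>2) \<partial>lborel)"
    by (rule nn_integral_sum) measurable
  also have "ennreal \<E> * \<dots> = (\<Sum>i\<in>I. ennreal \<E> * (\<integral>\<^sup>+x. indicator (T i) x * ennreal ((u x)\<^sup>2) \<partial>lborel))"
    by (rule sum_distrib_left)
  also have "\<dots> \<le> (\<Sum>i\<in>I. \<integral>\<^sup>+x. indicator (T i) x * ennreal ((norm (cgrad u x))\<^sup>2) \<partial>lborel)"
  proof (rule sum_mono)
    fix i assume i: "i \<in> I"
    have "ennreal \<E> * (\<integral>\<^sup>+x. indicator (T i) x * ennreal ((u x)\<^sup>2) \<partial>lborel)
       \<le> ennreal (lam 1 (E i)) * (\<integral>\<^sup>+x. indicator (T i) x * ennreal ((u x)\<^sup>2) \<partial>lborel)"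
      by (intro mult_right_mono ennreal_leI \<E>(2)[OF i]) simp
    also have "\<dots> \<le> (\<integral>\<^sup>+x. indicator (T i) x * ennreal ((norm (cgrad u x))\<^sup>2) \<partial>lborel)"
      unfolding T_def
    proof (rule end_rayleigh[OF E(1)[OF i] E(2)[OF i] R[OF i] S[OF i] _ u])
      show "y \<in> E i" if "s \<in> S i" "y \<in> closure (E i)" "R i *v emb y s + t i \<in> A" for y s
        using bdry[OF i that] .
      show "0 \<le> lam 1 (E i)" using \<E>(1) \<E>(2)[OF i] by simp
    qed
    finally show "ennreal \<E> * (\<integral>\<^sup>+x. indicator (T i) x * ennreal ((u x)\<^sup>2) \<partial>lborel)
       \<le> (\<integral>\<^sup>+x. indicator (T i) x * ennreal ((norm (cgrad u x))\<^sup>2) \<partial>lborel)" .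
  qed
  also have "\<dots> = (\<integral>\<^sup>+x. (\<Sum>i\<in>I. indicator (T i) x * ennreal ((norm (cgrad u x))\<^sup>2)) \<partial>lborel)"
    by (rule nn_integral_sum[symmetric]) measurable
  also have "\<dots> \<le> (\<integral>\<^sup>+x. ennreal ((norm (cgrad u x))\<^sup>2) \<partial>lborel)"
    unfolding sum_distrib_right[symmetric] ind[symmetric]
    by (intro nn_integral_mono) (simp add: indicator_def)
  also have "\<dots> = ennreal (enL u u)" by (rule Cc_inf_nn_integral_grad[OF u])
  finally show ?thesis using e0 unfolding T_def by (simp add: ennreal_le_iff)
qed

text \<open>If the image of a point of \<open>closure E\<close> lay in the open set
  \<open>X\<close>, so would the images of nearby points of \<open>E\<close>, against
  \<open>out\<close>. Within the cylinder itself, membership means \<open>y \<in> E\<close>.\<close>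

lemma slice_boundary:
  assumes R: "orthogonal_matrix R" and X: "open X"
    and out: "\<And>y. y \<in> E \<Longrightarrow> R *v emb y s + t \<notin> X"
    and y: "y \<in> closure E" "R *v emb y s + t \<in> X \<union> cyl E R t"
  shows "y \<in> E"
proof (cases "R *v emb y s + t \<in> cyl E R t")
  case True
  then show ?thesis unfolding cyl_eq_endset mem_endset[OF R] coord_inverse(1)[OF R] by simp
next
  case False
  have "continuous_on UNIV (\<lambda>y. R *v emb y s + t)"
    by (intro continuous_on_chart continuous_on_emb continuous_intros)
  then have "open ((\<lambda>y. R *v emb y s + t) -` X)" using X by (intro open_vimage)
  moreover have "y \<in> (\<lambda>y. R *v emb y s + t) -` X \<inter> closure E" using y False by auto
  ultimately have "(\<lambda>y. R *v emb y s + t) -` X \<inter> E \<noteq> {}" using open_Int_closure_eq_empty by blast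
  then show ?thesis using out by blast
qed

section \<open>Cubes in the coordinates of a cylinder\<close>

lemma mem_cube:
  assumes R: "orthogonal_matrix R"
  shows "x \<in> cube r R t \<longleftrightarrow> (\<forall>a. \<bar>coord R t x $ a\<bar> < r)"
proof
  assume "x \<in> cube r R t"
  then obtain z where "x = R *v z + t" "\<forall>a. \<bar>z $ a\<bar> < r" unfolding cube_def by blast
  then show "\<forall>a. \<bar>coord R t x $ a\<bar> < r" by (simp add: coord_inverse(1)[OF R])
next
  assume "\<forall>a. \<bar>coord R t x $ a\<bar> < r"
  then show "x \<in> cube r R t" unfolding cube_def using coord_inverse(2)[OF R, of t x] by (intro image_eqI[of _ _ "coord R t x"]) auto
qed

lemma open_cube: assumes R: "orthogonal_matrix R" shows "open (cube r R t)"
proof -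
  have "cube r R t = coord R t -` box (\<chi> a. - r) (\<chi> a. r)"
    using mem_cube[OF R] by (auto simp: mem_box_vec abs_less_iff minus_less_iff)
  then show ?thesis using open_vimage[OF open_box continuous_on_coord] by simp
qed

lemma norm_emb_le: "norm x \<le> norm (cross x) + \<bar>x $ None\<bar>"
proof (rule power2_le_imp_le)
  have "(norm x)\<^sup>2 = (norm (cross x))\<^sup>2 + \<bar>x $ None\<bar>\<^sup>2"
    unfolding power2_norm_eq_inner inner_option[of x] by (simp add: inner_vec_def power2_eq_square)
  also have "\<dots> \<le> (norm (cross x) + \<bar>x $ None\<bar>)\<^sup>2" by (simp add: power2_sum)
  finally show "(norm x)\<^sup>2 \<le> (norm (cross x) + \<bar>x $ None\<bar>)\<^sup>2" .
qed simp

section \<open>The main theorem\<close>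

theorem mainTheorem5:
  fixes k :: nat and ell :: nat
    and \<Omega>0 :: "(real^('m::finite option)) set"
    and E :: "nat \<Rightarrow> (real^'m) set"
    and R :: "nat \<Rightarrow> real^('m option)^('m option)"
    and t :: "nat \<Rightarrow> real^('m option)"
    and r0 :: real
  defines "C \<equiv> (\<lambda>i. cyl (E i) (R i) (t i))"
  defines "\<Omega> \<equiv> \<Omega>0 \<union> (\<Union>i\<in>{1..k}. C i)"
  defines "\<Omega>r \<equiv> (\<lambda>r. \<Union>i\<in>{1..k}. \<Omega>0 \<union> (cube r (R i) (t i) \<inter> C i))"
  assumes k: "k \<ge> 1"
    and A1: "bounded \<Omega>0" "open \<Omega>0"
    and A2: "\<forall>i\<in>{1..k}. open (E i) \<and> bounded (E i) \<and> connected (E i) \<and> E i \<noteq> {} \<and>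
                          orthogonal_matrix (R i)"
    and A3: "\<exists>\<rho>0>0. \<forall>i\<in>{1..k}. \<forall>j\<in>{1..k}. i \<noteq> j \<longrightarrow> (C i \<inter> C j) - ball 0 \<rho>0 = {}"
    and r0: "r0 > 0"
      "\<forall>r\<ge>r0. \<Omega> - \<Omega>r r = (\<Union>i\<in>{1..k}. C i - cube r (R i) (t i)) \<and>
               (\<forall>i\<in>{1..k}. \<forall>j\<in>{1..k}. i \<noteq> j \<longrightarrow>
                   (C i - cube r (R i) (t i)) \<inter> (C j - cube r (R j) (t j)) = {})"
    and l: "ell \<ge> 2"
    and gap: "lam ell \<Omega> < Min ((\<lambda>i. lam 1 (E i)) ` {1..k})"
  shows "\<forall>j\<in>{1..ell}. \<exists>u :: nat \<Rightarrow> real^('m option) \<Rightarrow> real.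
           (\<forall>m\<in>{1..j}. eigenfun \<Omega> (lam m \<Omega>) (u m)) \<and>
           (\<forall>m\<in>{1..j}. \<forall>m'\<in>{1..j}. m \<noteq> m' \<longrightarrow> L2inner \<Omega> (u m) (u m') = 0) \<and>
           is_arg_min (Dirichlet \<Omega>) (\<lambda>v. v \<in> S2 \<Omega> \<and> (\<forall>m\<in>{1..<j}. L2inner \<Omega> v (u m) = 0)) (u j) \<and>
           lam j \<Omega> = Dirichlet \<Omega> (u j) \<and>
           (\<exists>U :: nat \<Rightarrow> nat \<Rightarrow> real^('m option) \<Rightarrow> real.
              (\<forall>n::nat. real n \<ge> r0 \<longrightarrow>
                 (\<forall>m\<in>{1..j}. eigenfun (\<Omega>r (real n)) (lam m (\<Omega>r (real n))) (U n m)) \<and>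
                 (\<forall>m\<in>{1..j}. \<forall>m'\<in>{1..j}. m \<noteq> m' \<longrightarrow> L2inner (\<Omega>r (real n)) (U n m) (U n m') = 0)) \<and>
              (\<exists>s. strict_mono s \<and>
                 (\<forall>m\<in>{1..j}. (\<lambda>i. L2norm \<Omega> (\<lambda>x. U (s i) m x - u m x)) \<longlonglongrightarrow> 0)))"
proof -

  \<comment> \<open>Geometry of the domain and its truncations\<close>
  let ?I = "{1..k}"
  have R: "orthogonal_matrix (R i)" and E: "open (E i)" "bounded (E i)" "E i \<noteq> {}" if "i \<in> ?I" for i
    using A2 that by auto
  have Cdef: "C i = cyl (E i) (R i) (t i)" for i by (simp add: C_def)
  have \<Omega>def: "\<Omega> = \<Omega>0 \<union> (\<Union>i\<in>?I. C i)" by (simp add: \<Omega>_def)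
  have \<Omega>rdef: "\<Omega>r r = (\<Union>i\<in>?I. \<Omega>0 \<union> (cube r (R i) (t i) \<inter> C i))" for r by (simp add: \<Omega>r_def)
  have oC: "open (C i)" if "i \<in> ?I" for i
    unfolding Cdef cyl_eq_endset by (rule open_endset[OF R[OF that] E(1)[OF that]]) simp
  have memC: "x \<in> C i \<longleftrightarrow> cross (coord (R i) (t i) x) \<in> E i \<and> coord (R i) (t i) x $ None > 0" if "i \<in> ?I" for i x
    unfolding Cdef cyl_eq_endset mem_endset[OF R[OF that]] by simp
  have o\<Omega>: "open \<Omega>" unfolding \<Omega>def using A1(2) oC by blast
  have o\<Omega>r: "open (\<Omega>r r)" for r
    unfolding \<Omega>rdef using A1(2) oC open_cube[OF R] by (intro open_UN ballI open_Un open_Int) auto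
  have one: "1 \<in> ?I" using k by simp
  have \<Omega>0r: "\<Omega>0 \<subseteq> \<Omega>r r" for r unfolding \<Omega>rdef using one by blast
  have \<Omega>r\<Omega>: "\<Omega>r r \<subseteq> \<Omega>" for r unfolding \<Omega>rdef \<Omega>def by blast
  have \<Omega>rmono: "\<Omega>r r \<subseteq> \<Omega>r r'" if "r \<le> r'" for r r'
  proof -
    have "cube r (R i) (t i) \<subseteq> cube r' (R i) (t i)" if "i \<in> ?I" for i
    proof
      fix x assume "x \<in> cube r (R i) (t i)"
      then show "x \<in> cube r' (R i) (t i)"
        unfolding mem_cube[OF R[OF that]] using less_le_trans[OF _ \<open>r \<le> r'\<close>] by blast
    qed
    then show ?thesis unfolding \<Omega>rdef by blast
  qed
  have m\<Omega>: "\<Omega> \<in> sets lebesgue" and m\<Omega>r: "\<Omega>r r \<in> sets lebesgue" for r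
    using borel_open[OF o\<Omega>] borel_open[OF o\<Omega>r] by auto
  have ne: "\<Omega> \<noteq> {}"
  proof -
    obtain i where i: "i \<in> ?I" using one by blast
    obtain y where "y \<in> E i" using E(3)[OF i] by blast
    then have "R i *v emb y 1 + t i \<in> C i" using memC[OF i] by (simp add: coord_inverse(1)[OF R[OF i]])
    then show ?thesis unfolding \<Omega>def using i by blast
  qed
  define \<E> where "\<E> = Min ((\<lambda>i. lam 1 (E i)) ` ?I)"
  have \<E>le: "\<E> \<le> lam 1 (E i)" if "i \<in> ?I" for i unfolding \<E>_def using that by (intro Min_le) auto
  have \<E>0: "\<E> \<ge> 0"
    unfolding \<E>_def using one by (subst Min_ge_iff) (auto intro!: lam_nonneg E)

  \<comment> \<open>The rest of \<Omega> as seen from cylinder \<open>i\<close>. Where a piece of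
    the cylinder avoids \<open>X i\<close>, slices of test functions on \<Omega> vanish near the
    boundary of \<open>E i\<close>.\<close>
  define X where "X i = \<Omega>0 \<union> (\<Union>j\<in>?I - {i}. C j)" for i
  have oX: "open (X i)" for i unfolding X_def using A1(2) oC by blast
  have \<Omega>X: "\<Omega> = X i \<union> C i" if "i \<in> ?I" for i unfolding \<Omega>def X_def using that by blast
  \<comment> \<open>Such a point is not in \<open>\<Omega>r r\<close>. Membership in
    \<open>\<Omega>0\<close> would put it there; membership in another \<open>C j\<close> would put
    it either there or into the end of \<open>C j\<close>, which is disjoint from the end of
    \<open>C i\<close>.\<close>
  have outside: "x \<notin> X i" if i: "i \<in> ?I" and r: "r \<ge> r0" and x: "x \<in> C i - cube r (R i) (t i)" for i r x
  proof
    assume xX: "x \<in> X i"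
    have r0': "\<Omega> - \<Omega>r r = (\<Union>i\<in>?I. C i - cube r (R i) (t i))"
      "\<And>j. j \<in> ?I \<Longrightarrow> i \<noteq> j \<Longrightarrow> (C i - cube r (R i) (t i)) \<inter> (C j - cube r (R j) (t j)) = {}"
      using r0(2) r i by auto
    have nr: "x \<notin> \<Omega>r r" using r0'(1) x i by blast
    then have "x \<notin> \<Omega>0" using \<Omega>0r by blast
    then obtain j where j: "j \<in> ?I" "j \<noteq> i" "x \<in> C j" using xX unfolding X_def by blast
    then have "x \<notin> cube r (R j) (t j)" using nr unfolding \<Omega>rdef by blast
    then show False using r0'(2)[OF j(1)] j x by blast
  qed

  \<comment> \<open>Stated for general height sets: it serves with \<open>{r0..}\<close> for
    coercivity and with \<open>{0<..}\<close> to show that the truncated sets are nonempty.\<close>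
  have tail: "\<E> * (\<integral>x. indicator (\<Union>i\<in>?I. endset (E i) (S i) (R i) (t i)) x * (u x)\<^sup>2 \<partial>lebesgue) \<le> enL u u"
    if S: "\<And>i. i \<in> ?I \<Longrightarrow> S i \<in> sets borel" "\<And>i. i \<in> ?I \<Longrightarrow> S i \<subseteq> {0<..}"
      and out: "\<And>i x. i \<in> ?I \<Longrightarrow> x \<in> endset (E i) (S i) (R i) (t i) \<Longrightarrow> x \<notin> X i"
      and u: "u \<in> Cc_inf \<Omega>" for S u
  proof (rule ends_tail[OF _ E(1,2) R S(1) _ _ \<E>0 \<E>le u])
    fix i y s assume i: "i \<in> ?I" and y: "s \<in> S i" "y \<in> closure (E i)" "R i *v emb y s + t i \<in> \<Omega>"
    show "y \<in> E i"
    proof (rule slice_boundary[OF R[OF i] oX[of i] _ y(2)])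
      show "R i *v emb y' s + t i \<notin> X i" if "y' \<in> E i" for y'
        using that y(1) by (intro out[OF i]) (auto simp: endset_def)
      show "R i *v emb y s + t i \<in> X i \<union> cyl (E i) (R i) (t i)" using y(3) \<Omega>X[OF i] unfolding Cdef by simp
    qed
  next
    show "disjoint_family_on (\<lambda>i. endset (E i) (S i) (R i) (t i)) ?I"
      unfolding disjoint_family_on_def
    proof (intro ballI impI)
      fix i j assume ij: "i \<in> ?I" "j \<in> ?I" "i \<noteq> j"
      have "endset (E j) (S j) (R j) (t j) \<subseteq> C j" unfolding Cdef cyl_eq_endset using S(2)[OF ij(2)] by (auto simp: endset_def)
      then have "endset (E j) (S j) (R j) (t j) \<subseteq> X i" using ij unfolding X_def by blast
      then show "endset (E i) (S i) (R i) (t i) \<inter> endset (E j) (S j) (R j) (t j) = {}" using out[OF ij(1)] by blast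
    qed
  qed simp

  \<comment> \<open>Coercivity on the domain below the threshold\<close>
  have co: "sob.coercive (W0 \<Omega>) \<mu>" if "\<mu> < \<E>" for \<mu>
  proof -
    \<comment> \<open>The far ends: an axis coordinate of at least \<open>r0\<close> places a point
      outside the cube, and what remains of \<Omega> is bounded.\<close>
    define T where "T = (\<Union>i\<in>?I. endset (E i) {r0..} (R i) (t i))"
    have T\<Omega>: "T \<subseteq> \<Omega>" unfolding T_def \<Omega>def Cdef cyl_eq_endset using r0(1) by (auto simp: endset_def) force
    have mT: "T \<in> sets borel" unfolding T_def by (intro sets.finite_UN borel_endset R E) auto
    have ot: "x \<notin> X i" if i: "i \<in> ?I" and x: "x \<in> endset (E i) {r0..} (R i) (t i)" for i x
    proof (rule outside[OF i order_refl])
      have c: "cross (coord (R i) (t i) x) \<in> E i" "coord (R i) (t i) x $ None \<ge> r0"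
        using x unfolding mem_endset[OF R[OF i]] by auto
      then have "\<not> \<bar>coord (R i) (t i) x $ None\<bar> < r0" by simp
      then have "x \<notin> cube r0 (R i) (t i)" unfolding mem_cube[OF R[OF i]] by blast
      then show "x \<in> C i - cube r0 (R i) (t i)" using memC[OF i] c r0(1) by simp
    qed
    show ?thesis
    proof (rule coercive_of_tail[OF _ _ m\<Omega> that \<E>0, where B = "\<Omega> - T"])
      have bi: "bounded (C i - endset (E i) {r0..} (R i) (t i))" if i: "i \<in> ?I" for i
      proof -
        obtain M where M: "\<And>y. y \<in> E i \<Longrightarrow> norm y \<le> M" using E(2)[OF i] unfolding bounded_iff by blast
        have "norm x \<le> M + r0 + norm (t i)" if x: "x \<in> C i - endset (E i) {r0..} (R i) (t i)" for x
        proof -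
          let ?z = "coord (R i) (t i) x"
          have z: "cross ?z \<in> E i" "?z $ None > 0" "?z $ None < r0"
            using x by (auto simp: memC[OF i] mem_endset[OF R[OF i]])
          have "norm (x - t i) \<le> norm (cross ?z) + \<bar>?z $ None\<bar>"
            using norm_emb_le[of ?z] by (simp add: coord_inverse(3)[OF R[OF i]])
          also have "\<dots> \<le> M + r0" using M[OF z(1)] z by simp
          finally show ?thesis using norm_triangle_ineq2[of x "t i"] by linarith
        qed
        then show ?thesis unfolding bounded_iff by blast
      qed
      have "\<Omega> - T \<subseteq> \<Omega>0 \<union> (\<Union>i\<in>?I. C i - endset (E i) {r0..} (R i) (t i))" unfolding \<Omega>def T_def by blast
      moreover have "bounded (\<Omega>0 \<union> (\<Union>i\<in>?I. C i - endset (E i) {r0..} (R i) (t i)))"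
        using A1(1) bi by (simp add: bounded_UN)
      ultimately show "bounded (\<Omega> - T)" by (rule bounded_subset[rotated])
      show "\<Omega> - T \<in> sets lebesgue" using m\<Omega> mT by auto
      fix u assume u: "u \<in> Cc_inf \<Omega>"
      have s0: "{r0..} \<subseteq> {0<..}" using r0(1) by auto
      have "\<Omega> - (\<Omega> - T) = T" using T\<Omega> by blast
      then show "\<E> * (\<integral>x. indicator (\<Omega> - (\<Omega> - T)) x * (u x)\<^sup>2 \<partial>lebesgue) \<le> enL u u"
        using tail[of "\<lambda>_. {r0..}", OF _ s0 ot u] unfolding T_def by simp
    qed
  qed

  txt \<open>If a truncated set were empty, then \<open>\<Omega>\<close> would be a disjoint union of half-cylinders, which has no
    spectrum below \<open>\<E>\<close>.\<close>
  have ner: "\<Omega>r r \<noteq> {}" if r: "r \<ge> r0" for r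
  proof
    assume emp: "\<Omega>r r = {}"
    have Cc: "C i \<inter> cube r (R i) (t i) = {}" if "i \<in> ?I" for i using emp that unfolding \<Omega>rdef by blast
    have O: "\<Omega> = (\<Union>i\<in>?I. endset (E i) {0<..} (R i) (t i))"
      using emp \<Omega>0r[of r] unfolding \<Omega>def Cdef cyl_eq_endset by blast
    have ot: "x \<notin> X i" if i: "i \<in> ?I" and x: "x \<in> endset (E i) {0<..} (R i) (t i)" for i x
    proof (rule outside[OF i r])
      have "x \<in> C i" using x unfolding Cdef cyl_eq_endset .
      then show "x \<in> C i - cube r (R i) (t i)" using Cc[OF i] by blast
    qed
    \<comment> \<open>The zero term gives the inequality the shape of
      \<open>sob.estimate_dense\<close> with an empty family of functionals.\<close>
    have test: "\<E> * ipL u u \<le> enL u u + 0 * (\<Sum>i<0. (0::real)\<^sup>2)" if u: "u \<in> Cc_inf \<Omega>" for u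
    proof -
      have "ipL u u = (\<integral>x. indicator \<Omega> x * (u x)\<^sup>2 \<partial>lebesgue)"
        unfolding ipL_def using Cc_infD(5)[OF u]
        by (intro Bochner_Integration.integral_cong) (auto simp: indicator_def power2_eq_square)
      moreover have "\<E> * (\<integral>x. indicator \<Omega> x * (u x)\<^sup>2 \<partial>lebesgue) \<le> enL u u"
        using tail[of "\<lambda>_. {0<..}", OF _ _ ot u] unfolding O[symmetric] by simp
      ultimately show ?thesis by simp
    qed
    have dn: "\<E> * ipL u u \<le> enL u u" if u: "u \<in> W0 \<Omega>" for u
      using sob.estimate_dense[where M = 0 and C = 0 and f = "\<lambda>_ _. 0", OF W0_mono[OF subset_UNIV] W0_dense
          order_trans[OF Cc_inf_subset_W0 W0_mono[OF subset_UNIV]] _ test u] by simp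
    \<comment> \<open>With \<open>m = 0\<close> no orthogonality is imposed: every unit vector has
      energy at least \<open>\<E>\<close>, hence so has every level, contrary to
      \<open>gap\<close>.\<close>
    have "\<E> \<le> sob.minmax ell (W0 \<Omega>)"
    proof (rule sob.minmax_ge[OF W0_subsp W0_infinite_dim[OF o\<Omega> ne], where m = 0 and e = "\<lambda>_ _. 0"])
      show "0 < ell" using l by simp
      show "\<E> \<le> enL v v" if "v \<in> W0 \<Omega>" "ipL v v = 1" for v using dn[OF that(1)] that(2) by simp
    qed simp
    then show False using gap unfolding lam_eq[OF m\<Omega>] \<E>_def by simp
  qed

  \<comment> \<open>Truncated sets: coercivity and exhaustion\<close>
  define n0 where "n0 = nat \<lceil>r0\<rceil>"
  have n0: "n \<ge> n0 \<longleftrightarrow> real n \<ge> r0" for n unfolding n0_def by linarith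
  have bdr: "bounded (\<Omega>r r)" for r
  proof -
    have "bounded (cube r (R i) (t i))" if i: "i \<in> ?I" for i
    proof -
      have "norm x \<le> norm (t i) + (\<Sum>a\<in>(UNIV :: 'm option set). r)" if x: "x \<in> cube r (R i) (t i)" for x
      proof -
        have "norm (x - t i) = norm (coord (R i) (t i) x)" by (simp add: coord_inverse(3)[OF R[OF i]])
        also have "\<dots> \<le> (\<Sum>a\<in>UNIV. \<bar>coord (R i) (t i) x $ a\<bar>)" by (rule norm_le_l1_cart)
        also have "\<dots> \<le> (\<Sum>a\<in>(UNIV :: 'm option set). r)"
          using x unfolding mem_cube[OF R[OF i]] by (intro sum_mono) (auto simp: less_imp_le)
        finally show ?thesis using norm_triangle_ineq2[of x "t i"] by linarith
      qed
      then show ?thesis unfolding bounded_iff by blast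
    qed
    then show ?thesis unfolding \<Omega>rdef using A1(1) by (auto intro!: bounded_UN bounded_Un[THEN iffD2] bounded_Int)
  qed
  \<comment> \<open>The whole truncated set is bounded and is taken as \<open>B\<close>, so the tail
    is empty and the threshold may be put at any value above \<open>\<mu>\<close>.\<close>
  have cor: "sob.coercive (W0 (\<Omega>r r)) \<mu>" for r \<mu>
  proof (rule coercive_of_tail[OF bdr m\<Omega>r m\<Omega>r, where \<E> = "\<bar>\<mu>\<bar> + 1"])
    show "(\<bar>\<mu>\<bar> + 1) * (\<integral>x. indicator (\<Omega>r r - \<Omega>r r) x * (u x)\<^sup>2 \<partial>lebesgue) \<le> enL u u" if "u \<in> Cc_inf (\<Omega>r r)" for u
      using enL_Cc_inf[OF that] by simp
  qed auto
  have exhaust: "\<exists>n\<ge>n0. \<phi> \<in> Cc_inf (\<Omega>r (real n))" if \<phi>: "\<phi> \<in> Cc_inf \<Omega>" for \<phi>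
  proof -
    obtain M where M: "\<And>x. x \<in> closure {x. \<phi> x \<noteq> 0} \<Longrightarrow> norm x \<le> M"
      using compact_imp_bounded[OF Cc_infD(2)[OF \<phi>]] unfolding bounded_iff by blast
    \<comment> \<open>Coordinates relative to cylinder \<open>i\<close> are at most
      \<open>norm x + norm (t i)\<close>, so every cube of half-width \<open>n\<close> contains the
      support of \<open>\<phi>\<close>.\<close>
    define n where "n = max n0 (nat \<lceil>\<bar>M\<bar> + (\<Sum>i\<in>?I. norm (t i))\<rceil> + 1)"
    have nM: "M + norm (t i) < real n" if "i \<in> ?I" for i
    proof -
      have "norm (t i) \<le> (\<Sum>i\<in>?I. norm (t i))" using that by (intro member_le_sum) auto
      moreover have "\<bar>M\<bar> + (\<Sum>i\<in>?I. norm (t i)) < real n" unfolding n_def by linarith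
      ultimately show ?thesis by linarith
    qed
    have "closure {x. \<phi> x \<noteq> 0} \<subseteq> \<Omega>r (real n)"
    proof
      fix x assume x: "x \<in> closure {x. \<phi> x \<noteq> 0}"
      then have "x \<in> \<Omega>" using Cc_infD(3)[OF \<phi>] by blast
      then consider "x \<in> \<Omega>0" | i where "i \<in> ?I" "x \<in> C i" unfolding \<Omega>def by blast
      then show "x \<in> \<Omega>r (real n)"
      proof cases
        case 1
        then show ?thesis using \<Omega>0r by blast
      next
        case 2
        have "\<bar>coord (R i) (t i) x $ a\<bar> < real n" for a
        proof -
          have "\<bar>coord (R i) (t i) x $ a\<bar> \<le> norm (x - t i)"
            using component_le_norm_cart[of "coord (R i) (t i) x" a] by (simp add: coord_inverse(3)[OF R[OF 2(1)]])
          also have "\<dots> \<le> norm x + norm (t i)" by (rule norm_triangle_ineq4)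
          finally show ?thesis using M[OF x] nM[OF 2(1)] by linarith
        qed
        then have "x \<in> cube (real n) (R i) (t i)" unfolding mem_cube[OF R[OF 2(1)]] by blast
        then show ?thesis unfolding \<Omega>rdef using 2 by blast
      qed
    qed
    then have "\<phi> \<in> Cc_inf (\<Omega>r (real n))" using \<phi> by (simp add: Cc_inf_def)
    moreover have "n \<ge> n0" by (simp add: n_def)
    ultimately show ?thesis by blast
  qed

  \<comment> \<open>Eigenfunctions of the domain as limits of truncated ones\<close>
  obtain \<mu> where \<mu>: "lam ell \<Omega> < \<mu>" "\<mu> < \<E>" using gap dense unfolding \<E>_def by blast
  have "\<exists>U s u. (\<forall>n\<ge>n0. sob.eigsys (W0 (\<Omega>r (real n))) ell (U n)) \<and> strict_mono s \<and> (\<forall>n. s n \<ge> n0) \<and>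
      sob.eigsys (W0 \<Omega>) ell u \<and> (\<forall>i<ell. sob.conv (\<lambda>n. U (s n) i) (u i))"
  proof (rule sob.eigsys_approximation[OF W0_closed co[OF \<mu>(2)]])
    show "sob.minmax ell (W0 \<Omega>) < \<mu>" using \<mu>(1) unfolding lam_eq[OF m\<Omega>] .
    show "1 \<le> ell" using l by simp
    show "sob.closed_subsp (W0 (\<Omega>r (real n)))" for n by (rule W0_closed)
    show "W0 (\<Omega>r (real n)) \<subseteq> W0 (\<Omega>r (real m))" if "n \<le> m" for n m using that by (intro W0_mono \<Omega>rmono) simp
    show "W0 (\<Omega>r (real n)) \<subseteq> W0 \<Omega>" for n by (intro W0_mono \<Omega>r\<Omega>)
    show "sob.coercive (W0 (\<Omega>r (real n))) \<mu>'" for n \<mu>' by (rule cor)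
    show "\<exists>\<phi>. (\<forall>i<ell. \<phi> i \<in> W0 (\<Omega>r (real n))) \<and> sob.indep ell \<phi>" if "n \<ge> n0" for n
      using that n0 by (intro W0_infinite_dim o\<Omega>r ner) auto
    fix v \<epsilon> assume v: "v \<in> W0 \<Omega>" and \<epsilon>: "(\<epsilon>::real) > 0"
    obtain \<phi> where \<phi>: "\<And>k. \<phi> k \<in> Cc_inf \<Omega>" "sob.conv \<phi> v" using W0_dense[OF v] by blast
    have "\<forall>\<^sub>F k in sequentially. sqdist ipL (\<phi> k) v < \<epsilon> \<and> sqdist enL (\<phi> k) v < \<epsilon>"
      using \<phi>(2) \<epsilon> unfolding sob.conv_def sob.ip.conv_def sob.en.conv_def by (auto intro!: eventually_conj order_tendstoD(2))
    then obtain m where m: "sqdist ipL (\<phi> m) v < \<epsilon>" "sqdist enL (\<phi> m) v < \<epsilon>"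
      using eventually_happens sequentially_bot by fastforce
    obtain n where n: "n \<ge> n0" "\<phi> m \<in> Cc_inf (\<Omega>r (real n))" using exhaust[OF \<phi>(1)] by blast
    have H: "v \<in> W0 UNIV" "\<phi> m \<in> W0 UNIV" using v W0_mono[of \<Omega> UNIV] \<phi>(1)[of m] Cc_inf_subset_W0[of \<Omega>] by auto
    have "\<phi> m \<in> W0 (\<Omega>r (real n))" using n(2) Cc_inf_subset_W0 by blast
    then show "\<exists>n\<ge>n0. \<exists>w\<in>W0 (\<Omega>r (real n)). sqdist ipL v w < \<epsilon> \<and> sqdist enL v w < \<epsilon>"
      using n(1) m unfolding sob.ip.square_diff_commute[OF H(2,1)] sob.en.square_diff_commute[OF H(2,1)] by blast
  qed
  then obtain U s u where U: "\<And>n. n \<ge> n0 \<Longrightarrow> sob.eigsys (W0 (\<Omega>r (real n))) ell (U n)" and s: "strict_mono s" "\<And>n. s n \<ge> n0"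
    and u: "sob.eigsys (W0 \<Omega>) ell u" and conv: "\<And>i. i < ell \<Longrightarrow> sob.conv (\<lambda>n. U (s n) i) (u i)" by blast
  \<comment> \<open>The abstract systems are indexed from 0, the statement from 1; the shift
    \<open>m - 1\<close> loses nothing because \<open>m \<ge> 1\<close>.\<close>
  have eig: "eigenfun A (lam m A) (e (m - 1))" and orth: "m' \<in> {1..ell} \<Longrightarrow> m \<noteq> m' \<Longrightarrow> L2inner A (e (m - 1)) (e (m' - 1)) = 0"
    if A: "A \<in> sets lebesgue" and e: "sob.eigsys (W0 A) ell e" and m: "m \<in> {1..ell}" for A e m m'
  proof -
    have m1: "m - 1 < ell" "Suc (m - 1) = m" using m by auto
    note D = sob.eigsysD[OF e]
    show "eigenfun A (lam m A) (e (m - 1))"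
      unfolding eigenfun_iff[OF A] lam_eq[OF A] using D(1)[OF m1(1)] D(2)[OF m1(1) m1(1)] D(3)[OF m1(1)] m1(2) by simp
    assume m': "m' \<in> {1..ell}" "m \<noteq> m'"
    then have m1': "m' - 1 < ell" "m - 1 \<noteq> m' - 1" using m by auto
    have "e (m' - 1) \<in> W0 UNIV" using D(1)[OF m1'(1)] W0_mono[of A UNIV] by auto
    from L2inner_eq_ipL[OF A D(1)[OF m1(1)] this]
    show "L2inner A (e (m - 1)) (e (m' - 1)) = 0" using D(2)[OF m1(1) m1'(1)] m1'(2) by simp
  qed
  note D = sob.eigsysD[OF u]
  show ?thesis
  \<comment> \<open>The same system, and below the same subsequence, serve for every
    \<open>j\<close>.\<close>
  proof (intro ballI exI[of _ "\<lambda>m. u (m - 1)"] conjI impI)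
    fix j assume j: "j \<in> {1..ell}"
    have j1: "j - 1 < ell" "Suc (j - 1) = j" using j by auto
    show "eigenfun \<Omega> (lam m \<Omega>) (u (m - 1))" if "m \<in> {1..j}" for m
      by (rule eig[OF m\<Omega> u]) (use that j in auto)
    show "L2inner \<Omega> (u (m - 1)) (u (m' - 1)) = 0" if "m \<in> {1..j}" "m' \<in> {1..j}" "m \<noteq> m'" for m m'
      by (rule orth[OF m\<Omega> u]) (use that j in auto)
    have Dj: "Dirichlet \<Omega> (u (j - 1)) = sob.minmax j (W0 \<Omega>)"
      using Dirichlet_eq[OF m\<Omega> D(1)[OF j1(1)]] sob.en_eigsys[OF u j1(1)] j1(2) by simp
    show "lam j \<Omega> = Dirichlet \<Omega> (u (j - 1))" unfolding lam_eq[OF m\<Omega>] Dj ..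
    show "is_arg_min (Dirichlet \<Omega>) (\<lambda>v. v \<in> S2 \<Omega> \<and> (\<forall>m\<in>{1..<j}. L2inner \<Omega> v (u (m - 1)) = 0)) (u (j - 1))"
      unfolding is_arg_min_def
    proof (intro conjI notI ballI)
      show "u (j - 1) \<in> S2 \<Omega>" unfolding S2_eq[OF m\<Omega>] using D(1)[OF j1(1)] D(2)[OF j1(1) j1(1)] by simp
      show "L2inner \<Omega> (u (j - 1)) (u (m - 1)) = 0" if "m \<in> {1..<j}" for m
        by (rule orth[OF m\<Omega> u]) (use that j in auto)
      assume "\<exists>v. (v \<in> S2 \<Omega> \<and> (\<forall>m\<in>{1..<j}. L2inner \<Omega> v (u (m - 1)) = 0)) \<and> Dirichlet \<Omega> v < Dirichlet \<Omega> (u (j - 1))"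
      then obtain v where v: "v \<in> W0 \<Omega>" "ipL v v = 1" "\<forall>m\<in>{1..<j}. L2inner \<Omega> v (u (m - 1)) = 0"
        "Dirichlet \<Omega> v < Dirichlet \<Omega> (u (j - 1))" unfolding S2_eq[OF m\<Omega>] by blast
      have "ipL v (u i) = 0" if i: "i < j - 1" for i
      proof -
        have "Suc i \<in> {1..<j}" using i by auto
        then have "L2inner \<Omega> v (u (Suc i - 1)) = 0" using v(3) by blast
        moreover have "u i \<in> W0 UNIV" using D(1)[of i] i j1 W0_mono[of \<Omega> UNIV] by auto
        ultimately show ?thesis using L2inner_eq_ipL[OF m\<Omega> v(1)] by simp
      qed
      then have "sob.minmax (Suc (j - 1)) (W0 \<Omega>) \<le> enL v v"
        by (intro sob.eigsys_argmin[OF W0_subsp u j1(1) v(1,2)])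
      then show False using v(4) unfolding Dj Dirichlet_eq[OF m\<Omega> v(1)] j1(2) by simp
    qed
    show "\<exists>U. (\<forall>n::nat. real n \<ge> r0 \<longrightarrow>
         (\<forall>m\<in>{1..j}. eigenfun (\<Omega>r (real n)) (lam m (\<Omega>r (real n))) (U n m)) \<and>
         (\<forall>m\<in>{1..j}. \<forall>m'\<in>{1..j}. m \<noteq> m' \<longrightarrow> L2inner (\<Omega>r (real n)) (U n m) (U n m') = 0)) \<and>
       (\<exists>s. strict_mono s \<and> (\<forall>m\<in>{1..j}. (\<lambda>i. L2norm \<Omega> (\<lambda>x. U (s i) m x - u (m - 1) x)) \<longlonglongrightarrow> 0))"
    proof (intro exI[of _ "\<lambda>n m. U n (m - 1)"] exI[of _ s] conjI allI impI ballI)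
      fix n :: nat assume "real n \<ge> r0"
      then have n: "n \<ge> n0" using n0 by simp
      show "eigenfun (\<Omega>r (real n)) (lam m (\<Omega>r (real n))) (U n (m - 1))" if "m \<in> {1..j}" for m
        by (rule eig[OF m\<Omega>r U[OF n]]) (use that j in auto)
      show "L2inner (\<Omega>r (real n)) (U n (m - 1)) (U n (m' - 1)) = 0" if "m \<in> {1..j}" "m' \<in> {1..j}" "m \<noteq> m'" for m m'
        by (rule orth[OF m\<Omega>r U[OF n]]) (use that j in auto)
    next
      show "strict_mono s" by (rule s(1))
      fix m assume "m \<in> {1..j}"
      then have m1: "m - 1 < ell" using j by auto
      have "(\<lambda>x. U (s i) (m - 1) x - u (m - 1) x) \<in> W0 \<Omega>" for i
        using sob.eigsysD(1)[OF U[OF s(2)] m1, of i] W0_mono[OF \<Omega>r\<Omega>] D(1)[OF m1]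
        by (intro sob.subspD(5)[OF W0_subsp]) auto
      from L2norm_eq[OF m\<Omega> this]
      have "L2norm \<Omega> (\<lambda>x. U (s i) (m - 1) x - u (m - 1) x)
         = sqrt (sqdist ipL (U (s i) (m - 1)) (u (m - 1)))" for i .
      moreover have "(\<lambda>i. sqdist ipL (U (s i) (m - 1)) (u (m - 1))) \<longlonglongrightarrow> 0"
        using conv[OF m1] unfolding sob.conv_def sob.ip.conv_def by simp
      from tendsto_real_sqrt[OF this]
      have "(\<lambda>i. sqrt (sqdist ipL (U (s i) (m - 1)) (u (m - 1)))) \<longlonglongrightarrow> 0" by simp
      ultimately show "(\<lambda>i. L2norm \<Omega> (\<lambda>x. U (s i) (m - 1) x - u (m - 1) x)) \<longlonglongrightarrow> 0" by simp
    qed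
  qed
qed

end
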